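(* Let $\epsilon>0$, let $k \geq 3$ be an integer and let $n$ be a nonzero integer. Then $$PM_k(n, r_k)\ll |n|^{\frac{t_k}{k}+\epsilon}, \qquad PM_k\left(n, \frac{\log \log |n|+3.3}{\log (k-1)}+8\right) \ll |n|^{\frac{1}{k-2}+\epsilon},$$ where $r_3=9$, $r_4=6$, $r_5=5$, $r_k=4$ for $k\ge 6$, and $t_3=\frac{15399}{938}$, $t_4=\frac{34}{3}$, $t_5=\frac{97}{23}$, $t_6=\frac{29}{4}$, $t_k=\frac{k^2+k-4}{k^2-6k+6}$ for $k \geq 7$.
   Context: $\mathbb{N}$ denotes the set of positive integers; $\log$ is the natural logarithm. A pair $(A,B)$ of subsets of $\mathbb{N}$ has property $BD_k(n)$ if $|A|,|B|\geq 2$ and $ab+n\in\{x^k: x\in\mathbb{N}\}$ for all $a\in A$, $b\in B$. For real $R$, $PM_k(n,R)=\sup\{|A||B|: (A,B)\text{ has property } BD_k(n)\text{ and }\min\{|A|,|B|\}\ge R\}$. The notation $X\ll Y$ means $|X|\le CY$ for a constant $C$ (here the implied constants are independent of $n$). *)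

theory Defs
  imports "HOL-Analysis.Analysis"
begin

(* card is 0 on infinite sets, so the sizes |A| and |B| are taken in enat. *)
definition ecard :: "'a set \<Rightarrow> enat" where
  "ecard A = (if finite A then enat (card A) else \<infinity>)"

(* n may be negative, hence the integers; x ranges over positive integers only,
   so a * b + n = 0 does not count as a k-th power. *)
definition BD :: "nat \<Rightarrow> int \<Rightarrow> nat set \<Rightarrow> nat set \<Rightarrow> bool" where
  "BD k n A B \<longleftrightarrow>
     A \<subseteq> {0<..} \<and> B \<subseteq> {0<..} \<and> ecard A \<ge> 2 \<and> ecard B \<ge> 2 \<and>
     (\<forall>a\<in>A. \<forall>b\<in>B. int a * int b + n \<in> {int x ^ k | x :: nat. x > 0})"

(* In enat the supremum always exists; it is 0 when no pair (A, B) qualifies. *)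
definition PM :: "nat \<Rightarrow> int \<Rightarrow> real \<Rightarrow> enat" where
  "PM k n R = Sup {ecard A * ecard B | A B.
     BD k n A B \<and> ereal_of_enat (min (ecard A) (ecard B)) \<ge> ereal R}"

definition rk :: "nat \<Rightarrow> real" where
  "rk k = (if k = 3 then 9 else if k = 4 then 6 else if k = 5 then 5 else 4)"

definition tk :: "nat \<Rightarrow> real" where
  "tk k = (if k = 3 then 15399 / 938
          else if k = 4 then 34 / 3
          else if k = 5 then 97 / 23
          else if k = 6 then 29 / 4
          else (real k ^ 2 + real k - 4) / (real k ^ 2 - 6 * real k + 6))"

end

theory Submission
  imports Defs "HOL-Number_Theory.Cong" "HOL-Library.Infinite_Set"
begin

text \<open>Suppose \<open>a b + n\<close> is a \<open>k\<close>-th power for all \<open>a \<in> A\<close>, \<open>b \<in> B\<close>, let \<open>N\<close> be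
  \<open>\<bar>n\<bar>\<close> or a large constant, and measure all sizes by logarithms to base \<open>N\<close>.
  For \<open>a < a'\<close> and \<open>b < b'\<close>, comparing two distinct \<open>k\<close>-th powers gives the gap principle
  \<open>(a b) ^ (k - 1) \<lesssim> N ^ k a' b'\<close>. In the other direction, each \<open>a\<close> yields an approximation to
  \<open>(b / b') ^ (1 / k)\<close>, which diagonal Pade approximants to \<open>u ^ (1 / k)\<close> amplify; this
  bounds \<open>a'\<close> by a power of \<open>a\<close> once \<open>a\<close> is large compared with \<open>b'\<close>.
  Used with the roles of \<open>A\<close> and \<open>B\<close> exchanged, the two facts show first that a bounded number
  of elements of \<open>B\<close> at the top force \<open>A\<close> to grow quickly, and then that this growth is
  impossible: all but boundedly many \<open>b\<close> satisfy \<open>a b < N ^ t\<^sub>k\<close> for all \<open>a \<in> A\<close> but the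
  largest few.

  If \<open>A\<close> is bounded, counting the \<open>k\<close>-th roots leaves at most \<open>N ^ (t\<^sub>k / k)\<close> such \<open>b\<close>. If \<open>A\<close> is
  larger than a constant depending on \<open>\<epsilon>\<close>, there are only \<open>N ^ \<epsilon>\<close> of them: by the pigeonhole
  principle some nontrivial integral combination of the functions \<open>b \<mapsto> (a b + n) ^ (1 / k)\<close> is
  smaller than 1 on a short interval, hence vanishes at its integral points in \<open>B\<close>, while by
  Rolle's theorem it has few zeros. The second claim follows since its hypothesis makes both
  sets that large.\<close>

section \<open>Denominators of binomial coefficients\<close>

text \<open>The gap principle alone does not make \<open>A\<close> grow, because \<open>b'\<close>
  stands on its right side and is not bounded in terms of \<open>N\<close>; hence the detour through
  a chain of elements of \<open>B\<close>. In the other direction, the Pade form of one order only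
  keeps \<open>log N a'\<close> out of a window, so all orders are combined until the windows reach
  infinity. What survives is roughly \<open>(k - 1) * E' \<le> (3 * k + 1) * E\<close> for the
  exponents \<open>E\<close>, \<open>E'\<close> of \<open>a * b * b'\<close> and
  \<open>a' * b * b'\<close>. A contradiction needs exponents that grow by more than
  \<open>(3 * k + 1) / (k - 1)\<close>, which is 5, 13/3, 4 for \<open>k\<close> = 3, 4, 5 and below
  4 from 6 on. One growth step gains a factor just below \<open>k - 1\<close>, so three steps are
  spent on this for \<open>k = 3\<close> and two for larger \<open>k\<close>. Before them, 5, 3, 2
  and 1 steps for \<open>k\<close> = 3, 4, 5 and \<open>k \<ge> 6\<close> lift the exponents so far
  above \<open>log N b'\<close> that the Pade bound applies. With the starting element this uses 9,
  6, 5 and 4 elements of \<open>A\<close>, the numbers \<open>rk k\<close>. Starting at an exponent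
  of at least \<open>tk k\<close> keeps the additive losses affordable.\<close>

lemma multiplicity_fact_le:
  fixes p m :: nat
  assumes "prime p"
  shows "multiplicity p (fact m :: nat) \<le> m"
proof -
  have p2: "p \<ge> 2" using assms prime_ge_2_nat by blast
  have "multiplicity p (fact m :: nat) = (\<Sum>i\<in>{1..m}. multiplicity p i)"
    unfolding fact_prod of_nat_id using assms
    by (subst prime_elem_multiplicity_prod_distrib) auto
  \<comment> \<open>Double counting gives Legendre's formula. Exponents \<open>e > m\<close> do not
    occur, because \<open>p ^ e\<close> dividing \<open>i\<close> forces
    \<open>e < p ^ e \<le> i\<close>.\<close>
  also have "\<dots> = (\<Sum>i\<in>{1..m}. \<Sum>e\<in>{1..m}. if p ^ e dvd i then 1 else 0)"
  proof (rule sum.cong[OF refl])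
    fix i assume i: "i \<in> {1..m}"
    have iff: "p ^ e dvd i \<longleftrightarrow> e \<le> multiplicity p i" for e
      using i p2 by (intro power_dvd_iff_le_multiplicity) simp_all
    have "multiplicity p i < p ^ multiplicity p i" using p2 by (intro power_gt_expt) simp
    also have "\<dots> \<le> i" using i by (intro dvd_imp_le multiplicity_dvd) simp
    finally have le: "multiplicity p i \<le> m" using i by simp
    have "{e\<in>{1..m}. p ^ e dvd i} = {1..multiplicity p i}"
      unfolding iff using le by (intro set_eqI) (simp, linarith)
    thus "multiplicity p i = (\<Sum>e\<in>{1..m}. if p ^ e dvd i then 1 else 0)"
      by (simp flip: sum.inter_filter)
  qed
  also have "\<dots> = (\<Sum>e\<in>{1..m}. \<Sum>i\<in>{1..m}. if p ^ e dvd i then 1 else 0)"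
    by (rule sum.swap)
  also have "\<dots> = (\<Sum>e\<in>{1..m}. m div p ^ e)"
  proof (rule sum.cong[OF refl])
    fix e assume "e \<in> {1..m}"
    have "{i\<in>{1..m}. p ^ e dvd i} = (\<lambda>j. p ^ e * j) ` {1..m div p ^ e}"
    proof (intro set_eqI iffI)
      fix i assume "i \<in> {i\<in>{1..m}. p ^ e dvd i}"
      then obtain j where j: "i = p ^ e * j" "1 \<le> i" "i \<le> m" by (auto elim!: dvdE simp del: One_nat_def)
      hence "j \<noteq> 0" by auto
      hence "j \<in> {1..m div p ^ e}"
        using j p2 by (simp add: less_eq_div_iff_mult_less_eq mult.commute Suc_le_eq)
      with j show "i \<in> (\<lambda>j. p ^ e * j) ` {1..m div p ^ e}" by blast
    next
      fix i assume "i \<in> (\<lambda>j. p ^ e * j) ` {1..m div p ^ e}"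
      then obtain j where "i = p ^ e * j" "j \<in> {1..m div p ^ e}" by (rule imageE)
      hence j: "i = p ^ e * j" "1 \<le> j" "j \<le> m div p ^ e" unfolding atLeastAtMost_iff by blast+
      have "p ^ e * j \<le> p ^ e * (m div p ^ e)" using j by simp
      also have "\<dots> \<le> m" by simp
      finally have "i \<le> m" using j by simp
      moreover have "0 < i" using j p2 by simp
      ultimately show "i \<in> {i\<in>{1..m}. p ^ e dvd i}"
        using j(1) by (simp only: mem_Collect_eq atLeastAtMost_iff) (simp add: Suc_le_eq)
    qed
    hence "card {i\<in>{1..m}. p ^ e dvd i} = m div p ^ e"
      using p2 by (simp add: card_image inj_on_def)
    thus "(\<Sum>i\<in>{1..m}. if p ^ e dvd i then 1 else 0) = m div p ^ e"
      by (simp flip: sum.inter_filter)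
  qed
  finally have "real (multiplicity p (fact m :: nat)) = (\<Sum>e\<in>{1..m}. real (m div p ^ e))" by simp
  also have "\<dots> \<le> (\<Sum>e\<in>{1..m}. real m * (1/2) ^ e)"
  proof (rule sum_mono)
    fix e
    have "real (m div p ^ e) \<le> real m / real (p ^ e)" by (rule of_nat_div_le_of_nat)
    also have "\<dots> \<le> real m / 2 ^ e" using p2 by (intro divide_left_mono) (auto intro: power_mono)
    finally show "real (m div p ^ e) \<le> real m * (1/2) ^ e" by (simp add: power_divide)
  qed
  also have "\<dots> = real m * (\<Sum>e\<in>{1..m}. (1/2) ^ e)" by (simp add: sum_distrib_left)
  also have "(\<Sum>e\<in>{1..m}. (1/2::real) ^ e) = 1 - (1/2) ^ m"
    by (induction m) simp_all
  also have "real m * (1 - (1/2) ^ m) \<le> real m" by (simp add: mult_left_le)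
  finally show ?thesis by simp
qed

lemma fact_dvd_prod_int: "(fact m :: int) dvd (\<Prod>i<m. x - int i)"
proof -
  have "(\<Prod>i<m. x - int i) = (\<Prod>i = 0..<m. x - int i)" by (simp add: lessThan_atLeast0)
  also have "\<dots> = pochhammer (x - int m + 1) m" by (rule falling_fact_pochhammer')
  finally show ?thesis by (simp add: fact_dvd_pochhammer)
qed

text \<open>Primes dividing \<open>k\<close> are absorbed by \<open>k ^ m\<close>; modulo powers of the other primes
  \<open>k\<close> is invertible and the progression becomes one of consecutive integers.\<close>
lemma fact_dvd_arith_prog:
  fixes k m :: nat and c :: int
  assumes "k > 0"
  shows "(fact m :: int) dvd int k ^ m * (\<Prod>i<m. c - int k * int i)"
proof (cases "(\<Prod>i<m. c - int k * int i) = 0")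
  case False
  let ?P = "\<Prod>i<m. c - int k * int i"
  have "(fact m :: nat) dvd k ^ m * nat \<bar>?P\<bar>"
  proof (rule multiplicity_le_imp_dvd)
    show "(fact m :: nat) \<noteq> 0" by simp
    fix p :: nat assume p: "prime p"
    let ?v = "multiplicity p (fact m :: nat)"
    have nz: "k ^ m * nat \<bar>?P\<bar> \<noteq> 0" using False assms by simp
    have "p ^ ?v dvd k ^ m * nat \<bar>?P\<bar>"
    proof (cases "p dvd k")
      case True
      have "p ^ ?v dvd p ^ m" using multiplicity_fact_le[OF p] by (rule le_imp_power_dvd)
      also have "\<dots> dvd k ^ m" using True by (rule dvd_power_same)
      finally show ?thesis by simp
    next
      case False
      hence "coprime (int k) (int p ^ ?v)"
        using p by (metis coprime_commute coprime_int_iff coprime_power_left_iff of_nat_power prime_imp_coprime)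
      then obtain k' where k': "[int k * k' = 1] (mod int p ^ ?v)"
        using cong_solve_coprime_int by blast
      have "int p ^ ?v dvd fact m"
        by (metis multiplicity_dvd of_nat_dvd_iff of_nat_fact of_nat_power)
      also have "fact m dvd (\<Prod>i<m. c * k' - int i)" by (rule fact_dvd_prod_int)
      finally have "[int k ^ m * (\<Prod>i<m. c * k' - int i) = 0] (mod int p ^ ?v)"
        by (simp add: cong_0_iff)
      moreover have "int k ^ m * (\<Prod>i<m. c * k' - int i) = (\<Prod>i<m. int k * (c * k' - int i))"
        by (simp add: prod.distrib)
      moreover have "[(\<Prod>i<m. int k * (c * k' - int i)) = ?P] (mod int p ^ ?v)"
      proof (rule cong_prod)
        fix i
        have "[c * (int k * k') - int k * int i = c * 1 - int k * int i] (mod int p ^ ?v)"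
          by (intro cong_diff cong_mult cong_refl k')
        thus "[int k * (c * k' - int i) = c - int k * int i] (mod int p ^ ?v)"
          by (simp add: algebra_simps)
      qed
      ultimately have "int p ^ ?v dvd ?P" using cong_0_iff cong_trans cong_sym by metis
      hence "p ^ ?v dvd nat \<bar>?P\<bar>" by (simp flip: of_nat_power)
      thus ?thesis by simp
    qed
    thus "?v \<le> multiplicity p (k ^ m * nat \<bar>?P\<bar>)"
      using nz p by (intro multiplicity_geI) auto
  qed
  hence "int (fact m) dvd int (k ^ m * nat \<bar>?P\<bar>)" by (simp only: of_nat_dvd_iff)
  hence "fact m dvd int k ^ m * \<bar>?P\<bar>" by simp
  thus ?thesis by (metis abs_mult abs_of_nat dvd_abs_iff of_nat_power)
next
  case True
  show ?thesis unfolding True by simp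
qed

text \<open>One factor \<open>k ^ m\<close> clears the denominators of the \<open>m\<close> factors
  \<open>c / k - i\<close>; the other pays for the primes that \<open>k\<close> shares with
  \<open>fact m\<close>.\<close>

lemma gchoose_denominator:
  fixes k m :: nat and c :: int
  assumes "k > 0"
  shows "real k ^ (2 * m) * ((of_int c / real k) gchoose m) \<in> \<int>"
proof -
  from fact_dvd_arith_prog[OF assms, of m c] obtain z
    where z: "int k ^ m * (\<Prod>i<m. c - int k * int i) = fact m * z" by (auto elim: dvdE)
  have "(\<Prod>i = 0..<m. of_int c / real k - real i) * real k ^ m
        = (\<Prod>i<m. (of_int c / real k - real i) * real k)"
    by (simp add: prod.distrib lessThan_atLeast0)
  also have "\<dots> = (\<Prod>i<m. of_int (c - int k * int i))"
    using assms by (intro prod.cong) (auto simp: field_simps)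
  finally have e: "(\<Prod>i = 0..<m. of_int c / real k - real i) * real k ^ m
     = of_int (\<Prod>i<m. c - int k * int i)" by simp
  have "real k ^ (2 * m) * ((of_int c / real k) gchoose m)
        = real k ^ m * ((\<Prod>i = 0..<m. of_int c / real k - real i) * real k ^ m) / fact m"
    by (simp add: gbinomial_prod_rev power_add mult_2)
  also have "\<dots> = of_int (int k ^ m * (\<Prod>i<m. c - int k * int i)) / fact m"
    unfolding e by simp
  also have "\<dots> = of_int z" unfolding z by simp
  finally show ?thesis by simp
qed

section \<open>Pade approximants to powers\<close>

text \<open>Partial fractions of the reciprocal of a product of consecutive terms. Pascal's rule
  turns the sum for \<open>Suc r\<close> at \<open>c\<close> into the difference of the sums for
  \<open>r\<close> at \<open>c\<close> and at \<open>c + 1\<close>.\<close>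

lemma sum_alternating_binomial_div:
  fixes c :: real
  assumes "\<And>i. i \<le> r \<Longrightarrow> c + real i \<noteq> 0"
  shows "(\<Sum>i\<le>r. (-1) ^ i * real (r choose i) / (c + real i)) = fact r / (\<Prod>i\<le>r. c + real i)"
  using assms
proof (induction r arbitrary: c)
  case (Suc r)
  let ?S = "\<lambda>c. \<Sum>i\<le>r. (-1) ^ i * real (r choose i) / (c + real i)"
  let ?P = "\<Prod>i<r. c + 1 + real i"
  have "(\<Sum>i\<le>Suc r. (-1) ^ i * real (Suc r choose i) / (c + real i))
      = 1 / c + (\<Sum>i\<le>r. (-1) ^ Suc i * real (r choose Suc i) / (c + real (Suc i))
                 - (-1) ^ i * real (r choose i) / (c + 1 + real i))"
    unfolding sum.atMost_Suc_shift
    by (intro arg_cong2[where f = "(+)"] sum.cong refl)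
       (simp_all add: add_divide_distrib diff_divide_distrib ring_distribs add_ac)
  also have "\<dots> = (\<Sum>i\<le>Suc r. (-1) ^ i * real (r choose i) / (c + real i)) - ?S (c + 1)"
    by (simp add: sum.atMost_Suc_shift sum_subtractf del: sum.atMost_Suc)
  also have "\<dots> = ?S c - ?S (c + 1)" by simp
  also have "?S c = fact r / (\<Prod>i\<le>r. c + real i)"
    by (rule Suc.IH) (use Suc.prems in auto)
  also have "?S (c + 1) = fact r / (\<Prod>i\<le>r. c + 1 + real i)"
  proof (rule Suc.IH)
    fix i assume "i \<le> r"
    thus "c + 1 + real i \<noteq> 0" using Suc.prems[of "Suc i"] by (simp add: add_ac)
  qed
  also have p1: "(\<Prod>i\<le>r. c + real i) = c * ?P"
    unfolding lessThan_Suc_atMost[symmetric] by (subst prod.lessThan_Suc_shift) (simp add: add_ac)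
  also have p2: "(\<Prod>i\<le>r. c + 1 + real i) = ?P * (c + 1 + real r)"
    unfolding lessThan_Suc_atMost[symmetric] by simp
  also have "fact r / (c * ?P) - fact r / (?P * (c + 1 + real r)) = fact (Suc r) / (c * ?P * (c + 1 + real r))"
  proof -
    have "c \<noteq> 0" using Suc.prems[of 0] by simp
    moreover have "c + 1 + real r \<noteq> 0" using Suc.prems[of "Suc r"] by (simp add: add_ac)
    moreover have "?P \<noteq> 0"
    proof -
      have "c + 1 + real i \<noteq> 0" if "i < r" for i using Suc.prems[of "Suc i"] that by (simp add: add_ac)
      thus ?thesis by simp
    qed
    ultimately show ?thesis by (simp add: divide_simps) (simp add: algebra_simps)
  qed
  also have "c * ?P * (c + 1 + real r) = (\<Prod>i\<le>Suc r. c + real i)"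
    using p1 by (simp add: add_ac)
  finally show ?case .
qed simp

definition shift_prod :: "real \<Rightarrow> nat \<Rightarrow> real" where
  "shift_prod x n = (\<Prod>m<n. x + real (Suc m))"

text \<open>Coefficients of the diagonal Pade approximant of degree \<open>r\<close> to
  \<open>u powr \<nu>\<close>; numerator and denominator carry the same coefficients in opposite
  order. In this normalisation \<open>k ^ (2 * r)\<close> is a common denominator for
  \<open>\<nu> = 1 / k\<close>.\<close>

definition pade_coeff :: "real \<Rightarrow> nat \<Rightarrow> nat \<Rightarrow> real" where
  "pade_coeff \<nu> r j = ((real r + \<nu>) gchoose (r - j)) * ((real r - \<nu>) gchoose j)"

text \<open>This is \<open>\<nu>\<close> times the product of \<open>1 - \<nu>^2 / m^2\<close> over
  \<open>m\<close> from 1 to \<open>r\<close>, a partial product of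
  \<open>sin (pi * \<nu>) / pi\<close>.\<close>

definition pade_scale :: "real \<Rightarrow> nat \<Rightarrow> real" where
  "pade_scale \<nu> r = \<nu> * shift_prod \<nu> r * shift_prod (- \<nu>) r / fact r ^ 2"

text \<open>Stated without division, since \<open>shift_prod x j\<close> may vanish for arbitrary
  \<open>x\<close>.\<close>

lemma gchoose_shift_prod:
  "fact n * ((real (j + n) + x) gchoose n) * shift_prod x j = shift_prod x (j + n)"
proof (induction n)
  case (Suc n)
  have "((real (j + Suc n) + x) gchoose Suc n)
      = (real (j + n) + x + 1) / real (Suc n) * ((real (j + n) + x) gchoose n)"
    using gbinomial_factors[of "real (j + n) + x" n] by (simp add: add_ac)
  hence "fact (Suc n) * ((real (j + Suc n) + x) gchoose Suc n) * shift_prod x j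
      = (real (j + n) + x + 1) * (fact n * ((real (j + n) + x) gchoose n) * shift_prod x j)"
    by simp
  also have "\<dots> = shift_prod x (j + Suc n)"
    unfolding Suc.IH by (simp add: shift_prod_def add_ac)
  finally show ?case .
qed simp

lemma prod_shift_prod:
  "(\<Prod>m\<le>j + n. x - real n + real m) = (-1) ^ n * shift_prod (- x) n * x * shift_prod x j"
proof (induction j)
  case 0
  show ?case
  proof (induction n)
    case (Suc n)
    have "(\<Prod>m\<le>0 + Suc n. x - real (Suc n) + real m)
        = (x - real (Suc n)) * (\<Prod>m\<le>0 + n. x - real n + real m)"
      by (simp add: prod.atMost_Suc_shift algebra_simps del: prod.atMost_Suc)
    thus ?case unfolding Suc.IH by (simp add: shift_prod_def algebra_simps)
  qed (simp add: shift_prod_def)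
next
  case (Suc j)
  thus ?case by (simp add: shift_prod_def algebra_simps)
qed

text \<open>Identifies \<open>pade_coeff\<close> with the coefficients that arise when the remainder
  integral is expanded and summed by \<open>sum_alternating_binomial_div\<close>; this fixes the
  normalising factor \<open>pade_scale\<close>.\<close>

lemma pade_coeff_partial_fraction:
  assumes "j \<le> r"
  shows "pade_coeff \<nu> r j * (\<Prod>m\<le>r. \<nu> + real j - real r + real m)
       = (-1) ^ (r - j) * real (r choose j) * (fact r * pade_scale \<nu> r)"
proof -
  obtain n where r: "r = j + n" using assms le_Suc_ex by blast
  have "(\<Prod>m\<le>r. \<nu> + real j - real r + real m) = (\<Prod>m\<le>j + n. \<nu> - real n + real m)"
    by (simp add: r)
  hence "fact n * fact j * (pade_coeff \<nu> r j * (\<Prod>m\<le>r. \<nu> + real j - real r + real m))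
      = (-1) ^ n * \<nu> * (fact n * ((real (j + n) + \<nu>) gchoose n) * shift_prod \<nu> j)
        * (fact j * ((real (n + j) + (- \<nu>)) gchoose j) * shift_prod (- \<nu>) n)"
    unfolding prod_shift_prod by (simp add: pade_coeff_def r add_ac mult_ac)
  also have "\<dots> = (-1) ^ n * \<nu> * shift_prod \<nu> r * shift_prod (- \<nu>) r"
    unfolding gchoose_shift_prod by (simp add: r add_ac)
  also have "\<dots> = fact n * fact j * ((-1) ^ (r - j) * real (r choose j) * (fact r * pade_scale \<nu> r))"
    unfolding pade_scale_def r by (simp add: binomial_fact power2_eq_square)
  finally show ?thesis by simp
qed

section \<open>Integral formula for the Pade remainder\<close>

definition pade_rem :: "real \<Rightarrow> nat \<Rightarrow> real \<Rightarrow> real" where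
  "pade_rem \<nu> r u = (\<Sum>j\<le>r. pade_coeff \<nu> r j * (u ^ (r - j) - u powr (\<nu> + real j)))"

text \<open>Both binomials are expanded and the powers of \<open>w\<close> integrated. At
  \<open>w = 1\<close> the sum over \<open>i\<close> collapses by partial fractions and leaves the
  powers \<open>u ^ (r - j)\<close>; at \<open>w = u\<close> the sum over \<open>j\<close> collapses
  and leaves \<open>u powr \<nu>\<close> times the denominator.\<close>

lemma pade_rem_has_integral:
  assumes \<nu>: "0 < \<nu>" "\<nu> < 1" and u: "0 < u" "u \<le> 1"
  shows "((\<lambda>w. pade_scale \<nu> r * ((1 - w) ^ r * (w - u) ^ r * w powr (\<nu> - real r - 1)))
          has_integral pade_rem \<nu> r u) {u..1}"
proof -
  \<comment> \<open>As \<open>\<nu>\<close> is not an integer, no exponent vanishes and no logarithm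
    enters the antiderivative.\<close>
  have nz: "\<nu> + real i - real l \<noteq> 0" for i l :: nat
  proof
    assume "\<nu> + real i - real l = 0"
    hence "\<nu> = real_of_int (int l - int i)" by simp
    with \<nu> have "0 < int l - int i" "int l - int i < 1" by (simp_all del: of_int_diff)
    thus False by simp
  qed
  define e where "e = (\<lambda>i j. \<nu> + real j - real r + real i)"
  have enz: "e i j \<noteq> 0" for i j using nz[of "j + i" r] by (simp add: e_def algebra_simps)
  define c where "c = (\<lambda>i j. real (r choose i) * real (r choose j) * (-1) ^ i * (- u) ^ (r - j))"
  define G where "G = (\<lambda>w. \<Sum>j\<le>r. \<Sum>i\<le>r. c i j * (w powr e i j / e i j))"
  have "((\<lambda>w. (1 - w) ^ r * (w - u) ^ r * w powr (\<nu> - real r - 1)) has_integral G 1 - G u) {u..1}"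
  proof (rule fundamental_theorem_of_calculus[OF u(2)])
    fix w assume w: "w \<in> {u..1}"
    hence w0: "w > 0" using u by simp
    have ex: "(1 - w) ^ r * (w - u) ^ r = (\<Sum>j\<le>r. \<Sum>i\<le>r. c i j * w ^ (i + j))"
    proof -
      have "(1 - w) ^ r = (\<Sum>i\<le>r. real (r choose i) * (-1) ^ i * w ^ i)"
        using binomial_ring[of "- w" 1 r] by (simp add: power_minus[of w] mult_ac)
      moreover have "(w - u) ^ r = (\<Sum>j\<le>r. real (r choose j) * w ^ j * (- u) ^ (r - j))"
        using binomial_ring[of w "- u" r] by simp
      ultimately have "(1 - w) ^ r * (w - u) ^ r = (\<Sum>i\<le>r. \<Sum>j\<le>r. c i j * w ^ (i + j))"
        by (simp add: sum_product c_def power_add mult_ac)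
      thus ?thesis by (subst sum.swap)
    qed
    have "(G has_real_derivative (\<Sum>j\<le>r. \<Sum>i\<le>r. c i j * (w powr (e i j - 1)))) (at w)"
      unfolding G_def using enz w0
      by (auto intro!: derivative_eq_intros sum.cong simp: powr_diff field_simps)
    moreover have "(\<Sum>j\<le>r. \<Sum>i\<le>r. c i j * (w powr (e i j - 1)))
        = (1 - w) ^ r * (w - u) ^ r * w powr (\<nu> - real r - 1)"
    proof -
      have "w powr (e i j - 1) = w ^ (i + j) * w powr (\<nu> - real r - 1)" for i j
        using w0 by (simp add: e_def flip: powr_realpow powr_add) (simp add: algebra_simps)
      thus ?thesis unfolding ex sum_distrib_right by (simp add: mult_ac)
    qed
    ultimately show "(G has_vector_derivative (1 - w) ^ r * (w - u) ^ r * w powr (\<nu> - real r - 1)) (at w within {u..1})"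
      by (simp add: has_real_derivative_iff_has_vector_derivative has_vector_derivative_at_within)
  qed
  hence int: "((\<lambda>w. pade_scale \<nu> r * ((1 - w) ^ r * (w - u) ^ r * w powr (\<nu> - real r - 1)))
     has_integral pade_scale \<nu> r * (G 1 - G u)) {u..1}"
    by (rule has_integral_mult_right)
  have prnz: "(\<Prod>m\<le>r. \<nu> + real j - real r + real m) \<noteq> 0" for j
    using enz[of _ j] by (simp add: e_def)
  have Sj: "(\<Sum>i\<le>r. (-1) ^ i * real (r choose i) / (\<nu> + real j - real r + real i))
      = fact r / (\<Prod>m\<le>r. \<nu> + real j - real r + real m)" for j
    using enz[of _ j] by (intro sum_alternating_binomial_div) (auto simp: e_def)
  have q: "pade_scale \<nu> r * ((-1) ^ (r - j) * real (r choose j) * (\<Sum>i\<le>r. (-1) ^ i * real (r choose i) / (\<nu> + real j - real r + real i)))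
      = pade_coeff \<nu> r j" if "j \<le> r" for j
    unfolding Sj using pade_coeff_partial_fraction[OF that, of \<nu>] prnz[of j] by (simp add: field_simps)
  have G1: "pade_scale \<nu> r * G 1 = (\<Sum>j\<le>r. pade_coeff \<nu> r j * u ^ (r - j))"
    unfolding G_def sum_distrib_left
  proof (rule sum.cong[OF refl])
    fix j assume "j \<in> {..r}" hence j: "j \<le> r" by simp
    have "(\<Sum>i\<le>r. pade_scale \<nu> r * (c i j * (1 powr e i j / e i j)))
        = (pade_scale \<nu> r * ((-1) ^ (r - j) * real (r choose j) * (\<Sum>i\<le>r. (-1) ^ i * real (r choose i) / (\<nu> + real j - real r + real i)))) * u ^ (r - j)"
      by (simp add: c_def e_def power_minus[of u] sum_distrib_left sum_distrib_right mult_ac)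
    thus "(\<Sum>i\<le>r. pade_scale \<nu> r * (c i j * (1 powr e i j / e i j))) = pade_coeff \<nu> r j * u ^ (r - j)"
      unfolding q[OF j] .
  qed
  \<comment> \<open>\<open>q\<close> serves again with the two indices exchanged, because
    \<open>e i j\<close> is symmetric in \<open>i\<close> and \<open>j\<close>.\<close>
  have Gu: "pade_scale \<nu> r * G u = (\<Sum>j\<le>r. pade_coeff \<nu> r j * u powr (\<nu> + real j))"
    unfolding G_def sum_distrib_left
  proof (subst sum.swap, rule sum.cong[OF refl])
    fix i assume "i \<in> {..r}" hence i: "i \<le> r" by simp
    have "(\<Sum>j\<le>r. pade_scale \<nu> r * (c i j * (u powr e i j / e i j)))
       = (\<Sum>j\<le>r. pade_scale \<nu> r * ((-1) ^ (r - i) * real (r choose i) * ((-1) ^ j * real (r choose j) / (\<nu> + real i - real r + real j))) * u powr (\<nu> + real i))"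
    proof (rule sum.cong[OF refl])
      fix j assume "j \<in> {..r}" hence j: "j \<le> r" by simp
      have 1: "u powr e i j * u ^ (r - j) = u powr (\<nu> + real i)"
        using u j by (simp add: e_def of_nat_diff flip: powr_realpow powr_add) 
      have 2: "(-1::real) ^ i * (-1) ^ (r - j) = (-1) ^ (r - i) * (-1) ^ j"
        using i j by (simp add: minus_one_power_iff)
      have 3: "e i j = \<nu> + real i - real r + real j" by (simp add: e_def)
      have "c i j * (u powr e i j / e i j) = ((-1) ^ i * (-1) ^ (r - j)) * real (r choose i) * real (r choose j) * (u powr e i j * u ^ (r - j)) / e i j"
        by (simp add: c_def power_minus[of u] mult_ac)
      also have "\<dots> = ((-1) ^ (r - i) * (-1) ^ j) * real (r choose i) * real (r choose j) * u powr (\<nu> + real i) / (\<nu> + real i - real r + real j)"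
        unfolding 1 2 by (simp only: 3)
      finally show "pade_scale \<nu> r * (c i j * (u powr e i j / e i j)) = pade_scale \<nu> r * ((-1) ^ (r - i) * real (r choose i) * ((-1) ^ j * real (r choose j) / (\<nu> + real i - real r + real j))) * u powr (\<nu> + real i)"
        by (simp only: times_divide_eq_left times_divide_eq_right mult_ac)
    qed
    also have "\<dots> = (pade_scale \<nu> r * ((-1) ^ (r - i) * real (r choose i) * (\<Sum>j\<le>r. (-1) ^ j * real (r choose j) / (\<nu> + real i - real r + real j)))) * u powr (\<nu> + real i)"
      by (simp only: sum_distrib_left sum_distrib_right)
    also have "\<dots> = pade_coeff \<nu> r i * u powr (\<nu> + real i)" unfolding q[OF i] ..
    finally show "(\<Sum>j\<le>r. pade_scale \<nu> r * (c i j * (u powr e i j / e i j))) = pade_coeff \<nu> r i * u powr (\<nu> + real i)" .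
  qed
  have "pade_scale \<nu> r * (G 1 - G u) = pade_rem \<nu> r u"
    unfolding right_diff_distrib G1 Gu pade_rem_def by (simp add: right_diff_distrib sum_subtractf)
  with int show ?thesis by simp
qed

section \<open>Size of the remainder and of the coefficients\<close>

lemma shift_prod_pos: "x > -1 \<Longrightarrow> shift_prod x n > 0"
  unfolding shift_prod_def by (intro prod_pos) auto

lemma pade_scale_pos: "0 < \<nu> \<Longrightarrow> \<nu> < 1 \<Longrightarrow> 0 < pade_scale \<nu> r"
  unfolding pade_scale_def by (intro divide_pos_pos mult_pos_pos shift_prod_pos) auto

lemma pade_scale_Suc_le:
  assumes "0 < \<nu>" "\<nu> < 1"
  shows "pade_scale \<nu> (Suc r) \<le> pade_scale \<nu> r"
proof -
  have "pade_scale \<nu> (Suc r) = pade_scale \<nu> r * ((real (Suc r) ^ 2 - \<nu> ^ 2) / real (Suc r) ^ 2)"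
    by (simp add: pade_scale_def shift_prod_def power2_eq_square field_simps del: of_nat_Suc)
  also have "\<dots> \<le> pade_scale \<nu> r * 1"
    using pade_scale_pos[OF assms, of r] by (intro mult_left_mono) (auto simp: divide_le_eq)
  finally show ?thesis by simp
qed

lemma pade_scale_le_1:
  assumes "0 < \<nu>" "\<nu> < 1"
  shows "pade_scale \<nu> r \<le> 1"
proof (induction r)
  case (Suc r)
  thus ?case using pade_scale_Suc_le[OF assms, of r] by simp
qed (use assms in \<open>simp add: pade_scale_def shift_prod_def\<close>)

lemma gchoose_pos:
  fixes a :: real
  assumes "a > real n - 1"
  shows "a gchoose n > 0"
proof -
  have "(\<Prod>i = 0..<n. a - real i) > 0"
    using assms by (intro prod_pos) auto
  hence "fact n * (a gchoose n) > 0" by (simp only: gbinomial_mult_fact)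
  thus ?thesis by (simp add: zero_less_mult_iff)
qed

lemma pade_coeff_pos:
  assumes "0 < \<nu>" "\<nu> < 1" "j \<le> r"
  shows "pade_coeff \<nu> r j > 0"
  unfolding pade_coeff_def
proof (intro mult_pos_pos gchoose_pos)
  show "real (r - j) - 1 < real r + \<nu>" using assms by (simp add: of_nat_diff)
  show "real j - 1 < real r - \<nu>" using assms by linarith
qed

text \<open>Serves to compare the denominators of consecutive approximants. The first binomial gains
  a factor of at least 1, the second a nonnegative term by Pascal's rule.\<close>

lemma pade_coeff_mono:
  assumes "0 < \<nu>" "\<nu> < 1" "j \<le> r"
  shows "pade_coeff \<nu> r j \<le> pade_coeff \<nu> (Suc r) j"
proof -
  have 1: "(real r + \<nu>) gchoose (r - j) \<le> (real (Suc r) + \<nu>) gchoose (Suc r - j)"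
  proof -
    have pos: "(real r + \<nu>) gchoose (r - j) > 0" using assms by (intro gchoose_pos) (simp add: of_nat_diff)
    have "(real (Suc r) + \<nu>) gchoose (Suc r - j)
        = (real r + \<nu> + 1) / real (Suc (r - j)) * ((real r + \<nu>) gchoose (r - j))"
      using gbinomial_factors[of "real r + \<nu>" "r - j"] assms by (simp add: add_ac Suc_diff_le)
    moreover have "1 \<le> (real r + \<nu> + 1) / real (Suc (r - j))" using assms by (simp add: of_nat_diff)
    ultimately show ?thesis using pos mult_right_mono[of 1 _ "(real r + \<nu>) gchoose (r - j)"]
      by (metis less_imp_le mult_1)
  qed
  have 2: "(real r - \<nu>) gchoose j \<le> (real (Suc r) - \<nu>) gchoose j"
  proof (cases j)
    case (Suc i)
    have "(real (Suc r) - \<nu>) gchoose Suc i = ((real r - \<nu>) gchoose i) + ((real r - \<nu>) gchoose Suc i)"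
      using gbinomial_Suc_Suc[of "real r - \<nu>" i] by (simp add: algebra_simps)
    moreover have "(real r - \<nu>) gchoose i > 0" using assms Suc by (intro gchoose_pos) auto
    ultimately show ?thesis using Suc by simp
  qed simp
  have "(real r - \<nu>) gchoose j > 0" using assms by (intro gchoose_pos) linarith
  moreover have "(real (Suc r) + \<nu>) gchoose (Suc r - j) > 0"
    using assms by (intro gchoose_pos) (simp add: of_nat_diff)
  ultimately show ?thesis unfolding pade_coeff_def by (intro mult_mono 1 2) simp_all
qed

text \<open>Vandermonde's convolution: the parameters \<open>r + \<nu>\<close> and
  \<open>r - \<nu>\<close> add up to \<open>2 * r\<close>, so the sum is a central binomial
  coefficient.\<close>

lemma sum_pade_coeff_le: "(\<Sum>j\<le>r. pade_coeff \<nu> r j) \<le> 4 ^ r"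
proof -
  have "(\<Sum>j\<le>r. pade_coeff \<nu> r j) = (real r - \<nu> + (real r + \<nu>)) gchoose r"
    unfolding gbinomial_Vandermonde[symmetric] pade_coeff_def atLeast0AtMost by (simp add: mult.commute)
  also have "\<dots> = real ((2 * r) choose r)" by (simp add: binomial_gbinomial)
  also have "\<dots> \<le> real (2 ^ (2 * r))" unfolding of_nat_le_iff by (rule binomial_le_pow2)
  finally show ?thesis by (simp add: power_mult)
qed

lemma pade_rem_pos:
  assumes \<nu>: "0 < \<nu>" "\<nu> < 1" and u: "0 < u" "u < 1"
  shows "pade_rem \<nu> r u > 0"
proof -
  let ?f = "\<lambda>w. pade_scale \<nu> r * ((1 - w) ^ r * (w - u) ^ r * w powr (\<nu> - real r - 1))"
  have int: "(?f has_integral pade_rem \<nu> r u) {u..1}"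
    using pade_rem_has_integral[OF \<nu>] u by simp
  have nonneg: "0 \<le> ?f w" if "w \<in> {u..1}" for w
    using that pade_scale_pos[OF \<nu>, of r] by auto
  have "pade_rem \<nu> r u \<ge> 0" using has_integral_nonneg[OF int nonneg] .
  moreover have "pade_rem \<nu> r u \<noteq> 0"
  proof
    assume 0: "pade_rem \<nu> r u = 0"
    have "?f ((u + 1) / 2) = 0"
    proof (rule has_integral_0_cbox_imp_0[of u 1 ?f])
      show "continuous_on (cbox u 1) ?f" using u by (auto intro!: continuous_intros)
      show "(?f has_integral 0) (cbox u 1)" using int 0 by simp
    qed (use nonneg u in auto)
    moreover have "?f ((u + 1) / 2) > 0"
      using pade_scale_pos[OF \<nu>, of r] u by (intro mult_pos_pos zero_less_power) auto
    ultimately show False by linarith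
  qed
  ultimately show ?thesis by simp
qed

text \<open>The quotient of the two integrands is at most \<open>(1 - w) * (w - u) / w\<close>,
  which is at most 1/2 when \<open>1 / 2 \<le> u \<le> w \<le> 1\<close>.\<close>

lemma pade_rem_Suc_less:
  assumes \<nu>: "0 < \<nu>" "\<nu> < 1" and u: "1 / 2 \<le> u" "u < 1"
  shows "pade_rem \<nu> (Suc r) u < pade_rem \<nu> r u"
proof -
  let ?f = "\<lambda>r w. pade_scale \<nu> r * ((1 - w) ^ r * (w - u) ^ r * w powr (\<nu> - real r - 1))"
  have "pade_rem \<nu> (Suc r) u \<le> 1 / 2 * pade_rem \<nu> r u"
  proof (rule has_integral_le)
    show "(?f (Suc r) has_integral pade_rem \<nu> (Suc r) u) {u..1}"
      by (rule pade_rem_has_integral) (use \<nu> u in auto)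
    show "((\<lambda>w. 1 / 2 * ?f r w) has_integral 1 / 2 * pade_rem \<nu> r u) {u..1}"
      by (intro has_integral_mult_right pade_rem_has_integral) (use \<nu> u in auto)
    fix w assume w: "w \<in> {u..1}"
    have "(1 - w) * (w - u) \<le> (1/2) * (1/2)" using w u by (intro mult_mono) auto
    hence le: "(1 - w) * (w - u) / w \<le> 1 / 2" using w u by (simp add: divide_le_eq)
    have "w powr (\<nu> - real (Suc r) - 1) = w powr (\<nu> - real r - 1) / w"
      using w u powr_diff[of w "\<nu> - real r - 1" 1] by (simp add: algebra_simps)
    hence "?f (Suc r) w = (pade_scale \<nu> (Suc r) * ((1 - w) ^ r * (w - u) ^ r * w powr (\<nu> - real r - 1)))
         * ((1 - w) * (w - u) / w)" by (simp add: mult_ac)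
    also have "\<dots> \<le> ?f r w * (1 / 2)"
      using w u pade_scale_Suc_le[OF \<nu>, of r] pade_scale_pos[OF \<nu>, of r] le
      by (intro mult_mono mult_right_mono) auto
    finally show "?f (Suc r) w \<le> 1 / 2 * ?f r w" by simp
  qed
  also have "\<dots> < pade_rem \<nu> r u" using pade_rem_pos[OF \<nu>, of u r] u by simp
  finally show ?thesis .
qed

text \<open>The exponent \<open>2 * r + 1\<close> is the order of contact at \<open>u = 1\<close>:
  two factors of size at most \<open>1 - u\<close>, each to the power \<open>r\<close>, and the
  length of the interval. The power of 2 bounds the negative power of \<open>w\<close>, as
  \<open>w \<ge> 1 / 2\<close>.\<close>

lemma pade_rem_le:
  assumes \<nu>: "0 < \<nu>" "\<nu> < 1" and u: "1 / 2 \<le> u" "u < 1"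
  shows "pade_rem \<nu> r u \<le> 2 ^ Suc r * (1 - u) ^ (2 * r + 1)"
proof -
  let ?f = "\<lambda>r w. pade_scale \<nu> r * ((1 - w) ^ r * (w - u) ^ r * w powr (\<nu> - real r - 1))"
  have "pade_rem \<nu> r u \<le> (2 ^ Suc r * (1 - u) ^ (2 * r)) * (1 - u)"
  proof (rule has_integral_le)
    show "(?f r has_integral pade_rem \<nu> r u) {u..1}"
      by (rule pade_rem_has_integral) (use \<nu> u in auto)
    show "((\<lambda>w. 2 ^ Suc r * (1 - u) ^ (2 * r)) has_integral (2 ^ Suc r * (1 - u) ^ (2 * r)) * (1 - u)) {u..1}"
      using has_integral_const_real[of "2 ^ Suc r * (1 - u) ^ (2 * r)" u 1] u by (simp add: mult.commute)
    fix w assume w: "w \<in> {u..1}"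
    have "w powr (\<nu> - real r - 1) = w powr \<nu> / w ^ Suc r"
      using w u by (simp add: powr_realpow powr_diff flip: powr_add)
    also have "\<dots> \<le> 1 / (1/2) ^ Suc r"
    proof (intro frac_le power_mono)
      show "w powr \<nu> \<le> 1" using w u \<nu> by (intro powr_le1) auto
    qed (use w u in auto)
    finally have 1: "w powr (\<nu> - real r - 1) \<le> 2 ^ Suc r" by (simp add: power_divide)
    have 0: "(1 - w) ^ r * (w - u) ^ r \<le> (1 - u) ^ r * (1 - u) ^ r"
      using w u by (intro mult_mono power_mono) simp_all
    have 2: "(1 - w) ^ r * (w - u) ^ r * w powr (\<nu> - real r - 1) \<le> (1 - u) ^ r * (1 - u) ^ r * 2 ^ Suc r"
      using u by (intro mult_mono[OF 0 1]) simp_all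
    have "0 \<le> (1 - w) ^ r * (w - u) ^ r * w powr (\<nu> - real r - 1)" using w by simp
    hence "?f r w \<le> 1 * ((1 - u) ^ r * (1 - u) ^ r * 2 ^ Suc r)"
      by (intro mult_mono[OF pade_scale_le_1[OF \<nu>] 2]) simp_all
    also have "\<dots> = 2 ^ Suc r * (1 - u) ^ (2 * r)"
      unfolding mult_2[of r] power_add by (simp only: mult_1 mult_ac)
    finally show "?f r w \<le> 2 ^ Suc r * (1 - u) ^ (2 * r)" .
  qed
  thus ?thesis by (simp add: mult_ac)
qed

section \<open>Homogeneous forms, their independence and integrality\<close>

definition pade_form :: "real \<Rightarrow> nat \<Rightarrow> real \<Rightarrow> real \<Rightarrow> real" where
  "pade_form \<nu> r U V = (\<Sum>j\<le>r. pade_coeff \<nu> r j * U ^ j * V ^ (r - j))"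

lemma pade_form_pos:
  assumes "0 < \<nu>" "\<nu> < 1" "0 < U" "0 < V"
  shows "pade_form \<nu> r U V > 0"
  unfolding pade_form_def using assms by (intro sum_pos) (auto intro!: mult_pos_pos pade_coeff_pos)

lemma pade_form_le:
  assumes \<nu>: "0 < \<nu>" "\<nu> < 1" and UV: "0 < V" "V \<le> U"
  shows "pade_form \<nu> r U V \<le> 4 ^ r * U ^ r"
proof -
  have "pade_form \<nu> r U V \<le> (\<Sum>j\<le>r. pade_coeff \<nu> r j * U ^ r)"
    unfolding pade_form_def
  proof (rule sum_mono)
    fix j assume j: "j \<in> {..r}"
    have "pade_coeff \<nu> r j * U ^ j * V ^ (r - j) \<le> pade_coeff \<nu> r j * U ^ j * U ^ (r - j)"
      using UV pade_coeff_pos[OF \<nu>, of j r] j by (intro mult_left_mono power_mono) auto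
    also have "\<dots> = pade_coeff \<nu> r j * U ^ r" using j by (simp flip: power_add)
    finally show "pade_coeff \<nu> r j * U ^ j * V ^ (r - j) \<le> pade_coeff \<nu> r j * U ^ r" .
  qed
  also have "\<dots> = (\<Sum>j\<le>r. pade_coeff \<nu> r j) * U ^ r" by (simp add: sum_distrib_right)
  also have "\<dots> \<le> 4 ^ r * U ^ r" using UV by (intro mult_right_mono sum_pade_coeff_le) auto
  finally show ?thesis .
qed

text \<open>The remainder in homogeneous form:
  \<open>pade_form \<nu> r V U / pade_form \<nu> r U V\<close> approximates
  \<open>(U / V) powr \<nu>\<close>.\<close>

lemma pade_form_diff:
  assumes "0 < U" "0 < V"
  shows "U powr \<nu> * pade_form \<nu> r U V - V powr \<nu> * pade_form \<nu> r V U
       = U powr \<nu> * U ^ r * pade_rem \<nu> r (V / U)"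
proof -
  have "U powr \<nu> * (pade_coeff \<nu> r j * U ^ j * V ^ (r - j)) - V powr \<nu> * (pade_coeff \<nu> r j * V ^ j * U ^ (r - j))
      = U powr \<nu> * U ^ r * (pade_coeff \<nu> r j * ((V / U) ^ (r - j) - (V / U) powr (\<nu> + real j)))"
    if "j \<le> r" for j
  proof -
    have U: "U ^ r = U ^ j * U ^ (r - j)" using that by (simp flip: power_add)
    have "U powr \<nu> * U ^ r * ((V / U) powr (\<nu> + real j)) = V powr \<nu> * V ^ j * U ^ (r - j)"
      using assms by (simp add: powr_divide powr_add powr_realpow U)
    moreover have "U ^ r * (V / U) ^ (r - j) = U ^ j * V ^ (r - j)"
      using assms by (simp add: power_divide U)
    ultimately show ?thesis by (simp add: algebra_simps)
  qed
  thus ?thesis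
    unfolding pade_form_def pade_rem_def sum_distrib_left sum_subtractf[symmetric]
    by (intro sum.cong refl) auto
qed

lemma pade_form_scale:
  assumes "U > 0"
  shows "pade_form \<nu> r V U = U ^ r * (\<Sum>j\<le>r. pade_coeff \<nu> r j * (V / U) ^ j)"
  unfolding pade_form_def sum_distrib_left
proof (rule sum.cong[OF refl])
  fix j assume "j \<in> {..r}"
  hence "U ^ r = U ^ j * U ^ (r - j)" by (simp flip: power_add)
  thus "pade_coeff \<nu> r j * V ^ j * U ^ (r - j) = U ^ r * (pade_coeff \<nu> r j * (V / U) ^ j)"
    using assms by (simp add: power_divide)
qed

text \<open>No determinant is evaluated. If the two approximants agreed, their errors
  \<open>pade_rem \<nu> r u / B r\<close> would be equal; but from \<open>r\<close> to
  \<open>Suc r\<close> the remainder strictly decreases while the denominator \<open>B\<close> does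
  not.\<close>

lemma pade_form_independent:
  assumes \<nu>: "0 < \<nu>" "\<nu> < 1" and UV: "0 < V" "V < U" "U \<le> 2 * V"
  shows "pade_form \<nu> r U V * pade_form \<nu> (Suc r) V U \<noteq> pade_form \<nu> (Suc r) U V * pade_form \<nu> r V U"
proof
  assume eq: "pade_form \<nu> r U V * pade_form \<nu> (Suc r) V U = pade_form \<nu> (Suc r) U V * pade_form \<nu> r V U"
  define u where "u = V / U"
  have u: "1 / 2 \<le> u" "u < 1" "0 < u" using UV by (auto simp: u_def field_simps)
  have U: "U > 0" using UV by simp
  define B where "B = (\<lambda>r. \<Sum>j\<le>r. pade_coeff \<nu> r j * u ^ j)"
  have Bpos: "B r > 0" for r
    unfolding B_def using u by (intro sum_pos) (auto intro!: mult_pos_pos pade_coeff_pos \<nu>)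
  have Bmono: "B r \<le> B (Suc r)"
  proof -
    have "B r \<le> (\<Sum>j\<le>r. pade_coeff \<nu> (Suc r) j * u ^ j)"
      unfolding B_def using u by (intro sum_mono mult_right_mono pade_coeff_mono \<nu>) auto
    also have "\<dots> \<le> B (Suc r)"
      unfolding B_def using u pade_coeff_pos[OF \<nu>, of "Suc r" "Suc r"] by simp
    finally show ?thesis .
  qed
  have form: "pade_form \<nu> r V U = U ^ r * B r" for r
    using pade_form_scale[OF U] by (simp add: B_def u_def)
  have ratio: "U powr \<nu> * (pade_form \<nu> r U V / pade_form \<nu> r V U) = V powr \<nu> + U powr \<nu> * (pade_rem \<nu> r u / B r)" for r
  proof -
    have "U powr \<nu> * pade_form \<nu> r U V = V powr \<nu> * pade_form \<nu> r V U + U powr \<nu> * U ^ r * pade_rem \<nu> r u"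
      using pade_form_diff[OF U UV(1), of \<nu> r] by (simp add: u_def)
    thus ?thesis using U Bpos[of r] by (simp add: form add_divide_distrib)
  qed
  have "pade_form \<nu> r U V / pade_form \<nu> r V U = pade_form \<nu> (Suc r) U V / pade_form \<nu> (Suc r) V U"
    using eq pade_form_pos[OF \<nu> UV(1) U] by (simp add: frac_eq_eq less_imp_neq[THEN not_sym])
  hence "U powr \<nu> * (pade_rem \<nu> r u / B r) = U powr \<nu> * (pade_rem \<nu> (Suc r) u / B (Suc r))"
    using ratio[of r] ratio[of "Suc r"] by (metis add_left_cancel)
  moreover have "U powr \<nu> \<noteq> 0" using U by simp
  ultimately have "pade_rem \<nu> r u / B r = pade_rem \<nu> (Suc r) u / B (Suc r)"
    by (metis mult_left_cancel)
  moreover have "pade_rem \<nu> (Suc r) u / B (Suc r) < pade_rem \<nu> r u / B r"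
    using Bpos[of r] Bmono pade_rem_Suc_less[OF \<nu> u(1,2), of r] pade_rem_pos[OF \<nu> u(3,2), of "Suc r"]
    by (intro frac_less) auto
  ultimately show False by simp
qed

text \<open>The two binomials have upper arguments \<open>(r * k + 1) / k\<close> and
  \<open>(r * k - 1) / k\<close>; clearing them takes \<open>k\<close> to the powers
  \<open>2 * (r - j)\<close> and \<open>2 * j\<close>, whose product does not depend on
  \<open>j\<close>.\<close>

lemma pade_coeff_integer:
  assumes "k > 0" "j \<le> r"
  shows "real k ^ (2 * r) * pade_coeff (1 / real k) r j \<in> \<int>"
proof -
  have 1: "real r + 1 / real k = of_int (int r * int k + 1) / real k"
    and 2: "real r - 1 / real k = of_int (int r * int k - 1) / real k"
    using assms by (auto simp: field_simps)
  have "real k ^ (2 * r) = real k ^ (2 * (r - j)) * real k ^ (2 * j)"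
    unfolding power_add[symmetric] using assms by (intro arg_cong[where f = "(^) (real k)"]) simp
  hence "real k ^ (2 * r) * pade_coeff (1 / real k) r j
     = (real k ^ (2 * (r - j)) * ((of_int (int r * int k + 1) / real k) gchoose (r - j)))
       * (real k ^ (2 * j) * ((of_int (int r * int k - 1) / real k) gchoose j))"
    unfolding pade_coeff_def 1 2 by simp
  also have "\<dots> \<in> \<int>" by (intro Ints_mult gchoose_denominator assms)
  finally show ?thesis .
qed

lemma pade_form_integer:
  assumes "k > 0"
  shows "real k ^ (2 * r) * pade_form (1 / real k) r (real U) (real V) \<in> \<int>"
proof -
  have "real k ^ (2 * r) * pade_form (1 / real k) r (real U) (real V)
      = (\<Sum>j\<le>r. (real k ^ (2 * r) * pade_coeff (1 / real k) r j) * (real U ^ j * real V ^ (r - j)))"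
    unfolding pade_form_def sum_distrib_left by (simp add: mult_ac)
  also have "\<dots> \<in> \<int>"
    by (intro Ints_sum Ints_mult[of "_ * pade_coeff _ _ _"] pade_coeff_integer assms) auto
  finally show ?thesis .
qed

lemma powr_diff_le:
  fixes U V \<nu> :: real
  assumes "0 < V" "V \<le> U" "\<nu> \<le> 1"
  shows "U powr \<nu> - V powr \<nu> \<le> (U - V) * U powr (\<nu> - 1)"
proof -
  have "V * U powr (\<nu> - 1) \<le> V * V powr (\<nu> - 1)"
    using assms by (intro mult_left_mono powr_mono2') auto
  also have "\<dots> = V powr \<nu>" using assms by (simp add: powr_diff)
  finally have "V * U powr (\<nu> - 1) \<le> V powr \<nu>" .
  moreover have "U * U powr (\<nu> - 1) = U powr \<nu>" using assms by (simp add: powr_diff)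
  ultimately show ?thesis by (simp add: left_diff_distrib)
qed

text \<open>For a nonzero integer \<open>d\<close>: a difference of nonnegative numbers cannot reach
  size \<open>c\<close> unless one of them does.\<close>

lemma abs_diff_ge_1_cases:
  fixes x y c :: real
  assumes "0 < c" "0 \<le> x" "0 \<le> y" "\<bar>d\<bar> \<ge> 1" "c * d = x - y"
  shows "c \<le> x \<or> c \<le> y"
proof -
  have "c \<le> c * \<bar>d\<bar>" using assms by simp
  also have "\<dots> = \<bar>x - y\<bar>" using assms by (metis abs_mult abs_of_pos)
  finally show ?thesis using assms by linarith
qed

text \<open>If the approximation \<open>Y' / X'\<close> of \<open>(e / f) powr \<nu>\<close> differs from the one given by the
  Pade form of order \<open>s\<close>, then their integral cross difference has absolute value at least 1.
  Consecutive forms are independent, so this happens for \<open>s = r\<close> or \<open>s = r + 1\<close>.\<close>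
lemma pade_alternative:
  fixes k e f X Y X' Y' r :: nat
  defines "\<nu> \<equiv> 1 / real k"
  defines "U \<equiv> real (e * X ^ k)" and "V \<equiv> real (f * Y ^ k)"
  defines "U' \<equiv> real (e * X' ^ k)" and "V' \<equiv> real (f * Y' ^ k)"
  assumes k: "k \<ge> 2" and pos: "e > 0" "f > 0" "X > 0" "Y > 0" "X' > 0" "Y' > 0"
    and UV: "V < U" "U \<le> 2 * V" and UV': "V' < U'"
  shows "\<exists>s\<in>{r, Suc r}.
     (real e * real f) powr \<nu> \<le> real k ^ (2 * s) * (2 ^ Suc s * (U powr \<nu> * U ^ s * (1 - V / U) ^ (2 * s + 1))) * U' powr \<nu> \<or>
     (real e * real f) powr \<nu> \<le> real k ^ (2 * s) * (4 ^ s * U ^ s * U powr \<nu>) * ((U' - V') * U' powr (\<nu> - 1))"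
proof -
  have \<nu>: "0 < \<nu>" "\<nu> < 1" using k by (auto simp: \<nu>_def)
  have posR: "U > 0" "V > 0" "U' > 0" "V' > 0" using pos by (auto simp: U_def V_def U'_def V'_def)
  have root: "real (a * Z ^ k) powr \<nu> = real a powr \<nu> * real Z" if "Z > 0" for a Z :: nat
    using that k by (simp add: powr_mult \<nu>_def powr_powr flip: powr_realpow)
  note roots = root[OF pos(3), of e, folded U_def] root[OF pos(4), of f, folded V_def]
    root[OF pos(5), of e, folded U'_def] root[OF pos(6), of f, folded V'_def]
  define S where "S = (\<lambda>s. pade_form \<nu> s U V)"
  define T where "T = (\<lambda>s. pade_form \<nu> s V U)"
  define \<Delta> where "\<Delta> = (\<lambda>s. real k ^ (2 * s) * S s * (real X * real Y') - real k ^ (2 * s) * T s * (real Y * real X'))"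
  have Spos: "S s > 0" "T s > 0" for s
    unfolding S_def T_def using posR \<nu> by (auto intro: pade_form_pos)
  have int: "\<Delta> s \<in> \<int>" for s
    unfolding \<Delta>_def S_def T_def \<nu>_def U_def V_def using k
    by (intro Ints_diff Ints_mult[of "_ * pade_form _ _ _ _"] pade_form_integer) auto
  have "\<exists>s\<in>{r, Suc r}. \<Delta> s \<noteq> 0"
  proof (rule ccontr)
    assume "\<not> ?thesis"
    hence 0: "\<Delta> r = 0" "\<Delta> (Suc r) = 0" by auto
    have e: "S s * (real X * real Y') = T s * (real Y * real X')" if "\<Delta> s = 0" for s
      using that k by (simp add: \<Delta>_def)
    have "(S r * T (Suc r)) * ((real X * real Y') * (real Y * real X'))
        = (S (Suc r) * T r) * ((real X * real Y') * (real Y * real X'))"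
      using e[OF 0(1)] e[OF 0(2)] by (metis (no_types) mult.assoc mult.commute)
    hence "S r * T (Suc r) = S (Suc r) * T r" using pos by simp
    thus False
      using pade_form_independent[OF \<nu> posR(2) UV, of r] by (simp add: S_def T_def)
  qed
  then obtain s where s: "s \<in> {r, Suc r}" "\<Delta> s \<noteq> 0" by blast
  have "\<bar>\<Delta> s\<bar> \<ge> 1" using int[of s] s(2) by (rule Ints_nonzero_abs_ge1)
  define u where "u = V / U"
  have u: "1 / 2 \<le> u" "u < 1" "0 < u" using UV posR by (auto simp: u_def field_simps)
  let ?x = "real k ^ (2 * s) * (U powr \<nu> * U ^ s * pade_rem \<nu> s u) * U' powr \<nu>"
  let ?y = "real k ^ (2 * s) * (S s * U powr \<nu>) * (U' powr \<nu> - V' powr \<nu>)"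
  have "(real e * real f) powr \<nu> * \<Delta> s
      = real k ^ (2 * s) * (S s * U powr \<nu> * V' powr \<nu> - T s * V powr \<nu> * U' powr \<nu>)"
    unfolding \<Delta>_def roots by (simp add: powr_mult algebra_simps)
  \<comment> \<open>Adding and subtracting \<open>S s * U powr \<nu> * U' powr \<nu>\<close>
    separates the Pade remainder at \<open>(U, V)\<close> from the closeness of \<open>U'\<close>
    and \<open>V'\<close>.\<close>
  also have "\<dots> = real k ^ (2 * s) * (U powr \<nu> * S s - V powr \<nu> * T s) * U' powr \<nu> - ?y"
    by (simp add: algebra_simps)
  also have "U powr \<nu> * S s - V powr \<nu> * T s = U powr \<nu> * U ^ s * pade_rem \<nu> s u"
    unfolding S_def T_def u_def by (rule pade_form_diff[OF posR(1,2)])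
  finally have eq: "(real e * real f) powr \<nu> * \<Delta> s = ?x - ?y" .
  have "(real e * real f) powr \<nu> \<le> ?x \<or> (real e * real f) powr \<nu> \<le> ?y"
  proof (rule abs_diff_ge_1_cases[OF _ _ _ \<open>\<bar>\<Delta> s\<bar> \<ge> 1\<close> eq])
    show "0 \<le> ?x" using pade_rem_pos[OF \<nu> u(3,2), of s] posR by simp
    show "0 \<le> ?y" using Spos[of s] posR UV' \<nu> by (simp add: powr_mono2)
  qed (use pos in simp)
  moreover have "?x \<le> real k ^ (2 * s) * (2 ^ Suc s * (U powr \<nu> * U ^ s * (1 - V / U) ^ (2 * s + 1))) * U' powr \<nu>"
  proof -
    have "U powr \<nu> * U ^ s * pade_rem \<nu> s u \<le> U powr \<nu> * U ^ s * (2 ^ Suc s * (1 - u) ^ (2 * s + 1))"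
      using posR by (intro mult_left_mono pade_rem_le \<nu> u) auto
    also have "\<dots> = 2 ^ Suc s * (U powr \<nu> * U ^ s * (1 - V / U) ^ (2 * s + 1))"
      by (simp add: u_def mult_ac)
    finally show ?thesis by (intro mult_right_mono mult_left_mono) auto
  qed
  moreover have "?y \<le> real k ^ (2 * s) * (4 ^ s * U ^ s * U powr \<nu>) * ((U' - V') * U' powr (\<nu> - 1))"
  proof (rule mult_mono)
    show "real k ^ (2 * s) * (S s * U powr \<nu>) \<le> real k ^ (2 * s) * (4 ^ s * U ^ s * U powr \<nu>)"
      unfolding S_def using \<nu> posR UV by (intro mult_left_mono mult_right_mono pade_form_le) auto
    show "U' powr \<nu> - V' powr \<nu> \<le> (U' - V') * U' powr (\<nu> - 1)"
      using posR UV' \<nu> by (intro powr_diff_le) auto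
    show "0 \<le> U' powr \<nu> - V' powr \<nu>" using posR UV' \<nu> by (simp add: powr_mono2)
  qed (use posR in auto)
  ultimately show ?thesis using s(1) by (meson order_trans)
qed

section \<open>The gap principle and the Pade bound\<close>

abbreviation pos_power :: "nat \<Rightarrow> int \<Rightarrow> bool" where
  "pos_power k m \<equiv> m \<in> {int x ^ k | x :: nat. x > 0}"

lemma power_diff_ge:
  fixes p q k :: nat
  assumes "q < p" "k \<ge> 1"
  shows "q ^ k + p ^ (k - 1) \<le> p ^ k"
proof -
  have k: "x ^ k = x ^ (k - 1) * x" for x :: nat using assms by (metis One_nat_def Suc_pred less_eq_Suc_le power_Suc2)
  have "q ^ k + p ^ (k - 1) \<le> p ^ (k - 1) * q + p ^ (k - 1)"
    unfolding k[of q] using assms by (simp add: power_mono)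
  also have "\<dots> = p ^ (k - 1) * (q + 1)" by simp
  also have "\<dots> \<le> p ^ (k - 1) * p" using assms by (intro mult_left_mono) auto
  finally show ?thesis using k[of p] by simp
qed

lemma power_le_of_abs_diff:
  fixes p q :: nat and d :: int
  assumes "k \<ge> 1" "int p ^ k - int q ^ k = d" "d \<noteq> 0"
  shows "int p ^ (k - 1) \<le> \<bar>d\<bar>"
proof (cases "q < p")
  case True
  from power_diff_ge[OF this assms(1)] have "int (q ^ k + p ^ (k - 1)) \<le> int (p ^ k)"
    by (simp only: of_nat_le_iff)
  thus ?thesis using assms(2) by simp
next
  case False
  with assms have pq: "p < q" by (metis diff_self linorder_neqE_nat)
  from power_diff_ge[OF this assms(1)] have "int (p ^ k + q ^ (k - 1)) \<le> int (q ^ k)"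
    by (simp only: of_nat_le_iff)
  moreover have "int p ^ (k - 1) \<le> int q ^ (k - 1)" using pq by (intro power_mono) auto
  ultimately show ?thesis using assms(2) by simp
qed

text \<open>The \<open>k\<close>-th powers of \<open>x * y'\<close> and \<open>x' * y\<close> differ
  by \<open>n * (a' - a) * (b' - b)\<close>, so \<open>(x * y') ^ (k - 1)\<close> is at most
  \<open>N * a' * b'\<close>. On the other hand \<open>(x * y') ^ k\<close> is at least
  \<open>a * b * a' * b' / 4\<close>. Raising these to the powers \<open>k\<close> and
  \<open>k - 1\<close> and comparing cancels \<open>k - 1\<close> copies of
  \<open>a' * b'\<close>.\<close>

lemma gap_principle:
  fixes a a' b b' k :: nat and n :: int and N :: real
  assumes k: "k \<ge> 1" and n: "n \<noteq> 0" "\<bar>real_of_int n\<bar> \<le> N"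
    and a: "0 < a" "a < a'" and b: "0 < b" "b < b'" and ab: "2 * N \<le> real a * real b"
    and pw: "\<And>c d. c \<in> {a, a'} \<Longrightarrow> d \<in> {b, b'} \<Longrightarrow> pos_power k (int c * int d + n)"
  shows "real (k - 1) * (ln a + ln b) \<le> real (k - 1) * ln 4 + real k * ln N + ln a' + ln b'"
proof -
  obtain x y x' y' :: nat where xy:
      "int x ^ k = int a * int b + n" "int y ^ k = int a * int b' + n"
      "int x' ^ k = int a' * int b + n" "int y' ^ k = int a' * int b' + n"
    using pw[of a b] pw[of a b'] pw[of a' b] pw[of a' b'] by fastforce
  have Npos: "N \<ge> 1" using n by linarith
  have "int (x * y') ^ k - int (x' * y) ^ k = n * (int a' - int a) * (int b' - int b)"
    by (simp add: power_mult_distrib xy algebra_simps)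
  moreover have "n * (int a' - int a) * (int b' - int b) \<noteq> 0" using n a b by simp
  ultimately have "int (x * y') ^ (k - 1) \<le> \<bar>n * (int a' - int a) * (int b' - int b)\<bar>"
    by (rule power_le_of_abs_diff[OF k])
  also have "\<dots> = \<bar>n\<bar> * (int a' - int a) * (int b' - int b)" using a b by (simp add: abs_mult)
  also have "\<dots> \<le> \<bar>n\<bar> * int a' * int b'" using a b by (intro mult_mono) auto
  finally have "real_of_int (int (x * y') ^ (k - 1)) \<le> real_of_int (\<bar>n\<bar> * int a' * int b')"
    by (simp only: of_int_le_iff)
  hence 1: "real (x * y') ^ (k - 1) \<le> N * (real a' * real b')"
    using n(2) mult_right_mono[of "\<bar>real_of_int n\<bar>" N "real a' * real b'"] by (simp add: mult_ac)
  have half: "real c * real d / 2 \<le> real_of_int (int c * int d + n)"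
    if "c \<ge> a" "d \<ge> b" for c d
  proof -
    have "real a * real b \<le> real c * real d" using that by (intro mult_mono) auto
    thus ?thesis using ab n by simp
  qed
  have "real (x * y') ^ k = real_of_int (int a * int b + n) * real_of_int (int a' * int b' + n)"
    by (simp add: power_mult_distrib flip: xy)
  also have "\<dots> \<ge> (real a * real b / 2) * (real a' * real b' / 2)"
  proof (intro mult_mono half)
    show "0 \<le> real_of_int (int a * int b + n)" unfolding xy(1)[symmetric] by simp
  qed (use a b in auto)
  finally have 2: "(real a * real b) * (real a' * real b') / 4 \<le> real (x * y') ^ k" by simp
  have pos: "real a * real b > 0" "real a' * real b' > 0" using a b by auto
  have "((real a * real b) * (real a' * real b') / 4) ^ (k - 1) \<le> (real (x * y') ^ k) ^ (k - 1)"
    using 2 pos by (intro power_mono) auto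
  also have "\<dots> = (real (x * y') ^ (k - 1)) ^ k" by (simp add: mult.commute flip: power_mult)
  also have "\<dots> \<le> (N * (real a' * real b')) ^ k" using 1 by (intro power_mono) auto
  finally have le: "((real a * real b) * (real a' * real b') / 4) ^ (k - 1) \<le> (N * (real a' * real b')) ^ k" .
  have "0 < ((real a * real b) * (real a' * real b') / 4) ^ (k - 1)"
    using pos by (intro zero_less_power divide_pos_pos mult_pos_pos[of "real a * real b"]) simp_all
  from le this have "ln (((real a * real b) * (real a' * real b') / 4) ^ (k - 1)) \<le> ln ((N * (real a' * real b')) ^ k)"
    by (rule ln_mono)
  hence le: "real (k - 1) * (ln a + ln b + (ln a' + ln b') - ln 4) \<le> real k * (ln N + (ln a' + ln b'))"
    using a b Npos by (simp add: ln_realpow ln_mult ln_div)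
  define m where "m = real (k - 1)"
  have km: "real k = m + 1" using k by (simp add: m_def)
  show ?thesis using le unfolding m_def[symmetric] km by (simp add: algebra_simps)
qed

text \<open>The two alternatives of \<open>pade_alternative\<close> in logarithms, multiplied by
  \<open>k\<close> to remove the root. The constant \<open>c\<close> swallows all numerical factors:
  per unit of \<open>k * (s + 1)\<close> the powers of \<open>k\<close> cost at most
  \<open>2 * ln k\<close> and the powers of 2 at most \<open>3 * ln 2\<close>.\<close>

lemma pade_log_aux:
  fixes k e f X Y X' Y' r :: nat and E E' l :: real
  defines "U \<equiv> real (e * X ^ k)" and "V \<equiv> real (f * Y ^ k)"
  defines "U' \<equiv> real (e * X' ^ k)" and "V' \<equiv> real (f * Y' ^ k)"
  defines "c \<equiv> 2 * ln k + 3 * ln 2"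
  assumes k: "k \<ge> 2" and pos: "e > 0" "f > 0" "X > 0" "Y > 0" "X' > 0" "Y' > 0"
    and UV: "V < U" "U \<le> 2 * V" and UV': "V' < U'"
    and lnU: "E - ln 2 \<le> ln U" "ln U \<le> E + ln 2"
    and lnU': "E' - ln 2 \<le> ln U'" "ln U' \<le> E' + ln 2"
    and D: "ln (U - V) \<le> l" "ln (U' - V') \<le> l"
  shows "\<exists>s\<in>{r, Suc r}.
     ln e + ln f \<le> real k * (real s + 1) * c - (real k * (real s + 1) - 1) * E + real k * (2 * real s + 1) * l + E' \<or>
     ln e + ln f + (real k - 1) * E' \<le> real k * (real s + 1) * c + (real k * real s + 1) * E + real k * l"
proof -
  let ?\<nu> = "1 / real k"
  have posR: "U > 0" "V > 0" "U' > 0" "V' > 0" using pos by (auto simp: U_def V_def U'_def V'_def)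
  have k0: "real k > 0" using k by simp
  have D0: "U - V > 0" "U' - V' > 0" using UV UV' by auto
  obtain s where s: "s \<in> {r, Suc r}" and alt:
     "(real e * real f) powr ?\<nu> \<le> real k ^ (2 * s) * (2 ^ Suc s * (U powr ?\<nu> * U ^ s * (1 - V / U) ^ (2 * s + 1))) * U' powr ?\<nu> \<or>
     (real e * real f) powr ?\<nu> \<le> real k ^ (2 * s) * (4 ^ s * U ^ s * U powr ?\<nu>) * ((U' - V') * U' powr (?\<nu> - 1))"
    using pade_alternative[OF k pos, of r] UV UV' unfolding U_def V_def U'_def V'_def by blast
  have lnef: "ln ((real e * real f) powr ?\<nu>) = ?\<nu> * (ln e + ln f)"
    using pos by (simp add: ln_powr ln_mult)
  have DU: "1 - V / U = (U - V) / U" using posR by (simp add: field_simps)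
  have ln4: "ln 4 = 2 * ln (2::real)" using ln_realpow[of 2 2] by simp
  from alt show ?thesis
  proof
    assume A: "(real e * real f) powr ?\<nu> \<le> real k ^ (2 * s) * (2 ^ Suc s * (U powr ?\<nu> * U ^ s * (1 - V / U) ^ (2 * s + 1))) * U' powr ?\<nu>"
    let ?R = "real k ^ (2 * s) * (2 ^ Suc s * (U powr ?\<nu> * U ^ s * ((U - V) / U) ^ (2 * s + 1))) * U' powr ?\<nu>"
    have "ln ((real e * real f) powr ?\<nu>) \<le> ln ?R"
      using A posR k0 D0 pos unfolding DU by (subst ln_le_cancel_iff) (auto intro!: mult_pos_pos divide_pos_pos zero_less_power)
    also have "ln ?R = 2 * real s * ln k + (real s + 1) * ln 2 + (?\<nu> * ln U + real s * ln U + (2 * real s + 1) * (ln (U - V) - ln U)) + ?\<nu> * ln U'"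
    proof -
      have "ln (((U - V) / U) ^ (2 * s + 1)) = (2 * real s + 1) * (ln (U - V) - ln U)"
        using posR D0 by (subst ln_realpow) (auto simp: ln_div)
      moreover have "((U - V) / U) ^ (2 * s + 1) > 0" using posR D0 by simp
      ultimately show ?thesis
        using posR k0 D0 by (simp add: ln_mult ln_realpow ln_powr del: power_Suc power_Suc2 power_add)
    qed
    finally have "ln e + ln f \<le> real k * (2 * real s * ln k + (real s + 1) * ln 2 + (?\<nu> * ln U + real s * ln U + (2 * real s + 1) * (ln (U - V) - ln U)) + ?\<nu> * ln U')"
      unfolding lnef using k0 by (simp add: field_simps)
    also have "\<dots> = 2 * (real k * real s) * ln k + real k * (real s + 1) * ln 2 - (real k * (real s + 1) - 1) * ln U + real k * (2 * real s + 1) * ln (U - V) + ln U'"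
      using k0 by (simp add: field_simps)
    also have "\<dots> \<le> 2 * (real k * (real s + 1)) * ln k + real k * (real s + 1) * ln 2 - (real k * (real s + 1) - 1) * (E - ln 2) + real k * (2 * real s + 1) * l + (E' + ln 2)"
    proof -
      have "1 * 1 \<le> real k * (real s + 1)" using k by (intro mult_mono) auto
      hence "(real k * (real s + 1) - 1) * (E - ln 2) \<le> (real k * (real s + 1) - 1) * ln U"
        using lnU by (intro mult_left_mono) auto
      moreover have "real k * (2 * real s + 1) * ln (U - V) \<le> real k * (2 * real s + 1) * l"
        using D by (intro mult_left_mono) auto
      moreover have "2 * (real k * real s) * ln k \<le> 2 * (real k * (real s + 1)) * ln k"
        using k by (intro mult_right_mono) auto
      ultimately show ?thesis using lnU' by linarith
    qed
    also have "\<dots> = real k * (real s + 1) * (2 * ln k + 2 * ln 2) - (real k * (real s + 1) - 1) * E + real k * (2 * real s + 1) * l + E'"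
      by (simp add: algebra_simps)
    also have "\<dots> \<le> real k * (real s + 1) * c - (real k * (real s + 1) - 1) * E + real k * (2 * real s + 1) * l + E'"
      unfolding c_def by (intro add_right_mono diff_right_mono mult_left_mono) auto
    finally show ?thesis using s by blast
  next
    assume A: "(real e * real f) powr ?\<nu> \<le> real k ^ (2 * s) * (4 ^ s * U ^ s * U powr ?\<nu>) * ((U' - V') * U' powr (?\<nu> - 1))"
    let ?R = "real k ^ (2 * s) * (4 ^ s * U ^ s * U powr ?\<nu>) * ((U' - V') * U' powr (?\<nu> - 1))"
    have "ln ((real e * real f) powr ?\<nu>) \<le> ln ?R"
      using A posR k0 D0 pos by (subst ln_le_cancel_iff) (auto intro!: mult_pos_pos zero_less_power)
    also have "ln ?R = 2 * real s * ln k + (real s * (2 * ln 2) + real s * ln U + ?\<nu> * ln U) + (ln (U' - V') + (?\<nu> - 1) * ln U')"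
      using posR k0 D0 by (simp add: ln_mult ln_realpow ln_powr ln4)
    finally have "ln e + ln f \<le> real k * (2 * real s * ln k + (real s * (2 * ln 2) + real s * ln U + ?\<nu> * ln U) + (ln (U' - V') + (?\<nu> - 1) * ln U'))"
      unfolding lnef using k0 by (simp add: field_simps)
    also have "\<dots> = 2 * (real k * real s) * ln k + 2 * (real k * real s) * ln 2 + (real k * real s + 1) * ln U + real k * ln (U' - V') - (real k - 1) * ln U'"
      using k0 by (simp add: field_simps)
    also have "\<dots> \<le> 2 * (real k * (real s + 1)) * ln k + 2 * (real k * real s) * ln 2 + (real k * real s + 1) * (E + ln 2) + real k * l - (real k - 1) * (E' - ln 2)"
    proof -
      have "(real k * real s + 1) * ln U \<le> (real k * real s + 1) * (E + ln 2)"
        using lnU by (intro mult_left_mono) auto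
      moreover have "(real k - 1) * (E' - ln 2) \<le> (real k - 1) * ln U'"
        using lnU' k by (intro mult_left_mono) auto
      moreover have "real k * ln (U' - V') \<le> real k * l"
        using D by (intro mult_left_mono) auto
      moreover have "2 * (real k * real s) * ln k \<le> 2 * (real k * (real s + 1)) * ln k"
        using k by (intro mult_right_mono) auto
      ultimately show ?thesis by linarith
    qed
    also have "\<dots> = real k * (real s + 1) * (2 * ln k) + (3 * real k * real s + real k) * ln 2 + (real k * real s + 1) * E + real k * l - (real k - 1) * E'"
      by (simp add: algebra_simps)
    also have "\<dots> \<le> real k * (real s + 1) * (2 * ln k) + (real k * (real s + 1) * 3) * ln 2 + (real k * real s + 1) * E + real k * l - (real k - 1) * E'"
      by (intro add_right_mono diff_right_mono add_left_mono mult_right_mono) (auto simp: algebra_simps)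
    finally have "ln e + ln f + (real k - 1) * E' \<le> real k * (real s + 1) * c + (real k * real s + 1) * E + real k * l"
      by (simp add: c_def algebra_simps)
    thus ?thesis using s by blast
  qed
qed

text \<open>The identity \<open>b' * (a * b + n) - b * (a * b' + n) = n * (b' - b)\<close> does not
  involve \<open>a\<close>, so one bound \<open>l = ln N + ln b'\<close> serves for both differences
  in \<open>pade_log_aux\<close>. The hypothesis \<open>4 * N \<le> a * b\<close> keeps
  \<open>U\<close> and \<open>U'\<close> within a factor 2 of \<open>a * b * b'\<close> and
  \<open>a' * b * b'\<close>.\<close>

lemma pade_log:
  fixes a a' b b' k r :: nat and n :: int and N :: real
  defines "c \<equiv> 2 * ln k + 3 * ln 2"
  defines "E \<equiv> ln a + ln b + ln b'" and "E' \<equiv> ln a' + ln b + ln b'"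
  assumes k: "k \<ge> 2" and n: "n \<noteq> 0" "\<bar>real_of_int n\<bar> \<le> N"
    and a: "0 < a" "a < a'" and b: "0 < b" "b < b'" and ab: "4 * N \<le> real a * real b"
    and pw: "\<And>c d. c \<in> {a, a'} \<Longrightarrow> d \<in> {b, b'} \<Longrightarrow> pos_power k (int c * int d + n)"
  shows "\<exists>s\<in>{r, Suc r}.
     ln b + ln b' \<le> real k * (real s + 1) * c - (real k * (real s + 1) - 1) * E + real k * (2 * real s + 1) * (ln N + ln b') + E' \<or>
     ln b + ln b' + (real k - 1) * E' \<le> real k * (real s + 1) * c + (real k * real s + 1) * E + real k * (ln N + ln b')"
proof -
  obtain x y x' y' :: nat where xy:
      "int x ^ k = int a * int b + n" "int y ^ k = int a * int b' + n"
      "int x' ^ k = int a' * int b + n" "int y' ^ k = int a' * int b' + n"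
     and xpos: "x > 0" "y > 0" "x' > 0" "y' > 0"
    using pw[of a b] pw[of a b'] pw[of a' b] pw[of a' b'] by fastforce
  have R: "real x ^ k = real a * real b + n" "real y ^ k = real a * real b' + n"
      "real x' ^ k = real a' * real b + n" "real y' ^ k = real a' * real b' + n"
    using xy[THEN arg_cong[where f = real_of_int]] by simp_all
  have N: "N \<ge> 1" using n by linarith
  have Nb: "4 * N * real b' \<le> real d * real b * real b'" if "d \<ge> a" for d
  proof -
    have "real a * real b \<le> real d * real b" using that by (intro mult_right_mono) auto
    thus ?thesis using ab by (intro mult_right_mono) auto
  qed
  have near: "E0 - ln 2 \<le> ln w \<and> ln w \<le> E0 + ln 2"
    if w: "w = real d * real b * real b' + n * real z" and z: "z \<le> b'" and d: "d \<ge> a"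
      and E0: "E0 = ln d + ln b + ln b'" for w E0 d z
  proof -
    have P: "real d * real b * real b' > 0" using d a b by simp
    have "\<bar>n * real z\<bar> \<le> N * real b'" unfolding abs_mult using z n by (intro mult_mono) auto
    also have "\<dots> \<le> real d * real b * real b' / 4" using Nb[OF d] by simp
    finally have w1: "real d * real b * real b' / 2 \<le> w" "w \<le> real d * real b * real b' * 2"
      unfolding w using P by linarith+
    have "E0 - ln 2 = ln (real d * real b * real b' / 2)" "E0 + ln 2 = ln (real d * real b * real b' * 2)"
      using a b d by (simp_all add: E0 ln_div ln_mult)
    thus ?thesis using w1 P by simp
  qed
  have Dle: "ln (\<bar>real_of_int n\<bar> * (real b' - real b)) \<le> ln N + ln b'"
  proof -
    have "ln (\<bar>real_of_int n\<bar> * (real b' - real b)) \<le> ln (N * real b')"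
      using n N b by (subst ln_le_cancel_iff) (auto intro!: mult_mono mult_pos_pos)
    thus ?thesis using N b by (simp add: ln_mult)
  qed
  have Dpos: "\<bar>real_of_int n\<bar> * (real b' - real b) > 0" using n b by simp
  have Dhalf: "\<bar>real_of_int n\<bar> * (real b' - real b) \<le> N * real b'"
    using n N b by (intro mult_mono) auto
  show ?thesis
  \<comment> \<open>The forms require \<open>V < U\<close>, so the sign of \<open>n\<close> decides
    which of the two products is called \<open>U\<close>.\<close>
  proof (cases "n > 0")
    case True
    let ?U = "real (b' * x ^ k)" and ?V = "real (b * y ^ k)" and ?U' = "real (b' * x' ^ k)" and ?V' = "real (b * y' ^ k)"
    have UV: "?U - ?V = \<bar>real_of_int n\<bar> * (real b' - real b)" "?U' - ?V' = \<bar>real_of_int n\<bar> * (real b' - real b)"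
      using True by (simp_all add: R algebra_simps)
    have U: "?U = real a * real b * real b' + n * real b'" "?U' = real a' * real b * real b' + n * real b'"
      by (simp_all add: R algebra_simps)
    have U2: "?U \<le> 2 * ?V"
    proof -
      have "real_of_int n * real b' > 0" using True b by simp
      thus ?thesis using UV(1) Dhalf Nb[of a] U(1) Dpos by linarith
    qed
    show ?thesis
      using pade_log_aux[of k b' b x y x' y' E E' "ln N + ln b'" r, folded c_def]
        k a b xpos UV U2 Dpos Dle near[OF U(1)] near[OF U(2)]
      by (simp add: E_def E'_def add.commute[of "ln (real b')" "ln (real b)"])
  next
    case False
    let ?U = "real (b * y ^ k)" and ?V = "real (b' * x ^ k)" and ?U' = "real (b * y' ^ k)" and ?V' = "real (b' * x' ^ k)"
    have UV: "?U - ?V = \<bar>real_of_int n\<bar> * (real b' - real b)" "?U' - ?V' = \<bar>real_of_int n\<bar> * (real b' - real b)"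
      using False by (simp_all add: R algebra_simps)
    have U: "?U = real a * real b * real b' + n * real b" "?U' = real a' * real b * real b' + n * real b"
      by (simp_all add: R algebra_simps)
    have U2: "?U \<le> 2 * ?V"
    proof -
      have "\<bar>real_of_int n\<bar> * real b \<le> N * real b'" using n b N by (intro mult_mono) auto
      hence "- (N * real b') \<le> real_of_int n * real b" using False by simp
      thus ?thesis using UV(1) Dhalf Nb[of a] U(1) by linarith
    qed
    show ?thesis
      using pade_log_aux[of k b b' y x y' x' E E' "ln N + ln b'" r, folded c_def]
        k a b xpos UV U2 Dpos Dle near[OF U(1)] near[OF U(2)]
      by (simp add: E_def E'_def)
  qed
qed

text \<open>The windows for \<open>E'\<close> excluded by the forms of orders \<open>s \<ge> 2\<close> overlap, so only the
  values below the first of them survive.\<close>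
lemma windows_cover:
  fixes k E E' B l c :: real
  assumes k: "k \<ge> 3" and pos: "E > 0" "c > 0" "l > 0"
    and C1: "(k - 2) * E > 2 * (k - 1) * l + k * c"
    and C2: "(3 * k - 8) * E + B > (5 * k - 4) * l + (3 * k + 2) * c"
    and alt: "\<And>r. \<exists>s\<in>{r, Suc r}.
       B \<le> k * (real s + 1) * c - (k * (real s + 1) - 1) * E + k * (2 * real s + 1) * l + E' \<or>
       B + (k - 1) * E' \<le> k * (real s + 1) * c + (k * real s + 1) * E + k * l"
  shows "(k - 1) * E' \<le> (3 * k + 1) * E + k * l + 4 * k * c - B"
proof (rule ccontr)
  assume "\<not> ?thesis"
  hence big: "(k - 1) * E' > (3 * k + 1) * E + k * l + 4 * k * c - B" by simp
  \<comment> \<open>The alternative of order \<open>s\<close> reads \<open>Up s \<le> E'\<close> or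
    \<open>(k - 1) * E' \<le> Lo s\<close>, with both ends linear in \<open>s\<close>; the claim is
    \<open>(k - 1) * E' \<le> Lo 3\<close>.\<close>
  define Lo where "Lo = (\<lambda>r. k * (r + 1) * c + (k * r + 1) * E + k * l - B)"
  define Up where "Up = (\<lambda>r. B + (k * (r + 1) - 1) * E - k * (2 * r + 1) * l - k * (r + 1) * c)"
  define g where "g = k * (E - 2 * l - c)"
  have Lo_add: "Lo (r + t) = Lo r + t * (k * (c + E))" for r t by (simp add: Lo_def algebra_simps)
  have Up_add: "Up (r + t) = Up r + t * g" for r t by (simp add: Up_def g_def algebra_simps)
  \<comment> \<open>\<open>C1\<close> says that the upper end, scaled by \<open>k - 1\<close>, moves
    faster than the lower end.\<close>
  have slope: "(k - 1) * g > k * (c + E)"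
  proof -
    have "(k - 1) * g - k * (c + E) = k * ((k - 2) * E - 2 * (k - 1) * l - k * c)"
      by (simp add: g_def algebra_simps)
    also have "\<dots> > 0" using C1 k by (intro mult_pos_pos) auto
    finally show ?thesis by simp
  qed
  moreover have "k * (c + E) > 0" using k pos by simp
  ultimately have gpos: "g > 0" using k by (metis diff_gt_0_iff_gt less_le_trans less_trans one_less_numeral_iff semiring_norm(77) zero_less_mult_pos zero_less_numeral)
  \<comment> \<open>\<open>C2\<close> is the case \<open>i = 0\<close>. The orders differ by two,
    because \<open>alt\<close> does not tell which of two consecutive orders is effective.\<close>
  have UpLo: "(k - 1) * Up (2 + real i) > Lo (4 + real i)" for i :: nat
  proof -
    have "(k - 1) * Up 2 - Lo 4 = k * ((3 * k - 8) * E + B - (5 * k - 4) * l - (3 * k + 2) * c)"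
      by (simp add: Up_def Lo_def algebra_simps)
    also have "\<dots> > 0" using C2 k by (intro mult_pos_pos) auto
    finally have "(k - 1) * Up 2 > Lo 4" by simp
    moreover have "real i * (k * (c + E)) \<le> real i * ((k - 1) * g)" using slope by (intro mult_left_mono) auto
    ultimately show ?thesis unfolding Lo_add Up_add by (simp add: algebra_simps)
  qed
  have step: "E' \<ge> Up (2 + real i)" if "(k - 1) * E' > Lo (3 + real i)" for i :: nat
  proof -
    from alt[of "2 + i"] obtain s where s: "s \<in> {2 + i, Suc (2 + i)}" and
      a0: "B \<le> k * (real s + 1) * c - (k * (real s + 1) - 1) * E + k * (2 * real s + 1) * l + E' \<or>
       B + (k - 1) * E' \<le> k * (real s + 1) * c + (k * real s + 1) * E + k * l" by blast
    have a: "Up (real s) \<le> E' \<or> (k - 1) * E' \<le> Lo (real s)"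
      using a0 unfolding Up_def Lo_def by linarith
    define t where "t = real s - (2 + real i)"
    have t: "t \<in> {0, 1}" using s by (auto simp: t_def)
    have st: "real s = (2 + real i) + t" by (simp add: t_def)
    have "Lo ((2 + real i) + t) \<le> Lo ((2 + real i) + 1)"
      unfolding Lo_add using t k pos by auto
    also have "\<dots> = Lo (3 + real i)" by (simp add: add_ac)
    finally have "Up ((2 + real i) + t) \<le> E'" using a that unfolding st by linarith
    moreover have "Up (2 + real i) \<le> Up ((2 + real i) + t)" unfolding Up_add using t gpos by auto
    ultimately show ?thesis by simp
  qed
  have all: "(k - 1) * E' > Lo (3 + real i)" for i :: nat
  proof (induction i)
    case 0
    thus ?case using big by (simp add: Lo_def algebra_simps)
  next
    case (Suc i)
    have "Lo (3 + real (Suc i)) < (k - 1) * Up (2 + real i)" using UpLo[of i] by (simp add: add_ac)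
    also have "\<dots> \<le> (k - 1) * E'" using step[OF Suc] k by (intro mult_left_mono) auto
    finally show ?case .
  qed
  obtain i :: nat where "real i * g > E' - Up 2"
    using gpos reals_Archimedean3 by blast
  thus False using step[OF all[of i]] unfolding Up_add by simp
qed

section \<open>Both bounds in logarithms to base \<open>N\<close>, and the resulting growth\<close>

lemma log_gap:
  fixes a a' b b' k :: nat and n :: int and N :: real
  assumes k: "k \<ge> 1" and n: "n \<noteq> 0" "\<bar>real_of_int n\<bar> \<le> N" and N: "real k * ln 4 \<le> ln N / 100" "N > 1"
    and a: "0 < a" "a < a'" and b: "0 < b" "b < b'" and ab: "4 * N \<le> real a * real b"
    and pw: "\<And>c d. c \<in> {a, a'} \<Longrightarrow> d \<in> {b, b'} \<Longrightarrow> pos_power k (int c * int d + n)"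
  shows "(real k - 1) * (log N a + log N b) \<le> real k + 1 / 100 + log N a' + log N b'"
proof -
  have L: "ln N > 0" using N by simp
  have le: "real (k - 1) * (ln a + ln b) \<le> real (k - 1) * ln 4 + real k * ln N + ln a' + ln b'"
    by (rule gap_principle[OF k n a b _ pw]) (use ab N in auto)
  have "real (k - 1) * ln 4 \<le> ln N / 100"
    using N(1) by (rule order_trans[rotated]) (auto intro!: mult_right_mono)
  with le have "(real k - 1) * (ln a + ln b) \<le> (real k + 1 / 100) * ln N + ln a' + ln b'"
    using k by (simp add: of_nat_diff algebra_simps)
  hence "(real k - 1) * (ln a + ln b) / ln N \<le> ((real k + 1 / 100) * ln N + ln a' + ln b') / ln N"
    using L by (intro divide_right_mono) auto
  moreover have "(real k - 1) * (ln a + ln b) / ln N = (real k - 1) * (log N a + log N b)"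
    by (simp add: log_def add_divide_distrib distrib_left)
  moreover have "((real k + 1 / 100) * ln N + ln a' + ln b') / ln N = real k + 1 / 100 + log N a' + log N b'"
    using L by (simp add: log_def add_divide_distrib)
  ultimately show ?thesis by simp
qed

text \<open>\<open>windows_cover\<close> applied to \<open>pade_log\<close> and divided by
  \<open>ln N\<close>. The constant \<open>c\<close> is replaced by 1/100, whence the term
  \<open>k / 25\<close>.\<close>

lemma log_pade:
  fixes a a' b b' k :: nat and n :: int and N :: real
  defines "E \<equiv> log N a + log N b + log N b'" and "E' \<equiv> log N a' + log N b + log N b'"
    and "B \<equiv> log N b + log N b'"
  assumes k: "k \<ge> 3" and n: "n \<noteq> 0" "\<bar>real_of_int n\<bar> \<le> N"
    and N: "2 * ln k + 3 * ln 2 \<le> ln N / 100" "N > 1"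
    and a: "0 < a" "a < a'" and b: "0 < b" "b < b'" and ab: "4 * N \<le> real a * real b"
    and pw: "\<And>c d. c \<in> {a, a'} \<Longrightarrow> d \<in> {b, b'} \<Longrightarrow> pos_power k (int c * int d + n)"
    and C1: "(real k - 2) * E > 2 * (real k - 1) * (1 + log N b') + real k / 100"
    and C2: "(3 * real k - 8) * E + B > (5 * real k - 4) * (1 + log N b') + (3 * real k + 2) / 100"
  shows "(real k - 1) * E' \<le> (3 * real k + 1) * E + real k * (1 + log N b') + real k / 25 - B"
proof -
  define L where "L = ln N"
  have L: "L > 0" using N by (simp add: L_def)
  have E: "E * L = ln a + ln b + ln b'" and E': "E' * L = ln a' + ln b + ln b'" and B: "B * L = ln b + ln b'"
    and l: "(1 + log N b') * L = ln N + ln b'"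
    using L by (simp_all add: E_def E'_def B_def log_def L_def distrib_right)
  have Epos: "E > 0"
  proof -
    have "0 \<le> log N a" "0 \<le> log N b" "0 < log N b'" using N a b by (auto simp: Suc_le_eq)
    thus ?thesis by (simp add: E_def)
  qed
  have lpos: "1 + log N b' > 0" using N b by (intro add_pos_nonneg) auto
  have "(real k - 1) * (E' * L) \<le> (3 * real k + 1) * (E * L) + real k * ((1 + log N b') * L) + 4 * real k * (L / 100) - B * L"
  proof (rule windows_cover)
    show "(real k - 2) * (E * L) > 2 * (real k - 1) * ((1 + log N b') * L) + real k * (L / 100)"
      using mult_strict_right_mono[OF C1 L] by (simp add: algebra_simps)
    show "(3 * real k - 8) * (E * L) + B * L > (5 * real k - 4) * ((1 + log N b') * L) + (3 * real k + 2) * (L / 100)"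
      using mult_strict_right_mono[OF C2 L] by (simp add: algebra_simps)
    fix r
    have k2: "k \<ge> 2" using k by simp
    have "real k * (real s + 1) * (2 * ln k + 3 * ln 2) \<le> real k * (real s + 1) * (L / 100)" for s
      using N by (intro mult_left_mono) (auto simp: L_def)
    with pade_log[OF k2 n a b ab pw, of r]
    show "\<exists>s\<in>{r, Suc r}. B * L \<le> real k * (real s + 1) * (L / 100) - (real k * (real s + 1) - 1) * (E * L)
          + real k * (2 * real s + 1) * ((1 + log N b') * L) + E' * L \<or>
        B * L + (real k - 1) * (E' * L) \<le> real k * (real s + 1) * (L / 100) + (real k * real s + 1) * (E * L) + real k * ((1 + log N b') * L)"
      unfolding E E' B l by (smt (verit, ccfv_threshold))
  qed (use k L Epos lpos in auto)
  hence "((real k - 1) * E') * L \<le> ((3 * real k + 1) * E + real k * (1 + log N b') + real k / 25 - B) * L"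
    by (simp add: algebra_simps)
  thus ?thesis using L by simp
qed

text \<open>All demands on \<open>N\<close>: the numerical losses of the two bounds cost at most
  1/100 of \<open>ln N\<close>, and the last condition amounts to
  \<open>4 * N \<le> N powr tk k\<close>.\<close>

definition large_for :: "nat \<Rightarrow> real \<Rightarrow> bool" where
  "large_for k N \<longleftrightarrow> N > 1 \<and> real k * ln 4 \<le> ln N / 100 \<and> 2 * ln k + 3 * ln 2 \<le> ln N / 100
     \<and> ln 4 \<le> (tk k - 1) * ln N"

text \<open>If \<open>a'\<close> were small, the gap principle would make the \<open>b j\<close> grow so fast that two of them
  contradict the Pade bound for the pair \<open>(a, a')\<close>.\<close>
lemma log_growth:
  fixes a a' k J :: nat and b :: "nat \<Rightarrow> nat" and n :: int and N :: real
  assumes k: "k \<ge> 3" and n: "n \<noteq> 0" "\<bar>real_of_int n\<bar> \<le> N" and N: "large_for k N"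
    and J: "10000 * real k ^ 2 \<le> 2 ^ J"
    and a: "0 < a" "a < a'" and b: "0 < b 0" "\<And>j. j < J + 3 \<Longrightarrow> b j < b (Suc j)"
    and ab: "4 * N \<le> real a * real (b 0)"
    and pw: "\<And>c j. c \<in> {a, a'} \<Longrightarrow> j \<le> J + 3 \<Longrightarrow> pos_power k (int c * int (b j) + n)"
  shows "(real k - 1) * log N a + (real k - 2) * log N (b 0) - real k - 1 / 50 \<le> 101 / 100 * log N a'"
proof (rule ccontr)
  assume neg: "\<not> ?thesis"
  have N1: "N > 1" "real k * ln 4 \<le> ln N / 100" "2 * ln k + 3 * ln 2 \<le> ln N / 100"
    using N by (auto simp: large_for_def)
  have kR: "real k \<ge> 3" using k by simp
  define \<alpha> where "\<alpha> = log N a"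
  define \<alpha>' where "\<alpha>' = log N a'"
  define y where "y = (\<lambda>j. \<alpha> + log N (b j))"
  define Q where "Q = \<alpha>' - \<alpha> + real k + 1 / 100"
  \<comment> \<open>\<open>Q / (k - 2)\<close> is the fixed point of the recursion
    \<open>y (Suc j) \<ge> (k - 1) * y j - Q\<close> given by the gap principle; \<open>w\<close> is
    the scaled distance from it and gains a factor \<open>k - 1\<close> in each step.\<close>
  define w where "w = (\<lambda>j. (real k - 2) * y j - Q)"
  have \<alpha>: "0 \<le> \<alpha>" "\<alpha> \<le> \<alpha>'" using a N1 by (auto simp: \<alpha>_def \<alpha>'_def)
  have bmono: "b i \<le> b j" if "i \<le> j" "j \<le> J + 3" for i j
    using that
  proof (induction j rule: dec_induct)
    case (step m)
    thus ?case using b(2)[of m] by simp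
  qed simp
  have bstrict: "b i < b j" if "i < j" "j \<le> J + 3" for i j
  proof -
    have "b i < b (Suc i)" using b(2)[of i] that by simp
    also have "\<dots> \<le> b j" using that by (intro bmono) auto
    finally show ?thesis .
  qed
  have bpos: "0 < b j" if "j \<le> J + 3" for j using bmono[of 0 j] that b(1) by simp
  have abj: "4 * N \<le> real a * real (b j)" if "j \<le> J + 3" for j
    using ab bmono[of 0 j] that mult_left_mono[of "real (b 0)" "real (b j)" "real a"] by simp
  have y0: "1 \<le> y j" if "j \<le> J + 3" for j
  proof -
    have "log N N \<le> log N (real a * real (b j))"
      using abj[OF that] N1 a bpos[OF that] by (subst log_le_cancel_iff) auto
    thus ?thesis using N1 a bpos[OF that] by (simp add: y_def \<alpha>_def log_mult)
  qed
  have wstep: "w (Suc j) \<ge> (real k - 1) * w j" if "j < J + 3" for j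
  proof -
    have "(real k - 1) * (log N a + log N (b j)) \<le> real k + 1 / 100 + log N a' + log N (b (Suc j))"
      by (rule log_gap[OF _ n N1(2,1)])
         (use that k a b(2) bpos[of j] abj[of j] pw in auto)
    hence "(real k - 1) * y j - Q \<le> y (Suc j)"
      by (simp add: y_def \<alpha>_def \<alpha>'_def Q_def)
    hence "(real k - 2) * ((real k - 1) * y j - Q) \<le> (real k - 2) * y (Suc j)"
      using kR by (intro mult_left_mono) auto
    thus ?thesis unfolding w_def by (simp add: algebra_simps)
  qed
  \<comment> \<open>The terms 1/50 and 101/100 of the claim are chosen so that its negation starts
    \<open>w\<close> at a positive multiple of \<open>1 + \<alpha>'\<close>.\<close>
  have w0: "w 0 > (1 + \<alpha>') / 100"
    using neg by (simp add: w_def Q_def y_def \<alpha>_def \<alpha>'_def field_simps)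
  have wpow: "w j \<ge> 2 ^ j * ((1 + \<alpha>') / 100)" if "j \<le> J + 3" for j
    using that
  proof (induction j)
    case (Suc j)
    have "2 ^ Suc j * ((1 + \<alpha>') / 100) = 2 * (2 ^ j * ((1 + \<alpha>') / 100))" by simp
    also have "\<dots> \<le> 2 * w j" using Suc by (intro mult_left_mono) simp_all
    also have "\<dots> \<le> (real k - 1) * w j"
    proof (intro mult_right_mono)
      have "0 \<le> 2 ^ j * ((1 + \<alpha>') / 100)" using \<alpha> by simp
      thus "0 \<le> w j" using Suc by linarith
    qed (use kR in simp)
    also have "\<dots> \<le> w (Suc j)" using wstep[of j] Suc.prems by simp
    finally show ?case .
  qed (use w0 in simp)
  have wpos: "0 \<le> w j" if "j \<le> J + 3" for j
  proof -
    have "0 \<le> 2 ^ j * ((1 + \<alpha>') / 100)" using \<alpha> by simp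
    thus ?thesis using wpow[OF that] by linarith
  qed
  \<comment> \<open>Here \<open>J\<close> enters: the initial margin 1/100 becomes
    \<open>100 * k^2\<close>, so that from now on \<open>\<alpha>'\<close> is negligible against
    \<open>y J\<close>.\<close>
  have wJ: "w J \<ge> 100 * real k ^ 2 * (1 + \<alpha>')"
  proof -
    have "10000 * real k ^ 2 * ((1 + \<alpha>') / 100) \<le> 2 ^ J * ((1 + \<alpha>') / 100)"
      using J \<alpha> by (intro mult_right_mono) auto
    moreover have "10000 * real k ^ 2 * ((1 + \<alpha>') / 100) = 100 * real k ^ 2 * (1 + \<alpha>')" by simp
    ultimately show ?thesis using wpow[of J] by linarith
  qed
  \<comment> \<open>The Pade bound tolerates a factor of about
    \<open>(3 * k + 1) / (k - 1) \<le> 5\<close>; two doublings would not exceed it, three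
    do.\<close>
  have wJ3: "w (J + 3) \<ge> 8 * w J"
  proof -
    have two: "w (Suc j) \<ge> 2 * w j" if "j < J + 3" for j
    proof -
      have "2 * w j \<le> (real k - 1) * w j" using wpos[of j] that kR by (intro mult_right_mono) auto
      thus ?thesis using wstep[OF that] by linarith
    qed
    show ?thesis using two[of J] two[of "Suc J"] two[of "Suc (Suc J)"] by (simp add: numeral_3_eq_3)
  qed
  define Y where "Y = y J"
  have big: "100 * real k * (1 + \<alpha>') \<le> Y"
  proof -
    have "100 * real k * (real k * (1 + \<alpha>')) \<le> (real k - 2) * Y"
      using wJ \<alpha> kR by (simp add: w_def Q_def Y_def power2_eq_square algebra_simps)
    also have "\<dots> \<le> real k * Y" using y0[of J] by (intro mult_right_mono) (auto simp: Y_def)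
    finally have "real k * (100 * real k * (1 + \<alpha>')) \<le> real k * Y" by (simp add: mult_ac)
    thus ?thesis using kR by simp
  qed
  have k1: "3 * (1 + \<alpha>') \<le> real k * (1 + \<alpha>')" using \<alpha> kR by (intro mult_right_mono) auto
  define P where "P = real k * (1 + \<alpha>')"
  have P: "100 * P \<le> Y" "real k \<le> P" "3 * (1 + \<alpha>') \<le> P" "P > 0"
    using big k1 \<alpha> kR mult_left_mono[of 1 "1 + \<alpha>'" "real k"] by (auto simp: P_def mult_ac)
  have YJ3: "y (J + 3) \<ge> 7 * Y"
  proof -
    have "(real k - 2) * y (J + 3) \<ge> 8 * ((real k - 2) * Y) - 7 * (\<alpha>' - \<alpha> + real k + 1 / 100)"
      using wJ3 by (simp add: w_def Q_def Y_def)
    moreover have "7 * (\<alpha>' - \<alpha> + real k + 1 / 100) \<le> Y"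
    proof -
      show ?thesis using P \<alpha> by argo
    qed
    moreover have "Y \<le> (real k - 2) * Y" using kR y0[of J] mult_right_mono[of 1 "real k - 2" Y] by (simp add: Y_def)
    ultimately have "(real k - 2) * y (J + 3) \<ge> (real k - 2) * (7 * Y)" by linarith
    thus ?thesis using kR by simp
  qed
  have Yp: "Y > 0" using y0[of J] by (simp add: Y_def)
  have "(real k - 1) * (log N (b (J + 3)) + log N a + log N a')
     \<le> (3 * real k + 1) * (log N (b J) + log N a + log N a') + real k * (1 + log N a') + real k / 25 - (log N a + log N a')"
  proof (rule log_pade[OF k n N1(3,1)])
    show "4 * N \<le> real (b J) * real a" using abj[of J] by (simp add: mult.commute)
    show "b J < b (J + 3)" by (rule bstrict) auto
    show "pos_power k (int c * int d + n)" if "c \<in> {b J, b (J + 3)}" "d \<in> {a, a'}" for c d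
      using that pw[of d J] pw[of d "J + 3"] by (auto simp: mult.commute)
    have E: "log N (b J) + \<alpha> + \<alpha>' = Y + \<alpha>'" by (simp add: Y_def y_def)
    have "(real k - 2) * (Y + \<alpha>') \<ge> 1 * Y" using kR Yp \<alpha> by (intro mult_mono) auto
    moreover have "2 * (real k - 1) * (1 + \<alpha>') = 2 * P - 2 * (1 + \<alpha>')" by (simp add: P_def algebra_simps)
    ultimately show "2 * (real k - 1) * (1 + log N a') + real k / 100 < (real k - 2) * (log N (b J) + log N a + log N a')"
      unfolding \<alpha>'_def[symmetric] \<alpha>_def[symmetric] E using P \<alpha> by argo
    have "(3 * real k - 8) * (Y + \<alpha>') \<ge> 1 * Y" using kR Yp \<alpha> by (intro mult_mono) auto
    moreover have "(5 * real k - 4) * (1 + \<alpha>') = 5 * P - 4 * (1 + \<alpha>')" by (simp add: P_def algebra_simps)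
    ultimately show "(5 * real k - 4) * (1 + log N a') + (3 * real k + 2) / 100
       < (3 * real k - 8) * (log N (b J) + log N a + log N a') + (log N a + log N a')"
      unfolding \<alpha>'_def[symmetric] \<alpha>_def[symmetric] E using P \<alpha> kR by argo
  qed (use a bpos[of J] in auto)
  hence "(real k - 1) * (y (J + 3) + \<alpha>') \<le> (3 * real k + 1) * (Y + \<alpha>') + real k * (1 + \<alpha>') + real k / 25 - (\<alpha> + \<alpha>')"
    by (simp add: y_def Y_def \<alpha>_def \<alpha>'_def add_ac)
  moreover have "(real k - 1) * (7 * Y) \<le> (real k - 1) * (y (J + 3) + \<alpha>')"
    using YJ3 \<alpha> kR by (intro mult_left_mono) auto
  moreover have "(3 * real k + 1) * \<alpha>' = 3 * P - 3 * real k + \<alpha>'" by (simp add: P_def algebra_simps)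
  moreover have "real k * (1 + \<alpha>') = P" by (simp add: P_def)
  ultimately have "(7 * real k - 7) * Y \<le> (3 * real k + 1) * Y + 6 * P"
    using \<alpha> P kR by (simp add: algebra_simps)
  also have "\<dots> \<le> (3 * real k + 1) * Y + Y" using P by simp
  finally have "(4 * real k - 9) * Y \<le> 0" by (simp add: algebra_simps)
  thus False using Yp kR by (simp add: mult_le_0_iff)
qed

section \<open>Bounding the products\<close>

definition rk_nat :: "nat \<Rightarrow> nat" where
  "rk_nat k = (if k = 3 then 9 else if k = 4 then 6 else if k = 5 then 5 else 4)"

lemma real_rk_nat: "real (rk_nat k) = rk k"
  by (simp add: rk_nat_def rk_def)

lemma tk_gt_1:
  assumes k: "k \<ge> 3"
  shows "tk k > 1"
proof (cases "k \<ge> 7")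
  case True
  have "7 * real k \<le> real k * real k" using True by (intro mult_right_mono) auto
  hence "real k ^ 2 - 6 * real k + 6 > 0" by (simp add: power2_eq_square)
  thus ?thesis using True by (simp add: tk_def divide_simps)
next
  case False
  with k have "k \<in> {3, 4, 5, 6}" by auto
  thus ?thesis by (auto simp: tk_def)
qed

text \<open>The numbers come from the target \<open>s 1 \<ge> 27 / 10 * (1 + s 0)\<close> in
  \<open>growth_contradiction\<close>. Since 101/100 times 27/10 is 2727/1000, adding the 1 of
  \<open>k - 1\<close> gives 3727/1000, and adding 1/50 gives 2747/1000.\<close>

lemma tk_large:
  assumes "k \<ge> 6"
  shows "(real k - 3727 / 1000) * tk k \<ge> real k + 2747 / 1000"
proof (cases "k = 6")
  case False
  define K where "K = real k"
  have K: "K \<ge> 7" using assms False by (simp add: K_def)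
  have "7 * K \<le> K * K" using K by (intro mult_right_mono) auto
  hence D: "K ^ 2 - 6 * K + 6 > 0" unfolding power2_eq_square using K by linarith
  have "(K + 2747 / 1000) * (K ^ 2 - 6 * K + 6) \<le> (K - 3727 / 1000) * (K ^ 2 + K - 4)"
  proof -
    have "(K - 3727 / 1000) * (K ^ 2 + K - 4) - (K + 2747 / 1000) * (K ^ 2 - 6 * K + 6) = 263 / 500 * (K * K) + 551 / 200 * K - 787 / 500"
      by (simp add: power2_eq_square algebra_simps add_divide_distrib diff_divide_distrib)
    also have "\<dots> \<ge> 0" using K \<open>7 * K \<le> K * K\<close> by linarith
    finally show ?thesis by simp
  qed
  hence "K + 2747 / 1000 \<le> (K - 3727 / 1000) * (K ^ 2 + K - 4) / (K ^ 2 - 6 * K + 6)"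
    by (simp only: pos_le_divide_eq[OF D])
  moreover have "tk k = (K ^ 2 + K - 4) / (K ^ 2 - 6 * K + 6)"
    using K unfolding K_def tk_def by auto
  ultimately show ?thesis unfolding K_def[symmetric] by simp
qed (simp add: tk_def)

text \<open>The exponent \<open>s i\<close> is that of \<open>a i * b 1\<close>, and \<open>x\<close>, \<open>y\<close> are those of \<open>b 0\<close> and \<open>b 1\<close>.\<close>
lemma growth_contradiction:
  fixes k :: nat and s :: "nat \<Rightarrow> real" and x y :: real
  assumes k: "k \<ge> 3"
    and growth: "\<And>i. Suc i < rk_nat k \<Longrightarrow> (real k - 1) * s i - real k - 1 / 50 \<le> 101 / 100 * s (Suc i)"
    and xy: "0 \<le> x" "x \<le> y" "y \<le> s 0" "tk k \<le> s 0"
    and pade: "\<And>i i'. i < i' \<Longrightarrow> i' < rk_nat k \<Longrightarrow>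
       (real k - 2) * (s i + x) > 2 * (real k - 1) * (1 + y) + real k / 100 \<Longrightarrow>
       (3 * real k - 8) * (s i + x) + (x + y) > (5 * real k - 4) * (1 + y) + (3 * real k + 2) / 100 \<Longrightarrow>
       (real k - 1) * (s i' + x) \<le> (3 * real k + 1) * (s i + x) + real k * (1 + y) + real k / 25 - (x + y)"
  shows False
proof -
  consider "k = 3" | "k = 4" | "k = 5" | "k \<ge> 6" using k by linarith
  thus False
  proof cases
    case 1
    note g = growth[unfolded 1 rk_nat_def, simplified]
    \<comment> \<open>The factor is \<open>(k - 1) / (101 / 100)\<close> rounded down, and likewise
      in the cases 4 and 5.\<close>
    have step: "99 / 50 * s i - 3 \<le> s (Suc i) \<and> 16 \<le> s (Suc i)" if "i < 8" "16 \<le> s i" for i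
      using g[of i] that by simp
    have s0: "82 / 5 \<le> s 0" using xy 1 by (simp add: tk_def)
    have s1: "99 / 50 * s 0 - 3 \<le> s 1" "16 \<le> s 1" using step[of 0] s0 unfolding One_nat_def by simp_all
    have s2: "99 / 50 * s 1 - 3 \<le> s 2" "16 \<le> s 2" using step[of 1] s1 unfolding Suc_1 by simp_all
    have s3: "99 / 50 * s 2 - 3 \<le> s 3" "16 \<le> s 3" using step[of 2] s2 by simp_all
    have s4: "99 / 50 * s 3 - 3 \<le> s 4" "16 \<le> s 4" using step[of 3] s3 by simp_all
    have s5: "99 / 50 * s 4 - 3 \<le> s 5" "16 \<le> s 5" using step[of 4] s4 by simp_all
    have s6: "99 / 50 * s 5 - 3 \<le> s 6" "16 \<le> s 6" using step[of 5] s5 by simp_all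
    have s7: "99 / 50 * s 6 - 3 \<le> s 7" "16 \<le> s 7" using step[of 6] s6 by simp_all
    have s8: "99 / 50 * s 7 - 3 \<le> s 8" "16 \<le> s 8" using step[of 7] s7 by simp_all
    \<comment> \<open>As \<open>y \<le> s 0\<close>, this makes \<open>s 5\<close> exceed
      \<open>y\<close> so far that both Pade conditions hold and the terms in \<open>1 + y\<close>
      no longer matter.\<close>
    have s5': "s 5 \<ge> 18 * s 0 + 90" using s0 s1 s2 s3 s4 s5 by linarith
    show False using pade[of 5 8, unfolded 1 rk_nat_def, simplified] s5' s6 s7 s8 xy s0 by linarith
  next
    case 2
    note g = growth[unfolded 2 rk_nat_def, simplified]
    have step: "297 / 100 * s i - 4 \<le> s (Suc i) \<and> 11 \<le> s (Suc i)" if "i < 5" "11 \<le> s i" for i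
      using g[of i] that by simp
    have s0: "113 / 10 \<le> s 0" using xy 2 by (simp add: tk_def)
    have s1: "297 / 100 * s 0 - 4 \<le> s 1" "11 \<le> s 1" using step[of 0] s0 unfolding One_nat_def by simp_all
    have s2: "297 / 100 * s 1 - 4 \<le> s 2" "11 \<le> s 2" using step[of 1] s1 unfolding Suc_1 by simp_all
    have s3: "297 / 100 * s 2 - 4 \<le> s 3" "11 \<le> s 3" using step[of 2] s2 by simp_all
    have s4: "297 / 100 * s 3 - 4 \<le> s 4" "11 \<le> s 4" using step[of 3] s3 by simp_all
    have s5: "297 / 100 * s 4 - 4 \<le> s 5" "11 \<le> s 5" using step[of 4] s4 by simp_all
    have s3': "s 3 \<ge> 18 * s 0" using s0 s1 s2 s3 by linarith
    show False using pade[of 3 5, unfolded 2 rk_nat_def, simplified] s3' s4 s5 xy s0 by linarith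
  next
    case 3
    note g = growth[unfolded 3 rk_nat_def, simplified]
    have step: "99 / 25 * s i - 5 \<le> s (Suc i) \<and> 4 \<le> s (Suc i)" if "i < 4" "4 \<le> s i" for i
      using g[of i] that by simp
    have s0: "21 / 5 \<le> s 0" using xy 3 by (simp add: tk_def)
    have s1: "99 / 25 * s 0 - 5 \<le> s 1" "4 \<le> s 1" using step[of 0] s0 unfolding One_nat_def by simp_all
    have s2: "99 / 25 * s 1 - 5 \<le> s 2" "4 \<le> s 2" using step[of 1] s1 unfolding Suc_1 by simp_all
    have s3: "99 / 25 * s 2 - 5 \<le> s 3" "4 \<le> s 3" using step[of 2] s2 by simp_all
    have s4: "99 / 25 * s 3 - 5 \<le> s 4" "4 \<le> s 4" using step[of 3] s3 by simp_all
    have s2': "s 2 \<ge> 9 * s 0" using s0 s1 s2 by linarith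
    show False using pade[of 2 4, unfolded 3 rk_nat_def, simplified] s2' s3 s4 xy s0 by linarith
  next
    case 4
    define K where "K = real k"
    have K: "K \<ge> 6" using 4 by (simp add: K_def)
    have rk: "rk_nat k = 4" using 4 by (simp add: rk_nat_def)
    note g = growth[unfolded rk K_def[symmetric], simplified]
    \<comment> \<open>The first Pade condition is nearly tight: at \<open>K = 6\<close> it asks that
      \<open>4 * (s 1 + x)\<close> exceed \<open>10 * (1 + y)\<close> and a little more.\<close>
    have s1: "s 1 \<ge> 27 / 10 * (1 + s 0)"
    proof -
      have "K + 2747 / 1000 \<le> (K - 3727 / 1000) * tk k" using tk_large[OF 4] by (simp add: K_def)
      also have "\<dots> \<le> (K - 3727 / 1000) * s 0" using xy K by (intro mult_left_mono) auto
      finally show ?thesis using g[of 0] by (simp add: algebra_simps)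
    qed
    have s1': "s 1 \<ge> (27 / 5)"
    proof -
      have "s 0 > 1" using xy tk_gt_1[OF k] by linarith
      thus ?thesis using s1 by argo
    qed
    \<comment> \<open>The rate \<open>K / 2\<close> gives away part of \<open>K - 1\<close> in order
      to absorb the constant term \<open>K\<close>; two such steps still yield the factor
      \<open>3 / 2 * K\<close>.\<close>
    have grow: "s (Suc i) \<ge> K / 2 * s i" if "Suc i < 4" "s i \<ge> (27 / 5)" for i
    proof -
      have "(495 / 1000 * K - 1) * (27 / 5) \<le> (495 / 1000 * K - 1) * s i" using that K by (intro mult_left_mono) auto
      hence "505 / 1000 * K * s i \<le> (K - 1) * s i - K - 1 / 50" using K by (simp add: algebra_simps)
      thus ?thesis using g[of i] that by simp
    qed
    have s2: "s 2 \<ge> K / 2 * s 1" using grow[of 1] s1' by (simp add: numeral_2_eq_2)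
    have "3 * s 1 \<le> K / 2 * s 1" using K s1' by (intro mult_right_mono) auto
    hence s2': "s 2 \<ge> 3 * s 1" using s2 by simp
    have "K / 2 * (3 * s 1) \<le> K / 2 * s 2" using s2' K by (intro mult_left_mono) auto
    hence s3: "s 3 \<ge> 3 / 2 * (K * s 1)" using grow[of 2] s2' s1' by (simp add: numeral_3_eq_3 numeral_2_eq_2)
    have y1: "27 / 10 * (1 + y) \<le> s 1" using s1 xy by simp
    have "(K - 1) * (s 3 + x) \<le> (3 * K + 1) * (s 1 + x) + K * (1 + y) + K / 25 - (x + y)"
    proof (rule pade[of 1 3, unfolded rk K_def[symmetric]])
      have Ky: "6 * y \<le> K * y" using K xy by (intro mult_right_mono) auto
      have "(K - 2) * (27 / 10 * (1 + y)) \<le> (K - 2) * (s 1 + x)" using y1 xy K by (intro mult_left_mono) auto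
      moreover have "(K - 2) * (27 / 10 * (1 + y)) = 27 / 10 * K + 27 / 10 * (K * y) - 54 / 10 - 54 / 10 * y"
        by (simp add: field_simps)
      moreover have "2 * (K - 1) * (1 + y) = 2 * K + 2 * (K * y) - 2 - 2 * y" by (simp add: algebra_simps)
      ultimately show "2 * (K - 1) * (1 + y) + K / 100 < (K - 2) * (s 1 + x)"
        using K xy Ky by argo
      have "(3 * K - 8) * (27 / 10 * (1 + y)) \<le> (3 * K - 8) * (s 1 + x)" using y1 xy K by (intro mult_left_mono) auto
      moreover have "(3 * K - 8) * (27 / 10 * (1 + y)) = 81 / 10 * K + 81 / 10 * (K * y) - 216 / 10 - 216 / 10 * y"
        by (simp add: field_simps)
      moreover have "(5 * K - 4) * (1 + y) = 5 * K + 5 * (K * y) - 4 - 4 * y" by (simp add: algebra_simps)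
      ultimately show "(5 * K - 4) * (1 + y) + (3 * K + 2) / 100 < (3 * K - 8) * (s 1 + x) + (x + y)"
        using K xy Ky by argo
    qed auto
    moreover have "5 * (3 / 2 * (K * s 1)) + (K - 1) * x \<le> (K - 1) * (s 3 + x)"
    proof -
      have "5 * (3 / 2 * (K * s 1)) \<le> (K - 1) * s 3" using s3 K s1' by (intro mult_mono) auto
      thus ?thesis by (simp add: algebra_simps)
    qed
    moreover have "(3 * K + 1) * (s 1 + x) = 3 * (K * s 1) + s 1 + 3 * (K * x) + x" "(K - 1) * x = K * x - x"
        "K * (1 + y) = K + K * y" by (simp_all add: algebra_simps)
    moreover have "K * x \<le> K * y" "K * (27 / 10 * (1 + y)) \<le> K * s 1" "6 * s 1 \<le> K * s 1"
      using K xy y1 s1' by (auto intro!: mult_left_mono mult_right_mono)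
    moreover have "K * (27 / 10 * (1 + y)) = 27 / 10 * K + 27 / 10 * (K * y)" by (simp add: field_simps)
    ultimately show False using K xy s1' by argo
  qed
qed

text \<open>The growth is anchored at \<open>b 1\<close> rather than \<open>b 0\<close>. The Pade
  bound for the pair \<open>b 0\<close>, \<open>b 1\<close> needs \<open>a i\<close> large compared
  with \<open>b 1\<close>, which may lie far above \<open>b 0\<close>; measuring
  \<open>a i * b 1\<close> makes \<open>y \<le> s 0\<close> automatic. This is why \<open>b\<close>
  has one index more than in \<open>log_growth\<close>.\<close>

lemma product_bound:
  fixes a b :: "nat \<Rightarrow> nat" and k J :: nat and n :: int and N :: real
  assumes k: "k \<ge> 3" and n: "n \<noteq> 0" "\<bar>real_of_int n\<bar> \<le> N" and N: "large_for k N"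
    and J: "10000 * real k ^ 2 \<le> 2 ^ J"
    and a: "0 < a 0" "\<And>i. Suc i < rk_nat k \<Longrightarrow> a i < a (Suc i)"
    and b: "0 < b 0" "\<And>j. j < J + 4 \<Longrightarrow> b j < b (Suc j)"
    and pw: "\<And>i j. i < rk_nat k \<Longrightarrow> j \<le> J + 4 \<Longrightarrow> pos_power k (int (a i) * int (b j) + n)"
  shows "real (a 0) * real (b 0) < N powr (tk k)"
proof (rule ccontr)
  assume "\<not> ?thesis"
  hence ge: "N powr tk k \<le> real (a 0) * real (b 0)" by simp
  have N1: "N > 1" "real k * ln 4 \<le> ln N / 100" "2 * ln k + 3 * ln 2 \<le> ln N / 100"
    using N by (auto simp: large_for_def)
  have amono: "a i < a j" if "i < j" "j < rk_nat k" for i j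
    using that
  proof (induction j)
    case (Suc j)
    thus ?case using a(2)[of j] by (cases "i = j") auto
  qed simp
  have apos: "0 < a i" if "i < rk_nat k" for i using amono[of 0 i] that a(1) by (cases "i = 0") auto
  have r0: "0 < rk_nat k" by (simp add: rk_nat_def)
  define x where "x = log N (b 0)"
  define y where "y = log N (b 1)"
  define s where "s = (\<lambda>i. log N (a i) + y)"
  have b01: "b 0 < b 1" using b(2)[of 0] by simp
  have xy: "0 \<le> x" "x \<le> y" using b01 b(1) N1 by (simp_all add: x_def y_def del: One_nat_def)
  have "tk k = log N (N powr tk k)" using N1 by simp
  also have "\<dots> \<le> log N (real (a 0) * real (b 0))"
    using ge N1 a(1) b(1) by (subst log_le_cancel_iff) auto
  also have "\<dots> = log N (a 0) + x" using a(1) b(1) by (simp add: log_mult x_def)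
  finally have t: "tk k \<le> log N (a 0) + x" .
  have ab: "4 * N \<le> real (a i) * real (b j)" if "i < rk_nat k" "j \<in> {0, 1}" for i j
  proof -
    have "ln (4 * N) \<le> ln (N powr tk k)"
      using N by (simp add: large_for_def ln_mult ln_powr algebra_simps)
    hence "4 * N \<le> N powr tk k" by (subst (asm) ln_le_cancel_iff) (use N1 in auto)
    also have "\<dots> \<le> real (a 0) * real (b 0)" by (rule ge)
    also have "\<dots> \<le> real (a i) * real (b j)"
      using amono[of 0 i] that b01 by (intro mult_mono) (cases "i = 0"; auto)+
    finally show ?thesis .
  qed
  show False
  proof (rule growth_contradiction[OF k, of s x y])
    fix i assume i: "Suc i < rk_nat k"
    have "(real k - 1) * log N (a i) + (real k - 2) * log N (b (Suc 0)) - real k - 1 / 50 \<le> 101 / 100 * log N (a (Suc i))"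
    proof (rule log_growth[OF k n N J, where b = "\<lambda>j. b (Suc j)"])
      show "0 < a i" "a i < a (Suc i)" using apos[of i] a(2) i by auto
      show "0 < b (Suc 0)" using b01 b(1) by simp
      show "b (Suc j) < b (Suc (Suc j))" if "j < J + 3" for j using b(2)[of "Suc j"] that by simp
      show "4 * N \<le> real (a i) * real (b (Suc 0))" using ab[of i 1] i by simp
      show "pos_power k (int c * int (b (Suc j)) + n)" if "c \<in> {a i, a (Suc i)}" "j \<le> J + 3" for c j
        using that i pw[of i "Suc j"] pw[of "Suc i" "Suc j"] by auto
    qed
    moreover have "0 \<le> y" using xy by simp
    ultimately show "(real k - 1) * s i - real k - 1 / 50 \<le> 101 / 100 * s (Suc i)"
      by (simp add: s_def y_def algebra_simps)
  next
    have "0 \<le> log N (a 0)" using a(1) N1 by simp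
    thus "y \<le> s 0" by (simp add: s_def)
    show "tk k \<le> s 0" using t xy by (simp add: s_def)
  next
    fix i i' assume i: "i < i'" "i' < rk_nat k"
    assume C: "(real k - 2) * (s i + x) > 2 * (real k - 1) * (1 + y) + real k / 100"
       "(3 * real k - 8) * (s i + x) + (x + y) > (5 * real k - 4) * (1 + y) + (3 * real k + 2) / 100"
    have e: "log N (a i) + log N (b 0) + log N (b 1) = s i + x" for i by (simp add: s_def x_def y_def)
    have "4 * N \<le> real (a i) * real (b 0)" using ab[of i 0] i by simp
    from log_pade[OF k n N1(3,1) _ amono[OF i] b(1) b01 this]
    show "(real k - 1) * (s i' + x) \<le> (3 * real k + 1) * (s i + x) + real k * (1 + y) + real k / 25 - (x + y)"
      unfolding e using C i apos[of i] pw[of i 0] pw[of i 1] pw[of i' 0] pw[of i' 1]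
      by (auto simp: x_def y_def)
  qed (use xy in auto)
qed

section \<open>Few solutions in short intervals\<close>

text \<open>The induction adds the largest zero, which yields one critical point above all earlier
  ones. The last conjunct keeps the new zeros to the right of a point of \<open>Z\<close>, where
  positivity and derivatives remain available for the next round.\<close>

lemma rolle_zeros:
  fixes f f' :: "real \<Rightarrow> real"
  assumes "finite Z" "Z \<noteq> {}"
    and "\<And>x. x \<in> Z \<Longrightarrow> f x = 0" and "\<And>x z. z \<in> Z \<Longrightarrow> z \<le> x \<Longrightarrow> (f has_real_derivative f' x) (at x)"
  shows "\<exists>Z'. finite Z' \<and> card Z \<le> Suc (card Z') \<and> (\<forall>z\<in>Z'. f' z = 0 \<and> z < Max Z \<and> (\<exists>w\<in>Z. w \<le> z))"
  using assms
proof (induction Z rule: finite_linorder_max_induct)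
  case (insert b A)
  show ?case
  proof (cases "A = {}")
    case True
    thus ?thesis by (intro exI[of _ "{}"]) auto
  next
    case False
    have "\<exists>Z'. finite Z' \<and> card A \<le> Suc (card Z') \<and> (\<forall>z\<in>Z'. f' z = 0 \<and> z < Max A \<and> (\<exists>w\<in>A. w \<le> z))"
      by (rule insert.IH) (use insert.prems False in auto)
    then obtain Z' where Z': "finite Z'" "card A \<le> Suc (card Z')"
      "\<And>z. z \<in> Z' \<Longrightarrow> f' z = 0 \<and> z < Max A \<and> (\<exists>w\<in>A. w \<le> z)" by blast
    have MA: "Max A \<in> A" using False insert by simp
    have lt: "Max A < b" using MA insert by blast
    have d: "(f has_real_derivative f' x) (at x)" if "Max A \<le> x" for x
      using insert.prems(3)[of "Max A" x] MA that by blast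
    have "\<exists>c. Max A < c \<and> c < b \<and> (f has_real_derivative 0) (at c)"
    proof (rule Rolle[OF lt, of f])
      show "f (Max A) = f b" using insert.prems(2) MA by simp
      show "continuous_on {Max A..b} f"
        by (intro continuous_at_imp_continuous_on ballI DERIV_isCont[OF d]) auto
      show "f differentiable at x" if "Max A < x" "x < b" for x
        using d[of x] that real_differentiable_def by auto
    qed
    then obtain c where c: "Max A < c" "c < b" "(f has_real_derivative 0) (at c)" by blast
    have c0: "f' c = 0" using DERIV_unique[OF c(3) d] c(1) by simp
    have "c \<notin> Z'" using Z'(3)[of c] c(1) by auto
    moreover have "Max (insert b A) = b" using insert lt False by (subst Max_insert) auto
    moreover have "card (insert b A) = Suc (card A)" using insert by (intro card_insert_disjoint) auto
    ultimately have "finite (insert c Z')" "card (insert b A) \<le> Suc (card (insert c Z'))"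
      "Max (insert b A) = b" using Z'(1,2) by simp_all
    moreover have "f' z = 0 \<and> z < b \<and> (\<exists>w\<in>insert b A. w \<le> z)" if z: "z \<in> insert c Z'" for z
    proof (cases "z = c")
      case True
      thus ?thesis using c c0 MA by (intro conjI bexI[of _ "Max A"]) auto
    next
      case False
      hence "f' z = 0 \<and> z < Max A \<and> (\<exists>w\<in>A. w \<le> z)" using z Z'(3) by blast
      thus ?thesis using lt by auto
    qed
    ultimately show ?thesis by (intro exI[of _ "insert c Z'"]) simp
  qed
qed simp

text \<open>Dividing by \<open>(x + y p) powr s\<close> makes the term of \<open>p\<close> constant,
  so differentiation removes it. Up to a common nonzero factor the others become multiples of
  \<open>(x + y i) powr (s - 1)\<close>. Each round costs one term and one zero. Since
  \<open>s\<close> is not a natural number, the factor \<open>s\<close> produced by the derivative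
  never vanishes.\<close>

lemma powr_sum_zeros:
  fixes y d :: "'i \<Rightarrow> real" and s :: real
  assumes "finite I" "inj_on y I" "\<And>m::nat. s \<noteq> real m" "finite Z" "card I \<le> card Z"
    and "\<And>x i. x \<in> Z \<Longrightarrow> i \<in> I \<Longrightarrow> x + y i > 0"
    and "\<And>x. x \<in> Z \<Longrightarrow> (\<Sum>i\<in>I. d i * (x + y i) powr s) = 0"
  shows "\<forall>i\<in>I. d i = 0"
  using assms
proof (induction I arbitrary: s d Z rule: finite_induct)
  case (insert p I)
  have Zne: "Z \<noteq> {}" using insert by auto
  define f where "f = (\<lambda>x. \<Sum>i\<in>insert p I. d i * ((x + y i) / (x + y p)) powr s)"
  define g where "g = (\<lambda>x. \<Sum>i\<in>I. (d i * (y p - y i)) * (x + y i) powr (s - 1))"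
  define f' where "f' = (\<lambda>x. s * (x + y p) powr (- s - 1) * g x)"
  have pos: "x + y i > 0" if "z \<in> Z" "z \<le> x" "i \<in> insert p I" for x z i
    using insert.prems(5)[of z i] that by simp
  have f0: "f x = 0" if "x \<in> Z" for x
  proof -
    have "f x = (\<Sum>i\<in>insert p I. d i * (x + y i) powr s) / (x + y p) powr s"
      unfolding f_def sum_divide_distrib using pos[OF that order_refl]
      by (intro sum.cong refl) (simp add: powr_divide less_imp_le)
    thus ?thesis using insert.prems(6)[OF that] by simp
  qed
  have deriv: "(f has_real_derivative f' x) (at x)" if x: "z \<in> Z" "z \<le> x" for x z
  proof -
    note px = pos[OF x]
    have "(f has_real_derivative (\<Sum>i\<in>insert p I. s * d i * (y p - y i) * (x + y i) powr (s - 1) * (x + y p) powr (- s - 1))) (at x)"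
      unfolding f_def
    proof (intro DERIV_sum)
      fix i assume i: "i \<in> insert p I"
      have q: "(x + y i) / (x + y p) > 0" using px[OF i] px[of p] by simp
      have D: "((\<lambda>x. d i * ((x + y i) / (x + y p)) powr s) has_real_derivative
          d i * (s * ((x + y i) / (x + y p)) powr (s - 1) * ((1 * (x + y p) - (x + y i) * 1) / ((x + y p) * (x + y p))))) (at x)"
        using q px[of p] by (auto intro!: derivative_eq_intros simp: powr_diff field_simps)
      have Eq: "((x + y i) / (x + y p)) powr (s - 1) * ((1 * (x + y p) - (x + y i) * 1) / ((x + y p) * (x + y p)))
          = (y p - y i) * (x + y i) powr (s - 1) * (x + y p) powr (- s - 1)"
      proof -
        have "(x + y p) powr (- s - 1) = 1 / ((x + y p) powr (s - 1) * ((x + y p) * (x + y p)))"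
        proof -
          have "(x + y p) powr (- s - 1) * ((x + y p) powr (s - 1) * ((x + y p) powr 1 * (x + y p) powr 1)) = 1"
            using px[of p] unfolding powr_add[symmetric] by simp
          hence "(x + y p) powr (- s - 1) * ((x + y p) powr (s - 1) * ((x + y p) * (x + y p))) = 1"
            using px[of p] by (simp only: powr_one insertI1 less_imp_le)
          moreover have "(x + y p) powr (s - 1) * ((x + y p) * (x + y p)) \<noteq> 0" using px[of p] by simp
          ultimately show ?thesis by (metis nonzero_eq_divide_eq)
        qed
        thus ?thesis using px[OF i] px[of p] by (simp add: powr_divide)
      qed
      have "d i * (s * ((x + y i) / (x + y p)) powr (s - 1) * ((1 * (x + y p) - (x + y i) * 1) / ((x + y p) * (x + y p))))
          = s * d i * (y p - y i) * (x + y i) powr (s - 1) * (x + y p) powr (- s - 1)"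
        unfolding mult.assoc Eq[unfolded mult.assoc] by (simp only: mult_ac)
      with D show "((\<lambda>x. d i * ((x + y i) / (x + y p)) powr s) has_real_derivative
          s * d i * (y p - y i) * (x + y i) powr (s - 1) * (x + y p) powr (- s - 1)) (at x)"
        by (simp only:)
    qed
    also have "(\<Sum>i\<in>insert p I. s * d i * (y p - y i) * (x + y i) powr (s - 1) * (x + y p) powr (- s - 1)) = f' x"
      using insert.hyps by (simp add: f'_def g_def sum_distrib_left mult_ac)
    finally show ?thesis .
  qed
  have "\<exists>Z'. finite Z' \<and> card Z \<le> Suc (card Z') \<and> (\<forall>z\<in>Z'. f' z = 0 \<and> z < Max Z \<and> (\<exists>w\<in>Z. w \<le> z))"
    by (rule rolle_zeros[of Z f f']) (use insert.prems(3) Zne f0 deriv in simp_all)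
  then obtain Z' where Z'0: "finite Z'" "card Z \<le> Suc (card Z')"
      "\<forall>z\<in>Z'. f' z = 0 \<and> z < Max Z \<and> (\<exists>w\<in>Z. w \<le> z)" by blast
  have Z': "finite Z'" "card Z \<le> Suc (card Z')"
      "\<And>z. z \<in> Z' \<Longrightarrow> f' z = 0" "\<And>z. z \<in> Z' \<Longrightarrow> \<exists>w\<in>Z. w \<le> z"
    using Z'0 by simp_all
  have s1: "s - 1 \<noteq> real m" for m :: nat
    using insert.prems(2)[of "Suc m"] by auto
  have s0: "s \<noteq> 0" using insert.prems(2)[of 0] by simp
  have "\<forall>i\<in>I. d i * (y p - y i) = 0"
  proof (rule insert.IH[OF _ s1 Z'(1)])
    show "inj_on y I" using insert.prems by auto
    show "card I \<le> card Z'" using insert Z' by auto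
    show "x + y i > 0" if "x \<in> Z'" "i \<in> I" for x i
      using Z'(4)[OF that(1)] pos that by blast
    show "(\<Sum>i\<in>I. d i * (y p - y i) * (x + y i) powr (s - 1)) = 0" if "x \<in> Z'" for x
    proof -
      have "(x + y p) powr (- s - 1) \<noteq> 0" using Z'(4)[OF that] pos[of _ x p] by fastforce
      thus ?thesis using Z'(3)[OF that] s0 by (simp add: f'_def g_def)
    qed
  qed
  moreover have "y p \<noteq> y i" if "i \<in> I" for i using insert that by (auto simp: inj_on_def)
  ultimately have dI: "\<forall>i\<in>I. d i = 0" by auto
  obtain x where x: "x \<in> Z" using Zne by blast
  have "d p * (x + y p) powr s = 0"
    using insert.prems(6)[OF x] insert.hyps dI by simp
  with pos[OF x order_refl, of p] have "d p = 0" by simp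
  with dI show ?case by simp
qed simp

section \<open>Integral combinations of roots that vanish on short intervals\<close>

lemma abs_gchoose_le_1:
  fixes \<nu> :: real
  assumes "0 \<le> \<nu>" "\<nu> \<le> 1"
  shows "\<bar>\<nu> gchoose m\<bar> \<le> 1"
proof (induction m)
  case (Suc m)
  have "\<nu> gchoose Suc m = (\<nu> gchoose m) * ((\<nu> - real m) / real (Suc m))"
    using gbinomial_absorption[of m \<nu>] gbinomial_absorb_comp[of \<nu> m] by (simp add: field_simps)
  moreover have "\<bar>(\<nu> - real m) / real (Suc m)\<bar> \<le> 1" using assms by (simp add: abs_le_iff divide_le_eq)
  ultimately show ?case using Suc mult_mono[of "\<bar>\<nu> gchoose m\<bar>" 1 "\<bar>(\<nu> - real m) / real (Suc m)\<bar>" 1]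
    by (simp add: abs_mult)
qed simp

text \<open>Thue's pigeonhole argument, for linear forms \<open>E c m\<close> in the coefficients \<open>c\<close>.\<close>
lemma small_linear_forms:
  fixes g :: "nat \<Rightarrow> nat \<Rightarrow> real" and h J :: nat
  assumes J: "J \<ge> 1" and h: "5 * J \<le> h"
    and g: "\<And>i m. i < 4 * J \<Longrightarrow> m < J \<Longrightarrow> \<bar>g i m\<bar> \<le> real h"
  shows "\<exists>e :: nat \<Rightarrow> int. (\<exists>i<4*J. e i \<noteq> 0) \<and> (\<forall>i<4*J. \<bar>e i\<bar> \<le> int h) \<and>
     (\<forall>m<J. \<bar>\<Sum>i<4*J. of_int (e i) * g i m\<bar> < 1 / (2 * real J))"
proof -
  define S where "S = 4 * J * h * h"
  define D where "D = (PiE {..<4*J} (\<lambda>_. {0..h}))"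
  define X where "X = 2 * J * S"
  define R where "R = (PiE {..<J} (\<lambda>_. {- int X - 1..int X}))"
  define E where "E = (\<lambda>(c :: nat \<Rightarrow> nat) m. \<Sum>i<4*J. real (c i) * g i m)"
  \<comment> \<open>Cells of width \<open>1 / (2 * J)\<close>, so that \<open>J\<close> forms
    together contribute less than 1/2 in the application.\<close>
  define \<Phi> where "\<Phi> = (\<lambda>c. restrict (\<lambda>m. \<lfloor>E c m * (2 * real J)\<rfloor>) {..<J})"
  have "\<Phi> ` D \<subseteq> R"
  proof
    fix \<phi> assume "\<phi> \<in> \<Phi> ` D"
    then obtain c where c: "c \<in> D" "\<phi> = \<Phi> c" by blast
    have "\<lfloor>E c m * (2 * real J)\<rfloor> \<in> {- int X - 1..int X}" if m: "m < J" for m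
    proof -
      have "\<bar>E c m\<bar> \<le> (\<Sum>i<4*J. real h * real h)"
        unfolding E_def
      proof (rule order_trans[OF sum_abs sum_mono])
        fix i assume i: "i \<in> {..<4*J}"
        hence "c i \<le> h" using c by (auto simp: D_def PiE_def Pi_def)
        thus "\<bar>real (c i) * g i m\<bar> \<le> real h * real h"
          unfolding abs_mult using g[of i m] i m by (intro mult_mono) auto
      qed
      also have "\<dots> = real S" by (simp add: S_def)
      finally have "\<bar>E c m\<bar> * (2 * real J) \<le> real S * (2 * real J)" by (intro mult_right_mono) auto
      hence "\<bar>E c m * (2 * real J)\<bar> \<le> real_of_int (int X)" by (simp add: X_def abs_mult mult_ac)
      hence "- real_of_int (int X) \<le> E c m * (2 * real J)" "E c m * (2 * real J) \<le> real_of_int (int X)"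
        by linarith+
      thus ?thesis by (simp add: le_floor_iff floor_le_iff del: of_nat_mult)
    qed
    thus "\<phi> \<in> R" unfolding c(2) R_def \<Phi>_def by (intro restrict_PiE_iff[THEN iffD2]) auto
  qed
  moreover have finR: "finite R" unfolding R_def by (intro finite_PiE) auto
  \<comment> \<open>There are \<open>4 * J\<close> coefficients for only \<open>J\<close> forms,
    which allows up to \<open>h ^ 4\<close> cells per form; \<open>5 * J \<le> h\<close> makes
    \<open>4 * J * S + 2\<close> fit into this.\<close>
  moreover have "card R < card D"
  proof -
    have "int X - (- int X - 1) + 1 = int (4 * J * S + 2)" by (simp add: X_def)
    hence "card {- int X - 1..int X} = 4 * J * S + 2" by (simp only: card_atLeastAtMost_int nat_int)
    hence "card R = (4 * J * S + 2) ^ J" unfolding R_def by (subst card_PiE) simp_all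
    also have "\<dots> \<le> (h ^ 4) ^ J"
    proof (rule power_mono)
      have "1 * 1 \<le> J * J" "1 * 1 \<le> h * h" using J h by (auto intro!: mult_le_mono)
      hence "1 * 1 \<le> (J * J) * (h * h)" by (intro mult_le_mono) auto
      hence "4 * J * S + 2 \<le> 18 * ((J * J) * (h * h))" unfolding S_def by simp
      also have "\<dots> \<le> (5 * J) * (5 * J) * (h * h)" by simp
      also have "\<dots> \<le> h * h * (h * h)" using h by (intro mult_le_mono) auto
      finally show "4 * J * S + 2 \<le> h ^ 4" by (simp add: power4_eq_xxxx mult_ac)
    qed simp
    also have "\<dots> = h ^ (4 * J)" by (simp add: power_mult)
    also have "\<dots> < (h + 1) ^ (4 * J)" using J by (intro power_strict_mono) auto
    also have "\<dots> = card D" unfolding D_def by (simp add: card_PiE)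
    finally show ?thesis .
  qed
  ultimately have "\<not> inj_on \<Phi> D"
    using card_inj_on_le by (metis not_less)
  then obtain c c' where c: "c \<in> D" "c' \<in> D" "c \<noteq> c'" "\<Phi> c = \<Phi> c'" by (auto simp: inj_on_def)
  define e where "e = (\<lambda>i. int (c i) - int (c' i))"
  have "\<exists>i<4*J. e i \<noteq> 0"
  proof (rule ccontr)
    assume "\<not> ?thesis"
    hence "c = c'" using c(1,2) unfolding D_def by (intro PiE_ext[of c _ _ c']) (auto simp: e_def)
    thus False using c by simp
  qed
  moreover have "\<bar>e i\<bar> \<le> int h" if "i < 4 * J" for i
  proof -
    have "c i \<le> h" "c' i \<le> h" using c that by (auto simp: D_def PiE_def Pi_def)
    thus ?thesis by (simp add: e_def)
  qed
  moreover have "\<bar>\<Sum>i<4*J. of_int (e i) * g i m\<bar> < 1 / (2 * real J)" if m: "m < J" for m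
  proof -
    have "\<lfloor>E c m * (2 * real J)\<rfloor> = \<lfloor>E c' m * (2 * real J)\<rfloor>"
      using fun_cong[OF c(4), of m] m by (simp add: \<Phi>_def)
    hence "\<bar>E c m * (2 * real J) - E c' m * (2 * real J)\<bar> < 1" by linarith
    hence "\<bar>E c m - E c' m\<bar> * (2 * real J) < 1" by (simp add: abs_mult flip: left_diff_distrib)
    moreover have eq: "(\<Sum>i<4*J. of_int (e i) * g i m) = E c m - E c' m"
      unfolding E_def e_def by (simp add: sum_subtractf left_diff_distrib)
    ultimately show ?thesis unfolding eq using J by (simp add: field_simps)
  qed
  ultimately show ?thesis by blast
qed

text \<open>Write \<open>b = b0 + V * (1 + w)\<close> with \<open>0 \<le> w \<le> \<delta>\<close>;
  then \<open>a i * b + n = M i * (1 + \<theta> i * w)\<close>. Measuring from \<open>b0\<close>,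
  where all values are positive, ensures \<open>\<theta> i \<le> 1\<close> for negative
  \<open>n\<close> too. The coefficients from \<open>small_linear_forms\<close> make the first
  \<open>J\<close> Taylor coefficients in \<open>w\<close> tiny, and the tail is of order
  \<open>\<delta> ^ J\<close>.\<close>

lemma few_in_short_interval:
  fixes a :: "nat \<Rightarrow> nat" and b0 k h J :: nat and n :: int and V \<delta> :: real
  assumes k: "k \<ge> 2" and J: "J \<ge> 1" and h: "5 * J \<le> h" and n: "n \<noteq> 0"
    and a: "inj_on a {..<4*J}" "\<And>i. i < 4 * J \<Longrightarrow> a i > 0"
    and \<delta>: "0 < \<delta>" "\<delta> \<le> 1 / 2" "16 * real J * real h ^ 2 * \<delta> ^ J \<le> 1"
    and V: "V > 0" and b0: "\<And>i. i < 4 * J \<Longrightarrow> int (a i) * int b0 + n > 0"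
    and B: "finite B" "\<And>b. b \<in> B \<Longrightarrow> real b0 + V \<le> real b \<and> real b \<le> real b0 + V * (1 + \<delta>)"
    and pw: "\<And>i b. i < 4 * J \<Longrightarrow> b \<in> B \<Longrightarrow> \<exists>x::nat. x \<le> h \<and> int (a i) * int b + n = int x ^ k"
  shows "card B < 4 * J"
proof (rule ccontr)
  assume "\<not> ?thesis"
  hence cB: "4 * J \<le> card B" by simp
  define \<nu> where "\<nu> = 1 / real k"
  have \<nu>: "0 < \<nu>" "\<nu> < 1" using k by (auto simp: \<nu>_def)
  define M where "M = (\<lambda>i. real (a i) * real b0 + real_of_int n + real (a i) * V)"
  define \<theta> where "\<theta> = (\<lambda>i. real (a i) * V / M i)"
  have mpos: "real (a i) * real b0 + real_of_int n > 0" if "i < 4 * J" for i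
  proof -
    have "real_of_int (int (a i) * int b0 + n) > 0" using b0[OF that] by (simp only: of_int_0_less_iff)
    thus ?thesis by simp
  qed
  have Mpos: "M i > 0" if "i < 4 * J" for i
    using mpos[OF that] V by (auto simp: M_def intro: add_pos_nonneg)
  have \<theta>: "0 \<le> \<theta> i" "\<theta> i \<le> 1" if "i < 4 * J" for i
    using mpos[OF that] Mpos[OF that] V by (auto simp: \<theta>_def M_def divide_le_eq)
  have root: "\<exists>x::nat. x \<le> h \<and> (real (a i) * real b + real_of_int n) powr \<nu> = real x" if ib: "i < 4 * J" "b \<in> B" for i b
  proof -
    obtain x :: nat where x: "x \<le> h" "int (a i) * int b + n = int x ^ k" using pw[OF ib] by blast
    have "real_of_int (int (a i) * int b + n) = real_of_int (int x ^ k)" using x by simp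
    hence "real (a i) * real b + real_of_int n = real x ^ k" by simp
    moreover have "(real x ^ k) powr \<nu> = real x"
    proof (cases "x = 0")
      case False
      thus ?thesis using k by (simp add: \<nu>_def powr_powr flip: powr_realpow)
    qed (use k in simp)
    ultimately show ?thesis using x by auto
  qed
  obtain b1 where b1: "b1 \<in> B" using cB J by fastforce
  have Mroot: "M i powr \<nu> \<le> real h" if i: "i < 4 * J" for i
  proof -
    obtain x :: nat where x: "x \<le> h" "(real (a i) * real b1 + real_of_int n) powr \<nu> = real x"
      using root[OF i b1] by blast
    have "real (a i) * (real b0 + V) \<le> real (a i) * real b1" using B(2)[OF b1] by (intro mult_left_mono) auto
    hence "M i \<le> real (a i) * real b1 + real_of_int n" by (simp add: M_def distrib_left)
    hence "M i powr \<nu> \<le> (real (a i) * real b1 + real_of_int n) powr \<nu>"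
      using Mpos[OF i] \<nu> by (intro powr_mono2) auto
    thus ?thesis using x by simp
  qed
  define g where "g = (\<lambda>i m. M i powr \<nu> * (\<nu> gchoose m) * \<theta> i ^ m)"
  have gle: "\<bar>g i m\<bar> \<le> real h" if "i < 4 * J" for i m
  proof -
    have "\<bar>g i m\<bar> \<le> real h * 1 * 1"
      unfolding g_def abs_mult using Mroot[OF that] \<theta>[OF that] abs_gchoose_le_1[of \<nu> m] \<nu>
      by (intro mult_mono) (auto simp: power_le_one)
    thus ?thesis by simp
  qed
  obtain e :: "nat \<Rightarrow> int" where e: "\<exists>i<4*J. e i \<noteq> 0" "\<And>i. i < 4*J \<Longrightarrow> \<bar>e i\<bar> \<le> int h"
     "\<And>m. m < J \<Longrightarrow> \<bar>\<Sum>i<4*J. of_int (e i) * g i m\<bar> < 1 / (2 * real J)"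
    using small_linear_forms[OF J h, of g] gle by blast
  define E where "E = (\<lambda>m. \<Sum>i<4*J. of_int (e i) * g i m)"
  define S where "S = 4 * real J * real h ^ 2"
  have ES: "\<bar>E m\<bar> \<le> S" for m
  proof -
    have "\<bar>E m\<bar> \<le> (\<Sum>i<4*J. real h * real h)"
      unfolding E_def
    proof (rule order_trans[OF sum_abs sum_mono])
      fix i assume i: "i \<in> {..<4*J}"
      have "\<bar>real_of_int (e i)\<bar> \<le> real h" using e(2)[of i] i by (metis lessThan_iff of_int_abs of_int_le_iff of_int_of_nat_eq)
      thus "\<bar>of_int (e i) * g i m\<bar> \<le> real h * real h"
        unfolding abs_mult using gle[of i m] i by (intro mult_mono) auto
    qed
    thus ?thesis by (simp add: S_def power2_eq_square)
  qed
  have zero: "(\<Sum>i<4*J. of_int (e i) * (real (a i) * real b + real_of_int n) powr \<nu>) = 0" if b: "b \<in> B" for b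
  proof -
    define w where "w = (real b - real b0 - V) / V"
    have w: "0 \<le> w" "w \<le> \<delta>" using B(2)[OF b] V by (auto simp: w_def field_simps)
    have sums: "(\<lambda>m. g i m * w ^ m) sums (real (a i) * real b + real_of_int n) powr \<nu>" if i: "i < 4 * J" for i
    proof -
      have "\<theta> i * w \<le> 1 * (1 / 2)" using \<theta>[OF i] w \<delta> by (intro mult_mono) auto
      moreover have "0 \<le> \<theta> i * w" using \<theta>[OF i] w by simp
      ultimately have "(\<lambda>m. (\<nu> gchoose m) * (\<theta> i * w) ^ m) sums (1 + \<theta> i * w) powr \<nu>"
        by (intro gen_binomial_real) auto
      hence "(\<lambda>m. M i powr \<nu> * ((\<nu> gchoose m) * (\<theta> i * w) ^ m)) sums (M i powr \<nu> * (1 + \<theta> i * w) powr \<nu>)"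
        by (rule sums_mult)
      moreover have "M i powr \<nu> * (1 + \<theta> i * w) powr \<nu> = (M i * (1 + \<theta> i * w)) powr \<nu>"
        using Mpos[OF i] \<open>0 \<le> \<theta> i * w\<close> by (simp add: powr_mult)
      moreover have "M i * (1 + \<theta> i * w) = real (a i) * real b + real_of_int n"
      proof -
        have "M i * (1 + \<theta> i * w) = M i + real (a i) * (V * w)" using Mpos[OF i] by (simp add: \<theta>_def field_simps)
        also have "V * w = real b - real b0 - V" using V by (simp add: w_def)
        finally show ?thesis by (simp add: M_def algebra_simps)
      qed
      ultimately show ?thesis by (simp add: g_def power_mult_distrib mult_ac)
    qed
    define F where "F = (\<Sum>i<4*J. of_int (e i) * (real (a i) * real b + real_of_int n) powr \<nu>)"
    have "(\<lambda>m. \<Sum>i<4*J. of_int (e i) * (g i m * w ^ m)) sums F"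
      unfolding F_def by (intro sums_sum sums_mult sums) auto
    hence Fs: "(\<lambda>m. E m * w ^ m) sums F" by (simp only: E_def sum_distrib_right mult.assoc)
    hence F_split: "F = (\<Sum>m. E (m + J) * w ^ (m + J)) + (\<Sum>m<J. E m * w ^ m)"
      using suminf_split_initial_segment[OF sums_summable[OF Fs], of J] sums_unique[OF Fs] by simp
    have geo: "(\<lambda>m. S * \<delta> ^ J * (1 / 2) ^ m) sums (S * \<delta> ^ J * 2)"
      using sums_mult[OF geometric_sums[of "1 / 2 :: real"], of "S * \<delta> ^ J"] by simp
    have bnd: "norm (E (m + J) * w ^ (m + J)) \<le> S * \<delta> ^ J * (1 / 2) ^ m" for m
    proof -
      have "\<bar>E (m + J)\<bar> * w ^ (m + J) \<le> S * (\<delta> ^ J * (1 / 2) ^ m)"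
      proof (rule mult_mono[OF ES])
        have "w ^ J * w ^ m \<le> \<delta> ^ J * (1 / 2) ^ m"
          using w \<delta> by (intro mult_mono power_mono) auto
        thus "w ^ (m + J) \<le> \<delta> ^ J * (1 / 2) ^ m" by (simp add: power_add mult_ac)
      qed (use w in \<open>auto simp: S_def\<close>)
      thus ?thesis using w by (simp add: abs_mult mult_ac)
    qed
    have "\<bar>\<Sum>m. E (m + J) * w ^ (m + J)\<bar> \<le> S * \<delta> ^ J * 2"
    proof -
      have "norm (\<Sum>m. E (m + J) * w ^ (m + J)) \<le> (\<Sum>m. S * \<delta> ^ J * (1 / 2) ^ m)"
        by (rule norm_suminf_le[OF bnd sums_summable[OF geo]])
      thus ?thesis using sums_unique[OF geo] by simp
    qed
    \<comment> \<open>This is the last condition on \<open>\<delta>\<close>: \<open>S\<close> is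
      \<open>4 * J * h^2\<close>, and the geometric series contributes the factor 2.\<close>
    also have "\<dots> \<le> 1 / 2" using \<delta> by (simp add: S_def)
    finally have tail: "\<bar>\<Sum>m. E (m + J) * w ^ (m + J)\<bar> \<le> 1 / 2" .
    have "\<bar>\<Sum>m<J. E m * w ^ m\<bar> < (\<Sum>m<J. 1 / (2 * real J))"
    proof (rule le_less_trans[OF sum_abs sum_strict_mono])
      fix m assume m: "m \<in> {..<J}"
      have "\<bar>E m * w ^ m\<bar> \<le> \<bar>E m\<bar> * 1"
        unfolding abs_mult using w \<delta> by (intro mult_left_mono) (auto simp: power_le_one)
      also have "\<dots> < 1 / (2 * real J)" using e(3)[of m] m by (simp add: E_def)
      finally show "\<bar>E m * w ^ m\<bar> < 1 / (2 * real J)" .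
    qed (use J in \<open>auto simp: lessThan_empty_iff\<close>)
    also have "\<dots> = 1 / 2" using J by simp
    finally have "\<bar>F\<bar> < 1" unfolding F_split using tail by linarith
    moreover have "F \<in> \<int>"
      unfolding F_def
    proof (intro Ints_sum Ints_mult)
      fix i assume "i \<in> {..<4*J}"
      then obtain x :: nat where "(real (a i) * real b + real_of_int n) powr \<nu> = real x" using root[of i b] b by auto
      thus "(real (a i) * real b + real_of_int n) powr \<nu> \<in> \<int>" by simp
    qed auto
    ultimately have "F = 0" using Ints_nonzero_abs_less1 by blast
    thus ?thesis by (simp add: F_def)
  qed
  \<comment> \<open>Taking \<open>a i powr \<nu>\<close> out of each term leaves the shifts
    \<open>n / a i\<close>, which are distinct because \<open>n\<close> is nonzero.\<close>
  have "\<forall>i\<in>{..<4*J}. of_int (e i) * real (a i) powr \<nu> = 0"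
  proof (rule powr_sum_zeros[where y = "\<lambda>i. of_int n / real (a i)" and s = \<nu> and Z = "real ` B"])
    show "inj_on (\<lambda>i. of_int n / real (a i)) {..<4*J}"
    proof (rule inj_onI)
      fix i j assume ij: "i \<in> {..<4*J}" "j \<in> {..<4*J}" "of_int n / real (a i) = of_int n / real (a j)"
      hence "a i = a j" using n a(2)[of i] a(2)[of j] by (simp add: field_simps)
      thus "i = j" using a(1) ij by (auto simp: inj_on_def)
    qed
    show "\<nu> \<noteq> real m" for m :: nat using \<nu> by (cases m) auto
    show "card {..<4*J} \<le> card (real ` B)" using cB by (simp add: card_image)
    fix x assume "x \<in> real ` B"
    then obtain b where b: "b \<in> B" "x = real b" by blast
    have eq: "real (a i) * (x + of_int n / real (a i)) = real (a i) * real b + real_of_int n" if "i < 4 * J" for i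
      using a(2)[OF that] b by (simp add: field_simps)
    have pos: "real (a i) * real b + real_of_int n > 0" if i: "i < 4 * J" for i
    proof -
      have "real (a i) * real b0 \<le> real (a i) * real b" using B(2)[OF b(1)] V by (intro mult_left_mono) auto
      thus ?thesis using mpos[OF i] by simp
    qed
    show xpos: "x + of_int n / real (a i) > 0" if "i \<in> {..<4*J}" for i
    proof -
      have "0 < real (a i) * (x + of_int n / real (a i))" using that by (simp add: eq pos)
      thus ?thesis using a(2)[of i] that by (simp add: zero_less_mult_iff)
    qed
    have "(\<Sum>i<4*J. of_int (e i) * real (a i) powr \<nu> * (x + of_int n / real (a i)) powr \<nu>)
        = (\<Sum>i<4*J. of_int (e i) * (real (a i) * real b + real_of_int n) powr \<nu>)"
    proof (rule sum.cong[OF refl])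
      fix i assume i: "i \<in> {..<4*J}"
      have "real (a i) powr \<nu> * (x + of_int n / real (a i)) powr \<nu> = (real (a i) * (x + of_int n / real (a i))) powr \<nu>"
        using xpos[OF i] by (simp add: powr_mult)
      also have "\<dots> = (real (a i) * real b + real_of_int n) powr \<nu>" using eq i by simp
      finally show "of_int (e i) * real (a i) powr \<nu> * (x + of_int n / real (a i)) powr \<nu>
        = of_int (e i) * (real (a i) * real b + real_of_int n) powr \<nu>" by (simp add: mult.assoc)
    qed
    thus "(\<Sum>i<4*J. of_int (e i) * real (a i) powr \<nu> * (x + of_int n / real (a i)) powr \<nu>) = 0"
      using zero[OF b(1)] by simp
  qed (use B in auto)
  moreover obtain i where i: "i < 4 * J" "e i \<noteq> 0" using e(1) by blast
  ultimately have "of_int (e i) * real (a i) powr \<nu> = 0" by blast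
  thus False using i a(2)[OF i(1)] by simp
qed

text \<open>The ranges are geometric in the distance from \<open>b0 = Min B\<close>, with ratio
  \<open>1 + \<delta>\<close>, since \<open>few_in_short_interval\<close> measures from a point
  where all \<open>a i * b0 + n\<close> are positive. As
  \<open>ln (1 + \<delta>) \<ge> \<delta> / 2\<close>, about \<open>2 * ln T / \<delta>\<close>
  ranges suffice; the leading 1 counts \<open>b0\<close> itself.\<close>

lemma card_le_by_short_intervals:
  fixes a :: "nat \<Rightarrow> nat" and k h J :: nat and n :: int and T \<delta> :: real
  assumes k: "k \<ge> 2" and J: "J \<ge> 1" and h: "5 * J \<le> h" and n: "n \<noteq> 0"
    and a: "inj_on a {..<4*J}" "\<And>i. i < 4 * J \<Longrightarrow> a i > 0"
    and \<delta>: "0 < \<delta>" "\<delta> \<le> 1 / 2" "16 * real J * real h ^ 2 * \<delta> ^ J \<le> 1"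
    and B: "finite B" "\<And>b. b \<in> B \<Longrightarrow> real b \<le> T" and T: "T \<ge> 1"
    and pw: "\<And>i b. i < 4 * J \<Longrightarrow> b \<in> B \<Longrightarrow> \<exists>x::nat. 0 < x \<and> x \<le> h \<and> int (a i) * int b + n = int x ^ k"
  shows "real (card B) \<le> 1 + 4 * real J * (2 * ln T / \<delta> + 2)"
proof (cases "B = {}")
  case False
  define b0 where "b0 = Min B"
  have b0: "b0 \<in> B" "\<And>b. b \<in> B \<Longrightarrow> b0 \<le> b" using False B by (auto simp: b0_def)
  define p where "p = 1 + \<delta>"
  define z where "z = (\<lambda>b. ln (real b - real b0) / ln p)"
  define P where "P = nat \<lceil>2 * ln T / \<delta>\<rceil> + 1"
  define S where "S = (\<lambda>j::nat. {b \<in> B. real b0 + p ^ j \<le> real b \<and> real b \<le> real b0 + p ^ j * (1 + \<delta>)})"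
  have lnp: "\<delta> / 2 \<le> ln p"
  proof -
    have "\<delta> * \<delta> \<le> \<delta> * (1 / 2)" using \<delta> by (intro mult_left_mono) auto
    moreover have "\<delta> - \<delta>\<^sup>2 \<le> ln (1 + \<delta>)" using \<delta> by (intro ln_one_plus_pos_lower_bound) auto
    ultimately show ?thesis by (simp add: p_def power2_eq_square)
  qed
  have p: "p > 1" "ln p > 0" using \<delta> lnp by (auto simp: p_def)
  have "B - {b0} \<subseteq> (\<Union>j<P. S j)"
  proof
    fix b assume b: "b \<in> B - {b0}"
    define v where "v = real b - real b0"
    have "b0 < b" using b b0(2)[of b] by (metis Diff_iff le_neq_implies_less singleton_iff)
    hence v: "1 \<le> v" "v \<le> T" using B(2)[of b] b by (auto simp: v_def)
    define j where "j = nat \<lfloor>z b\<rfloor>"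
    have zb: "z b = ln v / ln p" by (simp add: z_def v_def)
    have z0: "0 \<le> z b" unfolding zb using v p by simp
    have j: "real j \<le> z b" "z b < real j + 1" using z0 by (auto simp: j_def)
    have "p ^ j = exp (real j * ln p)" using p by (simp add: exp_of_nat_mult)
    also have "\<dots> \<le> exp (ln v)" using j p by (simp add: zb field_simps)
    finally have 1: "p ^ j \<le> v" using v by simp
    have "v = exp (ln v)" using v by simp
    also have "\<dots> \<le> exp (real (Suc j) * ln p)" using j p by (simp add: zb field_simps)
    also have "\<dots> = p ^ Suc j" using p by (simp only: exp_of_nat_mult) simp
    finally have 2: "v \<le> p ^ j * (1 + \<delta>)" by (simp add: p_def mult.commute)
    have "z b \<le> ln T / ln p" unfolding zb using v p by (intro divide_right_mono) auto
    also have "\<dots> \<le> ln T / (\<delta> / 2)" using T \<delta> lnp p by (intro divide_left_mono) auto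
    finally have "real j \<le> 2 * ln T / \<delta>" using j by (simp add: mult.commute)
    hence "j < P" unfolding P_def by linarith
    moreover have "b \<in> S j" using 1 2 b by (auto simp: S_def v_def)
    ultimately show "b \<in> (\<Union>j<P. S j)" by blast
  qed
  hence "card (B - {b0}) \<le> card (\<Union>j<P. S j)" using B by (intro card_mono) (auto simp: S_def)
  also have "\<dots> \<le> (\<Sum>j<P. card (S j))" by (rule card_UN_le) simp
  also have "\<dots> \<le> (\<Sum>j<P. 4 * J)"
  proof (rule sum_mono)
    fix j
    have "card (S j) < 4 * J"
    proof (rule few_in_short_interval[OF k J h n a \<delta>, where V = "p ^ j" and ?b0.0 = b0])
      show "p ^ j > 0" using p by simp
      show "int (a i) * int b0 + n > 0" if "i < 4 * J" for i
        using pw[OF that b0(1)] by auto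
      show "\<exists>x::nat. x \<le> h \<and> int (a i) * int b + n = int x ^ k" if "i < 4 * J" "b \<in> S j" for i b
        using pw[of i b] that by (auto simp: S_def)
    qed (use B in \<open>auto simp: S_def\<close>)
    thus "card (S j) \<le> 4 * J" by simp
  qed
  finally have "card B - 1 \<le> 4 * J * P" using b0(1) B by (simp add: mult.commute)
  hence "card B \<le> 1 + 4 * J * P" by linarith
  hence "real (card B) \<le> real (1 + 4 * J * P)" by (simp only: of_nat_le_iff)
  also have "\<dots> = 1 + 4 * real J * real P" by simp
  also have "\<dots> \<le> 1 + 4 * real J * (2 * ln T / \<delta> + 2)"
  proof -
    have "0 \<le> 2 * ln T / \<delta>" using T \<delta> by simp
    hence "real P \<le> 2 * ln T / \<delta> + 2" unfolding P_def by linarith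
    thus ?thesis by (intro add_left_mono mult_left_mono) auto
  qed
  finally show ?thesis .
qed (use T \<delta> in simp)

text \<open>With \<open>\<delta>\<close> a constant times \<open>N powr (- \<epsilon> / 2)\<close>
  there are about \<open>N powr (\<epsilon> / 2) * ln N\<close> intervals, and half of
  \<open>\<epsilon>\<close> is left for the logarithm. \<open>J \<ge> 4 * t / \<epsilon>\<close>
  makes \<open>\<delta> ^ J\<close> small enough to beat \<open>h^2\<close>, which is of order
  \<open>N powr (2 * t)\<close>; \<open>D\<close> collects the constants in this comparison.\<close>

lemma few_solutions:
  fixes k :: nat and \<epsilon> t :: real
  assumes k: "k \<ge> 2" and \<epsilon>: "\<epsilon> > 0" and t: "t \<ge> 1"
  obtains J :: nat and C :: real where "C > 0"
    "\<And>N n a B. N \<ge> 1 \<Longrightarrow> n \<noteq> 0 \<Longrightarrow> \<bar>real_of_int n\<bar> \<le> N \<Longrightarrow> inj_on a {..<4*J} \<Longrightarrow> finite B \<Longrightarrow>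
      \<forall>i<4*J. \<forall>b\<in>B. 0 < a i \<and> real (a i) * real b \<le> N powr t \<and> pos_power k (int (a i) * int b + n) \<Longrightarrow>
      real (card B) \<le> C * N powr \<epsilon>"
proof -
  define J where "J = nat \<lceil>4 * t / \<epsilon>\<rceil> + 1"
  define D where "D = 16 * real J * (4 + 5 * real J) ^ 2"
  define W where "W = 2 * t * D * (2 / \<epsilon>)"
  define C where "C = 1 + 8 * real J + 4 * real J * W"
  have J: "J \<ge> 1" "4 * t / \<epsilon> \<le> real J" unfolding J_def by linarith+
  have D: "D \<ge> 2"
  proof -
    have "1 * 1 \<le> real J * (4 + 5 * real J) ^ 2" using J by (intro mult_mono) auto
    thus ?thesis by (simp add: D_def)
  qed
  have Cpos: "C > 0" unfolding C_def W_def using \<epsilon> t D by (intro add_pos_nonneg) auto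
  have main: "real (card B) \<le> C * N powr \<epsilon>"
    if N: "N \<ge> 1" and n: "n \<noteq> 0" "\<bar>real_of_int n\<bar> \<le> N" and inj: "inj_on a {..<4*J}" and B: "finite B"
     and ab: "\<forall>i<4*J. \<forall>b\<in>B. 0 < a i \<and> real (a i) * real b \<le> N powr t \<and> pos_power k (int (a i) * int b + n)"
    for N n and a :: "nat \<Rightarrow> nat" and B :: "nat set"
  proof (cases "B = {}")
    case False
    then obtain b1 where b1: "b1 \<in> B" by blast
    have Nt: "N powr t \<ge> 1" "N \<le> N powr t" using N t powr_mono[of 1 t N] by (auto simp: ge_one_powr_ge_zero)
    define h where "h = nat \<lceil>2 * N powr t\<rceil> + 5 * J"
    define \<delta> where "\<delta> = N powr (- \<epsilon> / 2) / D"
    have h5: "5 * J \<le> h" by (simp add: h_def)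
    have h2: "2 * N powr t \<le> real h" unfolding h_def using real_nat_ceiling_ge[of "2 * N powr t"] by linarith
    have hle: "real h \<le> (4 + 5 * real J) * N powr t"
    proof -
      have "real h \<le> 2 * N powr t + 1 + 5 * real J" unfolding h_def using Nt by linarith
      also have "\<dots> \<le> 2 * N powr t + N powr t + 5 * real J * N powr t"
        using Nt by (intro add_mono) (auto simp: mult_le_cancel_left1)
      finally show ?thesis using Nt by (simp add: algebra_simps)
    qed
    have Neps: "0 < N powr (- \<epsilon> / 2)" "N powr (- \<epsilon> / 2) \<le> 1"
      using N \<epsilon> powr_mono[of "- \<epsilon> / 2" 0 N] by auto
    have \<delta>: "0 < \<delta>" "\<delta> \<le> 1 / 2"
    proof -
      show "0 < \<delta>" using Neps D by (simp add: \<delta>_def)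
      have "\<delta> \<le> 1 / 2" unfolding \<delta>_def using Neps D by (intro frac_le) auto
      thus "\<delta> \<le> 1 / 2" .
    qed
    have tail: "16 * real J * real h ^ 2 * \<delta> ^ J \<le> 1"
    proof -
      have "real h ^ 2 \<le> ((4 + 5 * real J) * N powr t) ^ 2" using hle by (intro power_mono) auto
      hence "16 * real J * real h ^ 2 \<le> 16 * real J * ((4 + 5 * real J) * N powr t) ^ 2" by (intro mult_left_mono) auto
      also have "\<dots> = D * N powr (2 * t)"
        using N by (simp add: D_def power_mult_distrib powr_power mult.commute)
      finally have 1: "16 * real J * real h ^ 2 \<le> D * N powr (2 * t)" .
      have "\<delta> ^ J = N powr (- \<epsilon> / 2 * real J) / D ^ J"
        using N by (simp add: \<delta>_def power_divide powr_power mult.commute)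
      also have "\<dots> \<le> N powr (- (2 * t)) / D"
      proof (rule frac_le)
        show "N powr (- \<epsilon> / 2 * real J) \<le> N powr (- (2 * t))"
          using N J(2) \<epsilon> by (intro powr_mono) (auto simp: field_simps)
        show "D \<le> D ^ J" using D J by (simp add: self_le_power)
      qed (use D in auto)
      finally have 2: "\<delta> ^ J \<le> N powr (- (2 * t)) / D" .
      have "16 * real J * real h ^ 2 * \<delta> ^ J \<le> (D * N powr (2 * t)) * (N powr (- (2 * t)) / D)"
        using D \<delta> by (intro mult_mono[OF 1 2]) auto
      also have "\<dots> = 1" using D N by (simp flip: powr_add)
      finally show ?thesis .
    qed
    have bT: "real b \<le> N powr t" if "b \<in> B" for b
    proof -
      have a0: "0 < a 0" "real (a 0) * real b \<le> N powr t" using ab J that by auto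
      have "1 * real b \<le> real (a 0) * real b" using a0 by (intro mult_right_mono) auto
      thus ?thesis using a0 by simp
    qed
    have "real (card B) \<le> 1 + 4 * real J * (2 * ln (N powr t) / \<delta> + 2)"
    proof (rule card_le_by_short_intervals[OF k J(1) h5 n(1) inj _ \<delta> tail B bT Nt(1)])
      fix i b assume ib: "i < 4 * J" "b \<in> B"
      then obtain x :: nat where x: "x > 0" "int (a i) * int b + n = int x ^ k" using ab by blast
      have "real x ^ k = real_of_int (int (a i) * int b + n)" using x by simp
      also have "\<dots> \<le> N powr t + N powr t" using ab ib n(2) Nt by simp (smt (verit))
      finally have "real x ^ k \<le> real h" using h2 by linarith
      \<comment> \<open>Bounding the root by the power itself is good enough, since the power of
        \<open>N\<close> in \<open>h\<close> only influences the choice of \<open>J\<close>.\<close>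
      moreover have "real x ^ 1 \<le> real x ^ k" using x k by (intro power_increasing) auto
      ultimately have "real x \<le> real h" unfolding power_one_right by linarith
      hence "x \<le> h" by (simp only: of_nat_le_iff)
      thus "\<exists>x::nat. 0 < x \<and> x \<le> h \<and> int (a i) * int b + n = int x ^ k" using x by blast
    qed (use ab b1 in auto)
    also have "\<dots> \<le> 1 + 4 * real J * (W * N powr \<epsilon> + 2)"
    proof -
      have "ln N \<le> N powr (\<epsilon> / 2) / (\<epsilon> / 2)" using N \<epsilon> by (intro ln_powr_bound) auto
      hence "2 * t * D * ln N * N powr (\<epsilon> / 2) \<le> 2 * t * D * (N powr (\<epsilon> / 2) / (\<epsilon> / 2)) * N powr (\<epsilon> / 2)"
        using t D by (intro mult_right_mono mult_left_mono) auto
      also have "\<dots> = 2 * t * D * (2 / \<epsilon>) * (N powr (\<epsilon> / 2) * N powr (\<epsilon> / 2))" by simp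
      also have "N powr (\<epsilon> / 2) * N powr (\<epsilon> / 2) = N powr \<epsilon>" by (simp flip: powr_add)
      finally have "2 * t * D * ln N * N powr (\<epsilon> / 2) \<le> W * N powr \<epsilon>" unfolding W_def .
      moreover have "2 * ln (N powr t) / \<delta> = 2 * t * D * ln N * N powr (\<epsilon> / 2)"
        using N by (simp add: \<delta>_def ln_powr powr_minus field_simps)
      ultimately show ?thesis by (intro add_left_mono mult_left_mono add_right_mono) auto
    qed
    also have "\<dots> \<le> C * N powr \<epsilon>"
    proof -
      have "1 \<le> N powr \<epsilon>" using N \<epsilon> by (simp add: ge_one_powr_ge_zero)
      hence "(1 + 8 * real J) * 1 \<le> (1 + 8 * real J) * N powr \<epsilon>" by (intro mult_left_mono) auto
      moreover have "1 + 4 * real J * (W * N powr \<epsilon> + 2) = 1 + 8 * real J + 4 * real J * W * N powr \<epsilon>"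
        by (simp add: distrib_left mult.assoc)
      ultimately show ?thesis unfolding C_def distrib_right[of _ "4 * real J * W"] by simp
    qed
    finally show ?thesis .
  qed (use Cpos in simp)
  show thesis using Cpos main by (rule that)
qed

section \<open>Conclusion\<close>

text \<open>The arithmetic condition of \<open>BD\<close> for finite sets; it is symmetric and
  passes to subsets, which \<open>PM_le\<close> exploits for infinite sets.\<close>

definition grid :: "nat \<Rightarrow> int \<Rightarrow> nat set \<Rightarrow> nat set \<Rightarrow> bool" where
  "grid k n A B \<longleftrightarrow> finite A \<and> finite B \<and> A \<subseteq> {0<..} \<and> B \<subseteq> {0<..} \<and>
     (\<forall>a\<in>A. \<forall>b\<in>B. pos_power k (int a * int b + n))"

lemma grid_commute: "grid k n A B \<Longrightarrow> grid k n B A"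
proof -
  assume g: "grid k n A B"
  have "pos_power k (int b * int a + n)" if "a \<in> A" "b \<in> B" for a b
    using g that unfolding grid_def mult.commute[of "int b"] by blast
  thus ?thesis using g unfolding grid_def by blast
qed

lemma grid_enumeration:
  assumes "grid k n A B"
  obtains a b :: "nat \<Rightarrow> nat" where
    "\<And>i. i < card A \<Longrightarrow> 0 < a i" "\<And>j. j < card B \<Longrightarrow> 0 < b j"
    "\<And>i j. i < j \<Longrightarrow> j < card A \<Longrightarrow> a i < a j" "\<And>i j. i < j \<Longrightarrow> j < card B \<Longrightarrow> b i < b j"
    "\<And>i j. i < card A \<Longrightarrow> j < card B \<Longrightarrow> pos_power k (int (a i) * int (b j) + n)"
proof -
  have fin: "finite A" "finite B" and sub: "A \<subseteq> {0<..}" "B \<subseteq> {0<..}" using assms by (auto simp: grid_def)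
  obtain a where a: "bij_betw a {..<card A} A" "strict_mono_on {..<card A} a"
    using ex_bij_betw_strict_mono_card[OF fin(1)] by blast
  obtain b where b: "bij_betw b {..<card B} B" "strict_mono_on {..<card B} b"
    using ex_bij_betw_strict_mono_card[OF fin(2)] by blast
  have aA: "a i \<in> A" if "i < card A" for i using bij_betwE[OF a(1)] that by blast
  have bB: "b j \<in> B" if "j < card B" for j using bij_betwE[OF b(1)] that by blast
  show thesis
  proof (rule that[of a b])
    show "0 < a i" if "i < card A" for i using aA[OF that] sub by auto
    show "0 < b j" if "j < card B" for j using bB[OF that] sub by auto
    show "a i < a j" if "i < j" "j < card A" for i j
      using strict_mono_onD[OF a(2), of i j] that by simp
    show "b i < b j" if "i < j" "j < card B" for i j
      using strict_mono_onD[OF b(2), of i j] that by simp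
    show "pos_power k (int (a i) * int (b j) + n)" if "i < card A" "j < card B" for i j
      using assms aA[OF that(1)] bB[OF that(2)] unfolding grid_def by blast
  qed
qed

lemma card_le_roots:
  fixes a k m :: nat and b :: "nat \<Rightarrow> nat" and X :: real
  assumes k: "k \<ge> 1" and a: "a > 0" and b: "inj_on b {..<m}" and X: "X \<ge> 1"
    and pw: "\<And>j. j < m \<Longrightarrow> pos_power k (int a * int (b j) + n)"
    and le: "\<And>j. j < m \<Longrightarrow> real a * real (b j) + real_of_int n \<le> X"
  shows "real m \<le> X powr (1 / real k)"
proof -
  have "\<forall>j\<in>{..<m}. \<exists>x::nat. x > 0 \<and> int a * int (b j) + n = int x ^ k" using pw by blast
  then obtain x :: "nat \<Rightarrow> nat" where x: "\<And>j. j < m \<Longrightarrow> x j > 0" "\<And>j. j < m \<Longrightarrow> int a * int (b j) + n = int (x j) ^ k"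
    by (metis lessThan_iff)
  have "inj_on x {..<m}"
  proof (rule inj_onI)
    fix i j assume ij: "i \<in> {..<m}" "j \<in> {..<m}" "x i = x j"
    hence "int a * int (b i) + n = int a * int (b j) + n" using x(2)[of i] x(2)[of j] by simp
    hence "b i = b j" using a by simp
    thus "i = j" using b ij by (auto simp: inj_on_def)
  qed
  moreover have "x ` {..<m} \<subseteq> {1..nat \<lfloor>X powr (1 / real k)\<rfloor>}"
  proof
    fix y assume "y \<in> x ` {..<m}"
    then obtain j where j: "j < m" "y = x j" by auto
    have "real (x j) ^ k = real_of_int (int a * int (b j) + n)" using x(2)[OF j(1)] by simp
    also have "\<dots> \<le> X" using le[OF j(1)] by simp
    finally have "(real (x j) ^ k) powr (1 / real k) \<le> X powr (1 / real k)" by (intro powr_mono2) auto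
    moreover have "(real (x j) ^ k) powr (1 / real k) = real (x j)"
      using x(1)[OF j(1)] k by (simp add: powr_powr flip: powr_realpow)
    ultimately have "x j \<le> nat \<lfloor>X powr (1 / real k)\<rfloor>" by (simp add: le_nat_floor)
    thus "y \<in> {1..nat \<lfloor>X powr (1 / real k)\<rfloor>}" using j x(1)[OF j(1)] by simp
  qed
  ultimately have "card {..<m} \<le> card {1..nat \<lfloor>X powr (1 / real k)\<rfloor>}"
    by (intro card_inj_on_le) auto
  hence "m \<le> nat \<lfloor>X powr (1 / real k)\<rfloor>" by simp
  thus ?thesis using X by (simp add: le_nat_iff le_floor_iff)
qed

text \<open>\<open>product_bound\<close> for \<open>a i\<close> and \<open>b j\<close> uses
  \<open>rk_nat k - 1\<close> larger elements of \<open>A\<close> and \<open>J0 + 4\<close> larger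
  elements of \<open>B\<close>. Hence it covers all but the top \<open>M\<close> elements of
  \<open>B\<close>, where \<open>M\<close> depends on \<open>k\<close> only. The root count needs it
  for \<open>a 0\<close>, the short intervals for the smallest \<open>4 * J\<close> elements of
  \<open>A\<close>.\<close>

lemma grid_card_bounds:
  fixes k :: nat and \<epsilon> :: real
  assumes k: "k \<ge> 3" and \<epsilon>: "\<epsilon> > 0"
  obtains C :: real and R :: nat where "C > 0"
    "\<And>N n A B. large_for k N \<Longrightarrow> n \<noteq> 0 \<Longrightarrow> \<bar>real_of_int n\<bar> \<le> N \<Longrightarrow> grid k n A B \<Longrightarrow>
     (rk_nat k \<le> card A \<longrightarrow> real (card B) \<le> C * N powr (tk k / real k)) \<and>
     (R \<le> card A \<longrightarrow> real (card B) \<le> C * N powr \<epsilon>)"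
proof -
  obtain J0 where J0: "10000 * real k ^ 2 < 2 ^ J0"
    using real_arch_pow[of 2 "10000 * real k ^ 2"] by auto
  define M where "M = J0 + 4"
  have k2: "k \<ge> 2" and t: "tk k \<ge> 1" using k tk_gt_1[OF k] by auto
  obtain J :: nat and C where C: "C > 0" and few: "\<And>N n a B. N \<ge> 1 \<Longrightarrow> n \<noteq> 0 \<Longrightarrow> \<bar>real_of_int n\<bar> \<le> N \<Longrightarrow>
      inj_on a {..<4*J} \<Longrightarrow> finite B \<Longrightarrow>
      (\<forall>i<4*J. \<forall>b\<in>B. 0 < a i \<and> real (a i) * real b \<le> N powr tk k \<and> pos_power k (int (a i) * int b + n)) \<Longrightarrow>
      real (card B) \<le> C * N powr \<epsilon>"
    apply (rule few_solutions[OF k2 \<epsilon> t])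
    subgoal premises p by (rule p(1)[OF p(2,3)])
    done
  have main: "(rk_nat k \<le> card A \<longrightarrow> real (card B) \<le> (real M + 2 + C) * N powr (tk k / real k)) \<and>
     (4 * J + rk_nat k \<le> card A \<longrightarrow> real (card B) \<le> (real M + 2 + C) * N powr \<epsilon>)"
    if N: "large_for k N" and n: "n \<noteq> 0" "\<bar>real_of_int n\<bar> \<le> N" and g: "grid k n A B" for N n A B
  proof -
    obtain a b :: "nat \<Rightarrow> nat" where
      apos: "\<And>i. i < card A \<Longrightarrow> 0 < a i" and bpos: "\<And>j. j < card B \<Longrightarrow> 0 < b j" and
      amono: "\<And>i j. i < j \<Longrightarrow> j < card A \<Longrightarrow> a i < a j" and bmono: "\<And>i j. i < j \<Longrightarrow> j < card B \<Longrightarrow> b i < b j" and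
      pw: "\<And>i j. i < card A \<Longrightarrow> j < card B \<Longrightarrow> pos_power k (int (a i) * int (b j) + n)"
      using grid_enumeration[OF g] by blast
    have N1: "N > 1" using N by (simp add: large_for_def)
    define m where "m = card B - M"
    have Bm: "card B \<le> M + m" by (simp add: m_def)
    have small: "real (a i) * real (b j) < N powr tk k" if i: "i + rk_nat k \<le> card A" and j: "j < m" for i j
    proof -
      have r0: "0 < rk_nat k" by (simp add: rk_nat_def)
      have "real (a (i + 0)) * real (b (j + 0)) < N powr tk k"
      proof (rule product_bound[OF k n N, of J0 "\<lambda>i'. a (i + i')" "\<lambda>j'. b (j + j')"])
        show "10000 * (real k)\<^sup>2 \<le> 2 ^ J0" using J0 by simp
        show "0 < a (i + 0)" using apos[of i] i r0 by simp
        show "a (i + i') < a (i + Suc i')" if "Suc i' < rk_nat k" for i'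
          using amono[of "i + i'" "i + Suc i'"] i that by simp
        show "0 < b (j + 0)" using bpos[of j] j by (simp add: m_def)
        show "b (j + j') < b (j + Suc j')" if "j' < J0 + 4" for j'
          using bmono[of "j + j'" "j + Suc j'"] j that by (simp add: m_def M_def)
        show "pos_power k (int (a (i + i')) * int (b (j + j')) + n)" if "i' < rk_nat k" "j' \<le> J0 + 4" for i' j'
        proof (rule pw)
          show "i + i' < card A" using i that by simp
          show "j + j' < card B" using j that by (simp add: m_def M_def)
        qed
      qed
      thus ?thesis by simp
    qed
    have binj: "inj_on b {..<m}"
    proof (rule linorder_inj_onI')
      fix i j assume "i \<in> {..<m}" "j \<in> {..<m}" "i < j"
      hence "b i < b j" by (intro bmono) (auto simp: m_def)
      thus "b i \<noteq> b j" by simp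
    qed
    have mB: "j < card B" if "j < m" for j using that by (simp add: m_def)
    have Nt: "1 \<le> N powr tk k" "N \<le> N powr tk k" using N1 t powr_mono[of 1 "tk k" N] by (auto simp: ge_one_powr_ge_zero)
    show ?thesis
    proof (intro conjI impI)
      assume K: "rk_nat k \<le> card A"
      have r0: "0 < rk_nat k" by (simp add: rk_nat_def)
      have "real m \<le> (2 * N powr tk k) powr (1 / real k)"
      proof (rule card_le_roots[of k "a 0" b m])
        show "real (a 0) * real (b j) + real_of_int n \<le> 2 * N powr tk k" if "j < m" for j
          using small[of 0 j] K that n(2) Nt by simp
        show "pos_power k (int (a 0) * int (b j) + n)" if "j < m" for j
          using pw[of 0 j] K r0 mB[OF that] by simp
      qed (use k apos[of 0] K r0 binj Nt in auto)
      also have "\<dots> = 2 powr (1 / real k) * N powr (tk k / real k)"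
        using N1 by (simp add: powr_mult powr_powr)
      also have "\<dots> \<le> 2 * N powr (tk k / real k)"
      proof -
        have "2 powr (1 / real k) \<le> 2 powr (1::real)" using k by (intro powr_mono) auto
        thus ?thesis by (intro mult_right_mono) auto
      qed
      finally have m: "real m \<le> 2 * N powr (tk k / real k)" .
      have one: "1 \<le> N powr (tk k / real k)" using N1 t by (simp add: ge_one_powr_ge_zero)
      have "real (card B) \<le> real M * 1 + real m" using Bm by (simp flip: of_nat_add)
      also have "\<dots> \<le> real M * N powr (tk k / real k) + 2 * N powr (tk k / real k)"
        using m one by (intro add_mono mult_left_mono) auto
      also have "\<dots> \<le> (real M + 2 + C) * N powr (tk k / real k)"
        using C by (simp add: distrib_right)
      finally show "real (card B) \<le> (real M + 2 + C) * N powr (tk k / real k)" .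
    next
      assume K: "4 * J + rk_nat k \<le> card A"
      have r0: "0 < rk_nat k" by (simp add: rk_nat_def)
      have "real (card (b ` {..<m})) \<le> C * N powr \<epsilon>"
      proof (rule few[of N n a])
        show "inj_on a {..<4*J}"
        proof (rule linorder_inj_onI')
          fix i j assume "i \<in> {..<4*J}" "j \<in> {..<4*J}" "i < j"
          hence "a i < a j" using K by (intro amono) auto
          thus "a i \<noteq> a j" by simp
        qed
        show "\<forall>i<4 * J. \<forall>b\<in>b ` {..<m}. 0 < a i \<and> real (a i) * real b \<le> N powr tk k \<and> pos_power k (int (a i) * int b + n)"
        proof (intro allI impI ballI)
          fix i y assume i: "i < 4 * J" and "y \<in> b ` {..<m}"
          then obtain j where j: "j < m" "y = b j" by auto
          have "i < card A" using i K by simp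
          thus "0 < a i \<and> real (a i) * real y \<le> N powr tk k \<and> pos_power k (int (a i) * int y + n)"
            using apos[of i] small[of i j] pw[of i j] mB[OF j(1)] j i K by simp
        qed
      qed (use N1 n in auto)
      hence m: "real m \<le> C * N powr \<epsilon>" using binj by (simp add: card_image)
      have one: "1 \<le> N powr \<epsilon>" using N1 \<epsilon> by (simp add: ge_one_powr_ge_zero)
      have "real (card B) \<le> real M * 1 + real m" using Bm by (simp flip: of_nat_add)
      also have "\<dots> \<le> real M * N powr \<epsilon> + C * N powr \<epsilon>"
        using m one by (intro add_mono mult_left_mono) auto
      also have "\<dots> \<le> (real M + 2 + C) * N powr \<epsilon>" by (simp add: distrib_right)
      finally show "real (card B) \<le> (real M + 2 + C) * N powr \<epsilon>" .
    qed
  qed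
  have "real M + 2 + C > 0" using C by simp
  thus thesis using main by (rule that)
qed

text \<open>If both sets have at least \<open>R\<close> elements, each is bounded by a multiple of
  \<open>N powr (\<epsilon> / 2)\<close>. Otherwise one of them has fewer than \<open>R\<close>
  elements, so the exponent \<open>tk k / k\<close> is paid only once, for the other.\<close>

lemma grid_product_bounds:
  fixes k :: nat and \<epsilon> :: real
  assumes k: "k \<ge> 3" and \<epsilon>: "\<epsilon> > 0"
  obtains C :: real and R :: nat where "C > 0"
    "\<And>N n A B. large_for k N \<Longrightarrow> n \<noteq> 0 \<Longrightarrow> \<bar>real_of_int n\<bar> \<le> N \<Longrightarrow> grid k n A B \<Longrightarrow>
     (rk_nat k \<le> card A \<longrightarrow> rk_nat k \<le> card B \<longrightarrow> real (card A * card B) \<le> C * N powr (tk k / real k + \<epsilon>)) \<and>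
     (R \<le> card A \<longrightarrow> R \<le> card B \<longrightarrow> real (card A * card B) \<le> C * N powr \<epsilon>)"
proof -
  define \<eta> where "\<eta> = \<epsilon> / 2"
  have \<eta>: "\<eta> > 0" "\<eta> + \<eta> = \<epsilon>" using \<epsilon> by (auto simp: \<eta>_def)
  obtain C and R :: nat where C: "C > 0" and bd: "\<And>N n A B. large_for k N \<Longrightarrow> n \<noteq> 0 \<Longrightarrow> \<bar>real_of_int n\<bar> \<le> N \<Longrightarrow> grid k n A B \<Longrightarrow>
     (rk_nat k \<le> card A \<longrightarrow> real (card B) \<le> C * N powr (tk k / real k)) \<and>
     (R \<le> card A \<longrightarrow> real (card B) \<le> C * N powr \<eta>)"
    apply (rule grid_card_bounds[OF k \<eta>(1)])
    subgoal premises p by (rule p(1)[OF p(2,3)])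
    done
  define C' where "C' = C * C + real R * C"
  have C': "C' > 0" using C by (auto simp: C'_def intro!: add_pos_nonneg)
  have main: "(rk_nat k \<le> card A \<longrightarrow> rk_nat k \<le> card B \<longrightarrow> real (card A * card B) \<le> C' * N powr (tk k / real k + \<epsilon>)) \<and>
     (R \<le> card A \<longrightarrow> R \<le> card B \<longrightarrow> real (card A * card B) \<le> C' * N powr \<epsilon>)"
    if N: "large_for k N" and n: "n \<noteq> 0" "\<bar>real_of_int n\<bar> \<le> N" and g: "grid k n A B" for N n A B
  proof -
    note bB = bd[OF N n g] and bA = bd[OF N n grid_commute[OF g]]
    have N1: "N \<ge> 1" using N by (simp add: large_for_def)
    have tpos: "tk k / real k \<ge> 0" using tk_gt_1[OF k] by simp
    have both: "real (card A * card B) \<le> C' * N powr \<epsilon>" if "R \<le> card A" "R \<le> card B"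
    proof -
      have "real (card A * card B) \<le> (C * N powr \<eta>) * (C * N powr \<eta>)"
        unfolding of_nat_mult using bA bB that C by (intro mult_mono) auto
      also have "\<dots> = C * C * N powr \<epsilon>" by (simp only: \<eta>(2)[symmetric] powr_add mult_ac)
      also have "\<dots> \<le> C' * N powr \<epsilon>" using C by (intro mult_right_mono) (auto simp: C'_def)
      finally show ?thesis .
    qed
    have mono: "N powr \<epsilon> \<le> N powr (tk k / real k + \<epsilon>)" "N powr (tk k / real k) \<le> N powr (tk k / real k + \<epsilon>)"
      using N1 \<epsilon> tpos by (auto intro: powr_mono)
    have one: "real (card A * card B) \<le> C' * N powr (tk k / real k + \<epsilon>)"
      if K: "rk_nat k \<le> card A" "rk_nat k \<le> card B"
    proof -
      have RC: "real R * C * N powr (tk k / real k) \<le> C' * N powr (tk k / real k + \<epsilon>)"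
        using C mono by (intro mult_mono) (auto simp: C'_def)
      consider "R \<le> card A" "R \<le> card B" | "card A < R" | "card B < R" by linarith
      thus ?thesis
      proof cases
        case 1
        have "C' * N powr \<epsilon> \<le> C' * N powr (tk k / real k + \<epsilon>)" using mono C' by (intro mult_left_mono) auto
        with both[OF 1] show ?thesis by linarith
      next
        case 2
        have "real (card A * card B) \<le> real R * (C * N powr (tk k / real k))"
          unfolding of_nat_mult using bB K 2 C by (intro mult_mono) auto
        thus ?thesis using RC by (simp add: mult.assoc)
      next
        case 3
        have "real (card A * card B) \<le> (C * N powr (tk k / real k)) * real R"
          unfolding of_nat_mult using bA K 3 C by (intro mult_mono) auto
        thus ?thesis using RC by (simp add: mult_ac)
      qed
    qed
    show ?thesis using both one by blast
  qed
  show thesis using C' main by (rule that)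
qed

section \<open>Uniformity in \<open>n\<close> and passage to the supremum\<close>

lemma large_for_eventually:
  assumes "k \<ge> 3"
  obtains K where "K \<ge> 1" "\<And>N. N \<ge> K \<Longrightarrow> large_for k N"
proof -
  define p q s where "p = real k * ln 4" and "q = 2 * ln k + 3 * ln 2" and "s = ln 4 / (tk k - 1)"
  define l where "l = 1 + 100 * p + 100 * q + s"
  have t: "tk k - 1 > 0" using tk_gt_1[OF assms] by simp
  have nn: "0 \<le> p" "0 \<le> q" "0 \<le> s"
    using assms t by (auto simp: p_def q_def s_def intro!: add_nonneg_nonneg divide_nonneg_pos)
  show thesis
  proof (rule that[of "exp l"])
    show "exp l \<ge> 1" using nn by (simp add: l_def)
    fix N assume N: "N \<ge> exp l"
    have Npos: "N > 0" using N exp_gt_zero[of l] by linarith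
    have lN: "l \<le> ln N" using N Npos by (simp add: ln_ge_iff)
    have "ln N > 0" using lN nn unfolding l_def by linarith
    hence "N > 1" using Npos by simp
    moreover have "p \<le> ln N / 100" "q \<le> ln N / 100" "s \<le> ln N" using lN nn unfolding l_def by linarith+
    ultimately show "large_for k N"
      using t by (auto simp: large_for_def p_def q_def s_def pos_divide_le_eq mult.commute)
  qed
qed

text \<open>The supremum also ranges over infinite sets. An infinite set has finite subsets of any
  size, and together with a nonempty finite part of the other set these would violate
  \<open>fin\<close>; \<open>R > 0\<close> provides the nonemptiness.\<close>

lemma PM_le:
  fixes X R :: real
  assumes R: "R > 0" and X: "X \<ge> 0"
    and fin: "\<And>A B. grid k n A B \<Longrightarrow> R \<le> real (card A) \<Longrightarrow> R \<le> real (card B) \<Longrightarrow> real (card A * card B) \<le> X"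
  shows "ereal_of_enat (PM k n R) \<le> ereal X"
proof -
  have "PM k n R \<le> enat (nat \<lfloor>X\<rfloor>)"
    unfolding PM_def
  proof (rule Sup_least)
    fix p assume "p \<in> {ecard A * ecard B | A B. BD k n A B \<and> ereal_of_enat (min (ecard A) (ecard B)) \<ge> ereal R}"
    then obtain A B where p: "p = ecard A * ecard B" and BD: "BD k n A B"
      and "ereal R \<le> ereal_of_enat (min (ecard A) (ecard B))" by blast
    hence RA: "ereal R \<le> ereal_of_enat (ecard A)" and RB: "ereal R \<le> ereal_of_enat (ecard B)"
      by (auto intro: order_trans simp: ereal_of_enat_le_iff)
    define m where "m = nat \<lceil>R\<rceil>"
    have m: "m \<ge> 1" "R \<le> real m" using R unfolding m_def by linarith+
    have sub: "\<exists>A'\<subseteq>A. finite A' \<and> card A' = L" if "infinite A" for A :: "nat set" and L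
      using infinite_arbitrarily_large[OF that] by blast
    have grid: "grid k n A' B'" if "A' \<subseteq> A" "finite A'" "B' \<subseteq> B" "finite B'" for A' B'
      using BD that unfolding BD_def grid_def by blast
    have smaller: "\<exists>A'\<subseteq>S. finite A' \<and> R \<le> real (card A') \<and> 1 \<le> card A'" if "ereal R \<le> ereal_of_enat (ecard S)" for S :: "nat set"
    proof (cases "finite S")
      case True
      hence "R \<le> real (card S)" using that by (simp add: ecard_def)
      thus ?thesis using True R by (intro exI[of _ S]) auto
    next
      case False
      thus ?thesis using sub[OF False, of m] m by auto
    qed
    define L where "L = m + nat \<lceil>X\<rceil> + 1"
    have L: "R \<le> real L" "X < real L" using m X unfolding L_def by linarith+
    have finA: "finite A"
    proof (rule ccontr)
      assume "infinite A"
      then obtain A' where A': "A' \<subseteq> A" "finite A'" "card A' = L" using sub by blast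
      obtain B' where B': "B' \<subseteq> B" "finite B'" "R \<le> real (card B')" "1 \<le> card B'" using smaller[OF RB] by blast
      have "real (card A' * card B') \<le> X" by (rule fin[OF grid]) (use A' B' L in auto)
      moreover have "L * 1 \<le> card A' * card B'" using A' B' by (intro mult_le_mono) auto
      ultimately show False using L by (simp del: of_nat_mult)
    qed
    have finB: "finite B"
    proof (rule ccontr)
      assume "infinite B"
      then obtain B' where B': "B' \<subseteq> B" "finite B'" "card B' = L" using sub by blast
      obtain A' where A': "A' \<subseteq> A" "finite A'" "R \<le> real (card A')" "1 \<le> card A'" using smaller[OF RA] by blast
      have "real (card A' * card B') \<le> X" by (rule fin[OF grid]) (use A' B' L in auto)
      moreover have "1 * L \<le> card A' * card B'" using A' B' by (intro mult_le_mono) auto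
      ultimately show False using L by (simp del: of_nat_mult)
    qed
    have "real (card A * card B) \<le> X"
      by (rule fin[OF grid]) (use finA finB RA RB in \<open>auto simp: ecard_def\<close>)
    hence "card A * card B \<le> nat \<lfloor>X\<rfloor>" by (simp add: le_nat_floor)
    thus "p \<le> enat (nat \<lfloor>X\<rfloor>)" using finA finB by (simp add: p ecard_def)
  qed
  hence "ereal_of_enat (PM k n R) \<le> ereal_of_enat (enat (nat \<lfloor>X\<rfloor>))" by (simp only: ereal_of_enat_le_iff)
  also have "\<dots> \<le> ereal X" using X by simp
  finally show ?thesis .
qed

text \<open>The numerator is at least 1: for \<open>|n| = 1\<close> the convention
  \<open>ln 0 = 0\<close> makes the double logarithm 0, and for \<open>|n| \<ge> 2\<close> it is at
  least \<open>ln (1 / 2)\<close>, hence at least -1. For \<open>k = 3\<close>,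
  \<open>ln 2 \<le> 1\<close> raises the 8 to \<open>rk 3 = 9\<close>; otherwise 8 is
  enough.\<close>

lemma rk_le_loglog_bound:
  fixes n :: int and k :: nat
  assumes k: "k \<ge> 3" and n: "n \<noteq> 0"
  shows "rk k \<le> (ln (ln \<bar>real_of_int n\<bar>) + 3.3) / ln (real k - 1) + 8"
proof -
  have lnk: "ln (real k - 1) > 0" using k by simp
  have "ln (ln \<bar>real_of_int n\<bar>) \<ge> - 1"
  proof (cases "\<bar>n\<bar> = 1")
    case True
    hence "\<bar>real_of_int n\<bar> = 1" by linarith
    thus ?thesis by simp
  next
    case False
    hence "\<bar>n\<bar> \<ge> 2" using n by linarith
    hence "ln 2 \<le> ln \<bar>real_of_int n\<bar>" by simp
    hence *: "1 / 2 \<le> ln \<bar>real_of_int n\<bar>" using ln2_ge_two_thirds by linarith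
    have "- 1 \<le> - ln (2::real)" using ln2_le_25_over_36 by linarith
    also have "\<dots> = ln (1 / 2)" by (simp add: ln_div)
    also have "\<dots> \<le> ln (ln \<bar>real_of_int n\<bar>)" using * by (intro ln_mono) auto
    finally show ?thesis .
  qed
  hence ll: "ln (ln \<bar>real_of_int n\<bar>) + 3.3 \<ge> 1" by simp
  show ?thesis
  proof (cases "k = 3")
    case True
    hence "ln (real k - 1) \<le> 1" using ln2_le_25_over_36 by simp
    hence "1 \<le> (ln (ln \<bar>real_of_int n\<bar>) + 3.3) / ln (real k - 1)" using ll lnk by (simp add: le_divide_eq)
    thus ?thesis using True by (simp add: rk_def)
  next
    case False
    have "0 \<le> (ln (ln \<bar>real_of_int n\<bar>) + 3.3) / ln (real k - 1)" using ll lnk by simp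
    moreover have "rk k \<le> 8" using False by (simp add: rk_def)
    ultimately show ?thesis by linarith
  qed
qed

theorem theorem2p3:
  fixes \<epsilon> :: real and k :: nat
  assumes "\<epsilon> > 0" and "k \<ge> 3"
  shows "(\<exists>C::real. C > 0 \<and> (\<forall>n::int. n \<noteq> 0 \<longrightarrow>
            ereal_of_enat (PM k n (rk k))
              \<le> ereal (C * \<bar>real_of_int n\<bar> powr (tk k / real k + \<epsilon>))))
       \<and> (\<exists>C::real. C > 0 \<and> (\<forall>n::int. n \<noteq> 0 \<longrightarrow>
            ereal_of_enat (PM k n ((ln (ln \<bar>real_of_int n\<bar>) + 3.3) / ln (real k - 1) + 8))
              \<le> ereal (C * \<bar>real_of_int n\<bar> powr (1 / (real k - 2) + \<epsilon>))))"
proof -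
  obtain C and R :: nat where C: "C > 0" and bd: "\<And>N n A B. large_for k N \<Longrightarrow> n \<noteq> 0 \<Longrightarrow> \<bar>real_of_int n\<bar> \<le> N \<Longrightarrow> grid k n A B \<Longrightarrow>
     (rk_nat k \<le> card A \<longrightarrow> rk_nat k \<le> card B \<longrightarrow> real (card A * card B) \<le> C * N powr (tk k / real k + \<epsilon>)) \<and>
     (R \<le> card A \<longrightarrow> R \<le> card B \<longrightarrow> real (card A * card B) \<le> C * N powr \<epsilon>)"
    apply (rule grid_product_bounds[OF assms(2,1)])
    subgoal premises p by (rule p(1)[OF p(2,3)])
    done
  obtain K where K: "K \<ge> 1" "\<And>N. N \<ge> K \<Longrightarrow> large_for k N" using large_for_eventually[OF assms(2)] by blast
  define e where "e = tk k / real k + \<epsilon>"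
  have e: "e > 0" using assms tk_gt_1[OF assms(2)] by (auto simp: e_def intro: add_nonneg_pos)
  have n1: "1 \<le> \<bar>real_of_int n\<bar>" if "n \<noteq> 0" for n using that by linarith
  \<comment> \<open>Taking \<open>N = K * |n|\<close> makes \<open>N\<close> large for every nonzero
    \<open>n\<close> at once, at the price of a constant power of \<open>K\<close>.\<close>
  have KN: "K \<le> K * \<bar>real_of_int n\<bar>" "\<bar>real_of_int n\<bar> \<le> K * \<bar>real_of_int n\<bar>" if "n \<noteq> 0" for n
    using K n1[OF that] by (auto simp: mult_le_cancel_left1 mult_le_cancel_right1)
  have rk_pos: "rk k > 0" by (simp add: rk_def)
  have rk: "real (card A) \<ge> rk k \<longleftrightarrow> rk_nat k \<le> card A" for A :: "nat set"
    by (simp flip: real_rk_nat)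
  have first: "real (card A * card B) \<le> C * K powr e * \<bar>real_of_int n\<bar> powr e"
    if n: "n \<noteq> 0" and g: "grid k n A B" and r: "rk k \<le> real (card A)" "rk k \<le> real (card B)" for n A B
  proof -
    have "real (card A * card B) \<le> C * (K * \<bar>real_of_int n\<bar>) powr e"
      using bd[OF K(2)[OF KN(1)[OF n]] n KN(2)[OF n] g] r by (simp add: rk e_def)
    thus ?thesis using K by (simp add: powr_mult mult.assoc)
  qed
  show ?thesis
  proof (intro conjI)
    show "\<exists>C::real. C > 0 \<and> (\<forall>n::int. n \<noteq> 0 \<longrightarrow>
            ereal_of_enat (PM k n (rk k)) \<le> ereal (C * \<bar>real_of_int n\<bar> powr (tk k / real k + \<epsilon>)))"
    proof (intro exI conjI allI impI)
      show "C * K powr e > 0" using C K by simp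
      show "ereal_of_enat (PM k n (rk k)) \<le> ereal (C * K powr e * \<bar>real_of_int n\<bar> powr (tk k / real k + \<epsilon>))"
        if "n \<noteq> 0" for n
        by (rule PM_le[OF rk_pos]) (use C K first[OF that] in \<open>auto simp: e_def\<close>)
    qed
  next
    \<comment> \<open>From \<open>n0\<close> on, \<open>ln (ln |n|)\<close> is at least
      \<open>R * ln (k - 1)\<close>, so the required size is at least \<open>R\<close> and the bound
      with exponent \<open>\<epsilon>\<close> applies.\<close>
    define n0 where "n0 = exp (exp (real R * ln (real k - 1)))"
    have n0: "n0 \<ge> 1" by (simp add: n0_def)
    define f where "f = 1 / (real k - 2) + \<epsilon>"
    have f: "f \<ge> \<epsilon>" "f > 0" using assms by (auto simp: f_def intro: add_nonneg_pos)
    \<comment> \<open>The second summand handles \<open>|n| < n0\<close> through the first claim,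
      whose power of \<open>|n|\<close> is then at most \<open>n0 powr e\<close>.\<close>
    define C2 where "C2 = C * K powr \<epsilon> + C * K powr e * n0 powr e"
    have C2: "C2 > 0" "C * K powr \<epsilon> \<le> C2" "C * K powr e * n0 powr e \<le> C2"
      using C K n0 by (auto simp: C2_def intro: add_pos_pos)
    show "\<exists>C::real. C > 0 \<and> (\<forall>n::int. n \<noteq> 0 \<longrightarrow>
            ereal_of_enat (PM k n ((ln (ln \<bar>real_of_int n\<bar>) + 3.3) / ln (real k - 1) + 8))
              \<le> ereal (C * \<bar>real_of_int n\<bar> powr (1 / (real k - 2) + \<epsilon>)))"
    proof (intro exI conjI allI impI)
      show "C2 > 0" by (rule C2)
      fix n :: int assume n: "n \<noteq> 0"
      define r where "r = (ln (ln \<bar>real_of_int n\<bar>) + 3.3) / ln (real k - 1) + 8"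
      have rk_r: "rk k \<le> r" unfolding r_def by (rule rk_le_loglog_bound[OF assms(2) n])
      have "ereal_of_enat (PM k n r) \<le> ereal (C2 * \<bar>real_of_int n\<bar> powr f)"
      proof (rule PM_le)
        show "r > 0" using rk_r rk_pos by linarith
        show "0 \<le> C2 * \<bar>real_of_int n\<bar> powr f" using C2 by simp
        fix A B assume g: "grid k n A B" and r: "r \<le> real (card A)" "r \<le> real (card B)"
        show "real (card A * card B) \<le> C2 * \<bar>real_of_int n\<bar> powr f"
        proof (cases "n0 \<le> \<bar>real_of_int n\<bar>")
          case True
          have lnk: "ln (real k - 1) > 0" using assms by simp
          have "exp (real R * ln (real k - 1)) \<le> ln \<bar>real_of_int n\<bar>"
            using True n by (simp add: n0_def ln_ge_iff)
          hence "real R * ln (real k - 1) \<le> ln (ln \<bar>real_of_int n\<bar>)"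
            by (metis exp_gt_zero less_le_trans ln_ge_iff)
          hence "real R * ln (real k - 1) \<le> ln (ln \<bar>real_of_int n\<bar>) + 3.3" by simp
          hence "real R \<le> (ln (ln \<bar>real_of_int n\<bar>) + 3.3) / ln (real k - 1)" using lnk by (simp add: le_divide_eq)
          hence "real R \<le> r" unfolding r_def by linarith
          hence "R \<le> card A" "R \<le> card B" using r by linarith+
          hence "real (card A * card B) \<le> C * (K * \<bar>real_of_int n\<bar>) powr \<epsilon>"
            using bd[OF K(2)[OF KN(1)[OF n]] n KN(2)[OF n] g] by simp
          also have "\<dots> = C * K powr \<epsilon> * \<bar>real_of_int n\<bar> powr \<epsilon>" using K by (simp add: powr_mult mult.assoc)
          also have "\<dots> \<le> C2 * \<bar>real_of_int n\<bar> powr f"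
            using C2 f n1[OF n] by (intro mult_mono powr_mono) auto
          finally show ?thesis .
        next
          case False
          have "real (card A * card B) \<le> C * K powr e * \<bar>real_of_int n\<bar> powr e"
            by (rule first[OF n g]) (use r rk_r in auto)
          also have "\<dots> \<le> C * K powr e * n0 powr e"
            using False C K e by (intro mult_left_mono powr_mono2) auto
          also have "\<dots> \<le> C2 * 1" using C2 by simp
          also have "\<dots> \<le> C2 * \<bar>real_of_int n\<bar> powr f"
            using C2 f n1[OF n] by (intro mult_left_mono) (auto simp: ge_one_powr_ge_zero)
          finally show ?thesis .
        qed
      qed
      thus "ereal_of_enat (PM k n ((ln (ln \<bar>real_of_int n\<bar>) + 3.3) / ln (real k - 1) + 8))
              \<le> ereal (C2 * \<bar>real_of_int n\<bar> powr (1 / (real k - 2) + \<epsilon>))"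
        unfolding r_def f_def .
    qed
  qed
qed

end
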